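(* Let $\mathcal G=(V,E)$ be a decomposable undirected graph with $V=\{1,\dots,d\}$, with sequence of cliques $\mathcal C$ and multiset of separators $\mathcal D$. Suppose that $\boldsymbol Y$ has a multivariate Pareto distribution with positive and continuous density $f_{\boldsymbol Y}$ on $\mathcal L$. Denote the corresponding exponent measure and its density by $\Lambda$ and $\lambda$, respectively. Then the following are equivalent. (i) The distribution of $\boldsymbol Y$ satisfies the pairwise Markov property relative to $\mathcal G$, that is, $Y_i\perp_e Y_j\mid\boldsymbol Y_{\setminus\{i,j\}}$ for all distinct $i,j\in V$ with $(i,j)\notin E$. (ii) The distribution of $\boldsymbol Y$ satisfies the global Markov property relative to $\mathcal G$. (iii) The density $f_{\boldsymbol Y}$ factorizes according to $\mathcal G$, that is, $$f_{\boldsymbol Y}(\boldsymbol y)=\frac{1}{\Lambda(\boldsymbol 1)}\,\frac{\prod_{C\in\mathcal C}\lambda_C(\boldsymbol y_C)}{\prod_{D\in\mathcal D}\lambda_D(\boldsymbol y_D)},\qquad \boldsymbol y\in\mathcal L,$$ where the marginals $\lambda_I$ are positive, continuous and homogeneous of order $-(|I|+1)$ for any non-empty $I\subset V$. In all cases, the graph $\mathcal G$ is necessarily connected.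
   Context: Setting. $V=\{1,\dots,d\}$, $d\ge 2$; $\mathcal E=[0,\infty)^d\setminus\{\boldsymbol 0\}$; $\mathcal L=\{\boldsymbol x\in\mathcal E:\|\boldsymbol x\|_\infty>1\}$. For $I\subset V$, $\boldsymbol x_I=(x_i)_{i\in I}$ and $\boldsymbol x_{\setminus I}=(x_i)_{i\in V\setminus I}$. Multivariate Pareto distribution with density: the exponent measure $\Lambda$ is a Radon measure on $\mathcal E$, placing no mass on lower-dimensional faces, with density $\lambda$ satisfying (L1) $\lambda(t\boldsymbol y)=t^{-(d+1)}\lambda(\boldsymbol y)$ for all $t>0$, $\boldsymbol y\in\mathcal E$, and (L2) $\int_{\{\boldsymbol y\in\mathcal E:\,y_i>1\}}\lambda(\boldsymbol y)\,\mathrm d\boldsymbol y=1$ for $i=1,\dots,d$. The associated multivariate Pareto random vector $\boldsymbol Y$ takes values in $\mathcal L$ and has Lebesgue density $f_{\boldsymbol Y}(\boldsymbol y)=\lambda(\boldsymbol y)/\Lambda(\boldsymbol 1)$, $\boldsymbol y\in\mathcal L$, where $\Lambda(\boldsymbol 1)$ denotes $\Lambda(\mathcal E\setminus[0,1]^d)=\int_{\mathcal L}\lambda(\boldsymbol y)\,\mathrm d\boldsymbol y\in[1,d]$. Marginals: $\lambda_I(\boldsymbol y_I)=\int_{[0,\infty)^{d-|I|}}\lambda(\boldsymbol y)\,\mathrm d\boldsymbol y_{\setminus I}$ for non-empty $I\subset V$; convention $\lambda_\emptyset:=1$. Conditioned vectors: for $k\in V$, $\boldsymbol Y^k$ is $\boldsymbol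 Y$ conditioned on $\{Y_k>1\}$; it is supported on the product space $\mathcal L^k=\{\boldsymbol x\in\mathcal L:x_k>1\}$, where its density equals $\lambda$. Conditional independence $\perp_e$: for disjoint $A,B,C\subset V$ with union $V$, $A$ and $C$ non-empty, $\boldsymbol Y_A\perp_e\boldsymbol Y_C\mid\boldsymbol Y_B$ means that for every $k\in V$, $\boldsymbol Y^k_A$ and $\boldsymbol Y^k_C$ are conditionally independent given $\boldsymbol Y^k_B$ in the usual sense (if $B=\emptyset$: independent). Global Markov property of $\boldsymbol Y$ relative to $\mathcal G$: for every $k\in V$, $\boldsymbol Y^k$ satisfies the usual global Markov property, i.e. for all disjoint $A,B,C\subset V$ such that $B$ separates $A$ from $C$ in $\mathcal G$, $\boldsymbol Y^k_A$ and $\boldsymbol Y^k_C$ are conditionally independent given $\boldsymbol Y^k_B$. Graphs: cliques are maximal complete subsets of nodes. Decomposable means chordal (triangulated). For a decomposable graph the cliques can be ordered $C_1,\dots,C_m$ so that for $i=2,\dots,m$, $D_i:=C_i\cap\bigcup_{j<i}C_j\subset C_l$ for some $l<i$ (running intersection property); $\mathcal C=\{C_1,\dots,C_m\}$ and $\mathcal D$ is the multiset $\{D_2,\dots,D_m\}$ of separators.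
   Formalization: Positivity of the density (assumed) and of the marginals (claimed) is taken only at vectors with all coordinates positive, and the factorization is asserted at those y in L where the separator product is non-zero, since on faces with y_D = 0 the marginal λ_D diverges and the quotient is undefined. *)

theory Defs
  imports "HOL-Probability.Probability" "HOL-Library.Multiset"
begin

section \<open>Undirected graphs\<close>

text \<open>A simple undirected graph on the vertex set \<open>V\<close>: each undirected edge is represented by
  both of its orientations.\<close>

definition undirected_graph :: "nat set \<Rightarrow> (nat \<times> nat) set \<Rightarrow> bool" where
  "undirected_graph V E \<longleftrightarrow> finite V \<and> E \<subseteq> V \<times> V \<and> sym E \<and> irrefl E"

definition graph_path :: "nat set \<Rightarrow> (nat \<times> nat) set \<Rightarrow> nat list \<Rightarrow> bool" where
  "graph_path V E p \<longleftrightarrow>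
     p \<noteq> [] \<and> set p \<subseteq> V \<and> distinct p \<and> successively (\<lambda>u v. (u, v) \<in> E) p"

definition connected_graph :: "nat set \<Rightarrow> (nat \<times> nat) set \<Rightarrow> bool" where
  "connected_graph V E \<longleftrightarrow>
     (\<forall>u\<in>V. \<forall>v\<in>V. \<exists>p. graph_path V E p \<and> hd p = u \<and> last p = v)"

definition graph_separates ::
    "nat set \<Rightarrow> (nat \<times> nat) set \<Rightarrow> nat set \<Rightarrow> nat set \<Rightarrow> nat set \<Rightarrow> bool" where
  "graph_separates V E B A C \<longleftrightarrow>
     (\<forall>p. graph_path V E p \<and> hd p \<in> A \<and> last p \<in> C \<longrightarrow> set p \<inter> B \<noteq> {})"

definition graph_cycle :: "nat set \<Rightarrow> (nat \<times> nat) set \<Rightarrow> nat list \<Rightarrow> bool" where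
  "graph_cycle V E p \<longleftrightarrow> graph_path V E p \<and> 3 \<le> length p \<and> (last p, hd p) \<in> E"

text \<open>A chord of a cycle joins two vertices that are not consecutive on the cycle; the last and
  the first entry of the list are consecutive.\<close>

definition decomposable :: "nat set \<Rightarrow> (nat \<times> nat) set \<Rightarrow> bool" where
  "decomposable V E \<longleftrightarrow>
     (\<forall>p. graph_cycle V E p \<and> 4 \<le> length p \<longrightarrow>
        (\<exists>i j. i + 1 < j \<and> j < length p \<and> \<not> (i = 0 \<and> j = length p - 1) \<and> (p ! i, p ! j) \<in> E))"

definition complete_subset :: "nat set \<Rightarrow> (nat \<times> nat) set \<Rightarrow> nat set \<Rightarrow> bool" where
  "complete_subset V E K \<longleftrightarrow> K \<subseteq> V \<and> (\<forall>u\<in>K. \<forall>v\<in>K. u \<noteq> v \<longrightarrow> (u, v) \<in> E)"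

definition cliques :: "nat set \<Rightarrow> (nat \<times> nat) set \<Rightarrow> nat set set" where
  "cliques V E =
     {K. complete_subset V E K \<and> (\<forall>K'. complete_subset V E K' \<and> K \<subseteq> K' \<longrightarrow> K' = K)}"

definition separator :: "nat set list \<Rightarrow> nat \<Rightarrow> nat set" where
  "separator Cs i = Cs ! i \<inter> (\<Union>j<i. Cs ! j)"

text \<open>An enumeration of all cliques with the running intersection property.  List positions
  start at \<open>0\<close>, so the separators belong to the positions from \<open>1\<close> onwards.\<close>

definition clique_sequence :: "nat set \<Rightarrow> (nat \<times> nat) set \<Rightarrow> nat set list \<Rightarrow> bool" where
  "clique_sequence V E Cs \<longleftrightarrow>
     distinct Cs \<and> set Cs = cliques V E \<and>
     (\<forall>i\<in>{1..<length Cs}. \<exists>l<i. separator Cs i \<subseteq> Cs ! l)"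

definition separators :: "nat set list \<Rightarrow> nat set multiset" where
  "separators Cs = mset (map (separator Cs) [1..<length Cs])"


section \<open>Conditional independence\<close>

text \<open>Conditional independence of the random variables \<open>X\<close> and \<open>Y\<close> given the sigma-algebra
  generated by \<open>Z\<close>.  If \<open>Z\<close> takes values in a one-point space (as the vector indexed by the
  empty set does), that sigma-algebra is trivial and the notion is independence.\<close>

definition cond_indep_var ::
    "'a measure \<Rightarrow> 'b measure \<Rightarrow> ('a \<Rightarrow> 'b) \<Rightarrow> 'c measure \<Rightarrow> ('a \<Rightarrow> 'c) \<Rightarrow>
     'e measure \<Rightarrow> ('a \<Rightarrow> 'e) \<Rightarrow> bool" where
  "cond_indep_var M S X T Y N Z \<longleftrightarrow>
     X \<in> measurable M S \<and> Y \<in> measurable M T \<and> Z \<in> measurable M N \<and>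
     (\<forall>A\<in>sets S. \<forall>B\<in>sets T. AE \<omega> in M.
        real_cond_exp M (vimage_algebra (space M) Z N)
            (indicator (X -` A \<inter> Y -` B \<inter> space M)) \<omega> =
        real_cond_exp M (vimage_algebra (space M) Z N) (indicator (X -` A \<inter> space M)) \<omega> *
        real_cond_exp M (vimage_algebra (space M) Z N) (indicator (Y -` B \<inter> space M)) \<omega>)"


section \<open>Multivariate Pareto distributions\<close>

text \<open>Vectors indexed by a finite set \<open>I\<close> are functions that are \<open>undefined\<close> outside \<open>I\<close>;
  topological notions refer to the product topology on functions, which restricts to the Euclidean
  topology on these vectors.  \<open>lebesgue_on_coords I\<close> is Lebesgue measure on them.\<close>

abbreviation lebesgue_on_coords :: "nat set \<Rightarrow> (nat \<Rightarrow> real) measure" where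
  "lebesgue_on_coords I \<equiv> Pi\<^sub>M I (\<lambda>_. lborel)"

definition orthant :: "nat set \<Rightarrow> (nat \<Rightarrow> real) set" where
  "orthant I = {y \<in> I \<rightarrow>\<^sub>E {0..}. y \<noteq> (\<lambda>i\<in>I. 0)}"

definition pareto_space :: "nat \<Rightarrow> (nat \<Rightarrow> real) set" where
  "pareto_space d = {y \<in> orthant {1..d}. 1 < (MAX i\<in>{1..d}. \<bar>y i\<bar>)}"

definition homogeneous :: "nat set \<Rightarrow> real \<Rightarrow> ((nat \<Rightarrow> real) \<Rightarrow> real) \<Rightarrow> bool" where
  "homogeneous I p f \<longleftrightarrow>
     (\<forall>t>0. \<forall>y\<in>orthant I. f (\<lambda>i\<in>I. t * y i) = t powr p * f y)"

text \<open>On the locally compact, second countable space \<open>orthant {1..d}\<close>, a Borel measure is Radon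
  iff it is finite on compact sets.\<close>

definition exponent_measure ::
    "nat \<Rightarrow> (nat \<Rightarrow> real) measure \<Rightarrow> ((nat \<Rightarrow> real) \<Rightarrow> real) \<Rightarrow> bool" where
  "exponent_measure d \<Lambda> lam \<longleftrightarrow>
     lam \<in> borel_measurable (restrict_space (lebesgue_on_coords {1..d}) (orthant {1..d})) \<and>
     (\<forall>y\<in>orthant {1..d}. 0 \<le> lam y) \<and>
     \<Lambda> = density (restrict_space (lebesgue_on_coords {1..d}) (orthant {1..d}))
           (\<lambda>y. ennreal (lam y)) \<and>
     (\<forall>K. compact K \<and> K \<subseteq> orthant {1..d} \<longrightarrow> emeasure \<Lambda> K < \<infinity>) \<and>
     (\<forall>i\<in>{1..d}. emeasure \<Lambda> {y \<in> orthant {1..d}. y i = 0} = 0) \<and>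
     homogeneous {1..d} (- (real d + 1)) lam \<and>
     (\<forall>i\<in>{1..d}.
        (\<integral>\<^sup>+ y \<in> {y \<in> orthant {1..d}. 1 < y i}. ennreal (lam y) \<partial>lebesgue_on_coords {1..d}) = 1)"

definition exponent_function :: "nat \<Rightarrow> (nat \<Rightarrow> real) measure \<Rightarrow> (nat \<Rightarrow> real) \<Rightarrow> real" where
  "exponent_function d \<Lambda> x = measure \<Lambda> (orthant {1..d} - (\<Pi>\<^sub>E i\<in>{1..d}. {0..x i}))"

definition pareto_density ::
    "nat \<Rightarrow> (nat \<Rightarrow> real) measure \<Rightarrow> ((nat \<Rightarrow> real) \<Rightarrow> real) \<Rightarrow> (nat \<Rightarrow> real) \<Rightarrow> real" where
  "pareto_density d \<Lambda> lam y =
     (if y \<in> pareto_space d then lam y / exponent_function d \<Lambda> (\<lambda>_. 1) else 0)"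

definition multivariate_pareto ::
    "nat \<Rightarrow> (nat \<Rightarrow> real) measure \<Rightarrow> ((nat \<Rightarrow> real) \<Rightarrow> real) \<Rightarrow>
     'a measure \<Rightarrow> ('a \<Rightarrow> nat \<Rightarrow> real) \<Rightarrow> bool" where
  "multivariate_pareto d \<Lambda> lam M Y \<longleftrightarrow>
     prob_space M \<and>
     (\<forall>\<omega>\<in>space M. Y \<omega> \<in> pareto_space d) \<and>
     distributed M (lebesgue_on_coords {1..d}) Y (\<lambda>y. ennreal (pareto_density d \<Lambda> lam y))"

text \<open>Where the integral diverges, the library's integral has the value \<open>0\<close>; a positive value of
  \<open>marginal_density\<close> therefore entails convergence.\<close>

definition marginal_density ::
    "nat \<Rightarrow> ((nat \<Rightarrow> real) \<Rightarrow> real) \<Rightarrow> nat set \<Rightarrow> (nat \<Rightarrow> real) \<Rightarrow> real" where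
  "marginal_density d lam I y =
     (if I = {} then 1
      else (LINT z : ({1..d} - I \<rightarrow>\<^sub>E {0..}) | lebesgue_on_coords ({1..d} - I).
              lam (merge I ({1..d} - I) (y, z))))"


section \<open>Markov properties and factorization\<close>

text \<open>The law of \<open>Y\<close> conditioned on the event that its \<open>k\<close>-th coordinate exceeds \<open>1\<close> is the law of
  \<open>Y\<close> under the conditional probability measure given that event.\<close>

definition cond_exceed :: "'a measure \<Rightarrow> ('a \<Rightarrow> nat \<Rightarrow> real) \<Rightarrow> nat \<Rightarrow> 'a measure" where
  "cond_exceed M Y k = uniform_measure M {\<omega> \<in> space M. 1 < Y \<omega> k}"

definition cond_indep_coords ::
    "'a measure \<Rightarrow> ('a \<Rightarrow> nat \<Rightarrow> real) \<Rightarrow> nat set \<Rightarrow> nat set \<Rightarrow> nat set \<Rightarrow> bool" where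
  "cond_indep_coords M Y A C B \<longleftrightarrow>
     cond_indep_var M (Pi\<^sub>M A (\<lambda>_. borel)) (\<lambda>\<omega>. restrict (Y \<omega>) A)
                      (Pi\<^sub>M C (\<lambda>_. borel)) (\<lambda>\<omega>. restrict (Y \<omega>) C)
                      (Pi\<^sub>M B (\<lambda>_. borel)) (\<lambda>\<omega>. restrict (Y \<omega>) B)"

definition extremal_cond_indep ::
    "nat \<Rightarrow> 'a measure \<Rightarrow> ('a \<Rightarrow> nat \<Rightarrow> real) \<Rightarrow> nat set \<Rightarrow> nat set \<Rightarrow> nat set \<Rightarrow> bool" where
  "extremal_cond_indep d M Y A C B \<longleftrightarrow>
     (\<forall>k\<in>{1..d}. cond_indep_coords (cond_exceed M Y k) Y A C B)"

definition pairwise_markov ::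
    "nat \<Rightarrow> (nat \<times> nat) set \<Rightarrow> 'a measure \<Rightarrow> ('a \<Rightarrow> nat \<Rightarrow> real) \<Rightarrow> bool" where
  "pairwise_markov d E M Y \<longleftrightarrow>
     (\<forall>i\<in>{1..d}. \<forall>j\<in>{1..d}. i \<noteq> j \<and> (i, j) \<notin> E \<longrightarrow>
        extremal_cond_indep d M Y {i} {j} ({1..d} - {i, j}))"

definition global_markov ::
    "nat \<Rightarrow> (nat \<times> nat) set \<Rightarrow> 'a measure \<Rightarrow> ('a \<Rightarrow> nat \<Rightarrow> real) \<Rightarrow> bool" where
  "global_markov d E M Y \<longleftrightarrow>
     (\<forall>k\<in>{1..d}. \<forall>A B C.
        A \<subseteq> {1..d} \<and> B \<subseteq> {1..d} \<and> C \<subseteq> {1..d} \<and>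
        A \<inter> B = {} \<and> A \<inter> C = {} \<and> B \<inter> C = {} \<and> graph_separates {1..d} E B A C \<longrightarrow>
        cond_indep_coords (cond_exceed M Y k) Y A C B)"

text \<open>Positivity of the marginals is required at vectors with positive coordinates: a continuous
  density that factorizes over a non-complete graph has zeros on the faces of the orthant, which
  are Lebesgue null sets.  The quotient formula is required at every point of \<open>pareto_space d\<close> at
  which its denominator is non-zero; by the positivity requirement these include all points with
  positive coordinates.  The excluded points lie on the faces, where the quotient may have the form
  \<open>0 / 0\<close> or contain the divergent integral of a marginal at the origin.\<close>

definition density_factorizes ::
    "nat \<Rightarrow> nat set list \<Rightarrow> (nat \<Rightarrow> real) measure \<Rightarrow> ((nat \<Rightarrow> real) \<Rightarrow> real) \<Rightarrow> bool" where
  "density_factorizes d Cs \<Lambda> lam \<longleftrightarrow>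
     (\<forall>I. I \<subseteq> {1..d} \<and> I \<noteq> {} \<longrightarrow>
        (\<forall>y \<in> I \<rightarrow>\<^sub>E {0<..}. 0 < marginal_density d lam I y) \<and>
        continuous_on (orthant I) (marginal_density d lam I) \<and>
        homogeneous I (- (real (card I) + 1)) (marginal_density d lam I)) \<and>
     (\<forall>y \<in> pareto_space d.
        (\<Prod>D\<in>#separators Cs. marginal_density d lam D (restrict y D)) \<noteq> 0 \<longrightarrow>
        pareto_density d \<Lambda> lam y =
          1 / exponent_function d \<Lambda> (\<lambda>_. 1) *
          ((\<Prod>C\<in>set Cs. marginal_density d lam C (restrict y C)) /
           (\<Prod>D\<in>#separators Cs. marginal_density d lam D (restrict y D))))"

end

theory Submission
  imports Defs
begin

text \<open>All three properties are equivalent to the following splitting of \<open>\<lambda>\<close> on the open orthant: for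
  non-adjacent \<open>i \<noteq> j\<close>, the product of the values of \<open>\<lambda>\<close> at \<open>y\<close> and at the point where both
  coordinates are changed equals the product of the values at the two points where only one of them is
  changed. By positivity the identity telescopes from pairs \<open>i, j\<close> to disjoint sets \<open>S, T\<close> without
  edges between them, and by homogeneity it need only be known on a half-space \<open>y\<^sub>k > 1\<close>.

  Integrating it over the changed coordinates yields the density form of conditional independence for
  each \<open>Y\<^sup>k\<close>, hence the global Markov property. Conversely, pairwise conditional independence gives
  the integrated identity over small boxes, and continuity gives it pointwise. Integrating \<open>\<lambda>\<close> over the
  coordinates of the last cliques one after the other gives the factorization; for an empty separator the
  integrated identity would equate a finite quantity with the infinite total mass of \<open>\<lambda>\<close>, which also
  forces the graph to be connected. On the faces of the orthant the formula follows by continuity,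
  because a marginal evaluated at the origin has the value 0 (by homogeneity its integral is 0 or
  infinite).\<close>

section \<open>Integrating out coordinates\<close>

text \<open>Conditional expectations enter only once: given the coordinates in \<open>B\<close>, a
  conditional probability is a quotient of two partial integrals of the density, and clearing the
  denominator leaves a product identity in \<open>ennreal\<close>. Conditioning on the event that
  the \<open>k\<close>-th coordinate exceeds 1 does no harm: the indicator of a half-space involves
  a single coordinate and therefore splits.

  The faces of the orthant are an obstacle, since \<open>lam\<close> may vanish there. Extension by
  zero turns the identity into \<open>0 = 0\<close> as soon as a relevant coordinate is not
  positive. Finiteness of the marginals comes from bounding \<open>lam\<close> by a power of the
  largest coordinate.

  For the factorization, it is not evident that integration preserves the splitting. The marginal on
  the first \<open>l\<close> cliques splits along non-adjacent pairs because it equals the marginal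
  on the first \<open>l + 1\<close> cliques times that of their last separator, divided by that of
  their last clique, and no clique contains a non-adjacent pair. One step thus yields both the next
  factor and the splitting that the following step needs.\<close>

interpretation coords: product_sigma_finite "\<lambda>_::nat. lborel :: real measure"
  by standard

lemma sigma_finite_coords [simp]: "finite I \<Longrightarrow> sigma_finite_measure (lebesgue_on_coords I)"
  by (rule coords.sigma_finite)

text \<open>Integrals over some of the coordinates are functions of a full vector that ignore the
  integrated coordinates; this avoids changing the index set.\<close>

definition coord_integral ::
    "nat set \<Rightarrow> ((nat \<Rightarrow> real) \<Rightarrow> ennreal) \<Rightarrow> (nat \<Rightarrow> real) \<Rightarrow> ennreal" where
  "coord_integral J F y = (\<integral>\<^sup>+ z. F (override_on y z J) \<partial>lebesgue_on_coords J)"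

lemma override_on_same [simp]:
  "override_on (override_on y z J) z K = override_on y z (J \<union> K)"
  by (auto simp: override_on_def)

lemma override_on_restrict:
  "y \<in> extensional V \<Longrightarrow> B \<subseteq> V \<Longrightarrow> override_on (restrict y B) z (V - B) = override_on y z (V - B)"
  by (auto simp: override_on_def restrict_def extensional_def fun_eq_iff)

lemma override_on_PiE:
  "y \<in> V \<rightarrow>\<^sub>E X \<Longrightarrow> J \<subseteq> V \<Longrightarrow> (\<And>i. i \<in> J \<Longrightarrow> z i \<in> X) \<Longrightarrow> override_on y z J \<in> V \<rightarrow>\<^sub>E X"
  by (auto simp: override_on_def PiE_iff extensional_def)

lemma space_coords [simp]: "space (lebesgue_on_coords I) = I \<rightarrow>\<^sub>E UNIV"
  by (simp add: space_PiM)

lemma measurable_override_on: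
  assumes "J \<subseteq> V"
  shows "(\<lambda>(y, z). override_on y z J)
    \<in> measurable (lebesgue_on_coords V \<Otimes>\<^sub>M lebesgue_on_coords J) (lebesgue_on_coords V)"
proof (rule measurable_PiM_single')
  fix i assume i: "i \<in> V"
  show "(\<lambda>x. (case x of (y, z) \<Rightarrow> override_on y z J) i)
      \<in> measurable (lebesgue_on_coords V \<Otimes>\<^sub>M lebesgue_on_coords J) lborel"
  proof (cases "i \<in> J")
    case True
    have "(\<lambda>x. (case x of (y, z) \<Rightarrow> override_on y z J) i) = (\<lambda>x :: (nat \<Rightarrow> real) \<times> (nat \<Rightarrow> real). snd x i)"
      using True by (auto simp: override_on_def split: prod.split)
    moreover have "(\<lambda>x. snd x i) \<in> measurable (lebesgue_on_coords V \<Otimes>\<^sub>M lebesgue_on_coords J) lborel"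
      using True by (intro measurable_compose[OF measurable_snd measurable_component_singleton])
    ultimately show ?thesis by (simp only:)
  next
    case False
    have "(\<lambda>x. (case x of (y, z) \<Rightarrow> override_on y z J) i) = (\<lambda>x :: (nat \<Rightarrow> real) \<times> (nat \<Rightarrow> real). fst x i)"
      using False by (auto simp: override_on_def split: prod.split)
    moreover have "(\<lambda>x. fst x i) \<in> measurable (lebesgue_on_coords V \<Otimes>\<^sub>M lebesgue_on_coords J) lborel"
      using i by (intro measurable_compose[OF measurable_fst measurable_component_singleton])
    ultimately show ?thesis by (simp only:)
  qed
next
  show "(\<lambda>x. case x of (y, z) \<Rightarrow> override_on y z J)
      \<in> space (lebesgue_on_coords V \<Otimes>\<^sub>M lebesgue_on_coords J) \<rightarrow> V \<rightarrow>\<^sub>E space lborel"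
    using assms by (auto simp: space_pair_measure override_on_def PiE_iff extensional_def)
qed

lemma measurable_override_on_fixed:
  assumes "J \<subseteq> V" "y \<in> V \<rightarrow>\<^sub>E UNIV"
  shows "(\<lambda>z. override_on y z J) \<in> measurable (lebesgue_on_coords J) (lebesgue_on_coords V)"
proof -
  have "(\<lambda>z. (y, z)) \<in> measurable (lebesgue_on_coords J)
      (lebesgue_on_coords V \<Otimes>\<^sub>M lebesgue_on_coords J)"
    by (rule measurable_Pair1') (use assms in simp)
  from measurable_compose[OF this measurable_override_on[OF assms(1)]]
  show "(\<lambda>z. override_on y z J) \<in> measurable (lebesgue_on_coords J) (lebesgue_on_coords V)"
    by simp
qed

lemma override_on_merge:
  "J \<inter> K = {} \<Longrightarrow> override_on y (merge J K (s, t)) (J \<union> K) = override_on (override_on y s J) t K"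
  by (auto simp: override_on_def merge_def fun_eq_iff)

lemma override_on_eq_merge:
  "b \<in> B \<rightarrow>\<^sub>E X \<Longrightarrow> B \<subseteq> V \<Longrightarrow> override_on b z (V - B) = merge B (V - B) (b, z)"
  by (auto simp: override_on_def merge_def fun_eq_iff PiE_iff extensional_def)

lemma coord_integral_cong:
  assumes "\<And>z. z \<in> J \<rightarrow>\<^sub>E UNIV \<Longrightarrow> F (override_on y z J) = G (override_on x z J)"
  shows "coord_integral J F y = coord_integral J G x"
  unfolding coord_integral_def by (rule nn_integral_cong) (use assms in simp)

lemma coord_integral_mono:
  assumes "\<And>z. z \<in> J \<rightarrow>\<^sub>E UNIV \<Longrightarrow> F (override_on y z J) \<le> G (override_on x z J)"
  shows "coord_integral J F y \<le> coord_integral J G x"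
  unfolding coord_integral_def by (rule nn_integral_mono) (use assms in simp)

lemma coord_integral_indep:
  assumes "\<And>i. i \<notin> J \<Longrightarrow> y i = x i"
  shows "coord_integral J F y = coord_integral J F x"
proof -
  have "override_on y z J = override_on x z J" for z
    using assms by (auto simp: override_on_def)
  then show ?thesis by (intro coord_integral_cong) simp
qed

lemma measurable_coord_integral:
  assumes "finite V" "J \<subseteq> V" "F \<in> borel_measurable (lebesgue_on_coords V)"
  shows "coord_integral J F \<in> borel_measurable (lebesgue_on_coords V)"
proof -
  interpret J: sigma_finite_measure "lebesgue_on_coords J"
    using assms by (intro sigma_finite_coords) (rule finite_subset)
  have "(\<lambda>(y, z). F (override_on y z J))
      \<in> borel_measurable (lebesgue_on_coords V \<Otimes>\<^sub>M lebesgue_on_coords J)"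
    using measurable_compose[OF measurable_override_on[OF assms(2)] assms(3)]
    by (simp add: case_prod_beta')
  then show ?thesis
    unfolding coord_integral_def by (rule J.borel_measurable_nn_integral)
qed

lemma measurable_coord_integrand:
  assumes "J \<subseteq> V" "F \<in> borel_measurable (lebesgue_on_coords V)" "y \<in> V \<rightarrow>\<^sub>E UNIV"
  shows "(\<lambda>z. F (override_on y z J)) \<in> borel_measurable (lebesgue_on_coords J)"
  using measurable_compose[OF measurable_override_on_fixed[OF assms(1,3)] assms(2)] .

lemma coord_integral_union:
  assumes "finite V" "J \<subseteq> V" "K \<subseteq> V" "J \<inter> K = {}" "y \<in> V \<rightarrow>\<^sub>E UNIV"
    and "F \<in> borel_measurable (lebesgue_on_coords V)"
  shows "coord_integral (J \<union> K) F y = coord_integral J (coord_integral K F) y"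
proof -
  have fin: "finite J" "finite K" using assms(1-3) by (auto intro: finite_subset)
  have "coord_integral (J \<union> K) F y =
      (\<integral>\<^sup>+ s. \<integral>\<^sup>+ t. F (override_on y (merge J K (s, t)) (J \<union> K)) \<partial>lebesgue_on_coords K \<partial>lebesgue_on_coords J)"
    unfolding coord_integral_def
    by (rule coords.product_nn_integral_fold[OF assms(4) fin])
      (use measurable_coord_integrand[of "J \<union> K" V F y] assms in auto)
  also have "\<dots> = coord_integral J (coord_integral K F) y"
    unfolding coord_integral_def by (simp add: override_on_merge assms(4))
  finally show ?thesis .
qed

lemma coord_integral_cmult:
  assumes "J \<subseteq> V" "F \<in> borel_measurable (lebesgue_on_coords V)" "y \<in> V \<rightarrow>\<^sub>E UNIV"
  shows "coord_integral J (\<lambda>x. c * F x) y = c * coord_integral J F y"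
  unfolding coord_integral_def
  by (rule nn_integral_cmult) (rule measurable_coord_integrand[OF assms])

lemma coord_integral_all:
  assumes "y \<in> extensional V"
  shows "coord_integral V F y = integral\<^sup>N (lebesgue_on_coords V) F"
proof -
  have "override_on y z V = z" if "z \<in> V \<rightarrow>\<^sub>E UNIV" for z
    using that assms by (auto simp: override_on_def extensional_def PiE_iff fun_eq_iff)
  then show ?thesis unfolding coord_integral_def by (intro nn_integral_cong) simp
qed

lemma coord_integral_empty [simp]: "coord_integral {} F y = F y"
proof -
  interpret E: prob_space "lebesgue_on_coords {}"
    by (rule prob_spaceI) (simp add: PiM_empty)
  show ?thesis unfolding coord_integral_def by (simp add: E.emeasure_space_1 del: space_coords)
qed

text \<open>Tonelli. The outer variable \<open>b\<close> is indexed by \<open>B\<close> alone; its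
  undefined entries are harmless, because \<open>coord_integral\<close> overrides all coordinates in
  \<open>V - B\<close>.\<close>

lemma nn_integral_coords_split:
  assumes "finite V" "B \<subseteq> V" "F \<in> borel_measurable (lebesgue_on_coords V)"
  shows "integral\<^sup>N (lebesgue_on_coords V) F =
    (\<integral>\<^sup>+ b. coord_integral (V - B) F b \<partial>lebesgue_on_coords B)"
proof -
  have V: "V = B \<union> (V - B)" using assms by auto
  have "integral\<^sup>N (lebesgue_on_coords V) F = integral\<^sup>N (lebesgue_on_coords (B \<union> (V - B))) F"
    using V by simp
  also have "\<dots> = (\<integral>\<^sup>+ b. \<integral>\<^sup>+ z. F (merge B (V - B) (b, z)) \<partial>lebesgue_on_coords (V - B) \<partial>lebesgue_on_coords B)"
    by (rule coords.product_nn_integral_fold) (use assms V finite_subset in auto)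
  also have "\<dots> = (\<integral>\<^sup>+ b. coord_integral (V - B) F b \<partial>lebesgue_on_coords B)"
    unfolding coord_integral_def
    by (intro nn_integral_cong) (simp add: override_on_eq_merge[OF _ assms(2)])
  finally show ?thesis .
qed

text \<open>Measurability is needed on the coordinates in \<open>B\<close> themselves: quotients of
  such integrals have to be measurable for the sigma-algebra generated by the \<open>B\<close>-part
  of a random vector.\<close>

lemma measurable_coord_integral_restricted:
  assumes "finite V" "B \<subseteq> V" "F \<in> borel_measurable (lebesgue_on_coords V)"
  shows "coord_integral (V - B) F \<in> borel_measurable (lebesgue_on_coords B)"
proof -
  interpret J: sigma_finite_measure "lebesgue_on_coords (V - B)"
    using assms finite_subset by auto
  have V: "B \<union> (V - B) = V" using assms by auto
  have "(\<lambda>(b, z). F (merge B (V - B) (b, z)))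
      \<in> borel_measurable (lebesgue_on_coords B \<Otimes>\<^sub>M lebesgue_on_coords (V - B))"
    using measurable_compose[OF measurable_merge[of B "V - B" "\<lambda>_. lborel"], of F borel] assms V
    by (simp add: case_prod_beta')
  then have "(\<lambda>b. \<integral>\<^sup>+ z. F (merge B (V - B) (b, z)) \<partial>lebesgue_on_coords (V - B))
      \<in> borel_measurable (lebesgue_on_coords B)"
    by (rule J.borel_measurable_nn_integral)
  then show ?thesis
    by (rule measurable_cong[THEN iffD1, rotated])
      (simp add: coord_integral_def override_on_eq_merge[OF _ assms(2)])
qed

lemma coord_integral_restrict:
  assumes "y \<in> extensional V" "B \<subseteq> V"
  shows "coord_integral (V - B) F (restrict y B) = coord_integral (V - B) F y"
  by (rule coord_integral_cong) (simp add: override_on_restrict[OF assms])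

text \<open>The mixed-product identity says that \<open>F\<close> splits into a factor not involving \<open>T\<close> and a
  factor not involving \<open>S\<close>; in this form no division is needed, so zeros and infinities are
  harmless.\<close>

definition splits_at ::
    "((nat \<Rightarrow> real) \<Rightarrow> 'b::times) \<Rightarrow> nat set \<Rightarrow> nat set \<Rightarrow> (nat \<Rightarrow> real) \<Rightarrow> (nat \<Rightarrow> real) \<Rightarrow> bool" where
  "splits_at F S T y z \<longleftrightarrow>
    F y * F (override_on y z (S \<union> T)) = F (override_on y z S) * F (override_on y z T)"

lemma splits_at_symm: "splits_at F S T y z \<Longrightarrow> splits_at F T S y z" for F :: "_ \<Rightarrow> 'b::ab_semigroup_mult"
  by (simp add: splits_at_def Un_commute mult.commute)

text \<open>The splitting identity is integrated over the replacement \<open>z\<close>. With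
  \<open>y\<close> fixed, \<open>G y\<close> is a constant, and a replacement on
  \<open>S \<union> T\<close> consists of two independent parts \<open>s\<close> and
  \<open>t\<close>, so Tonelli turns the right-hand side into a product.\<close>

lemma coord_integral_splits:
  assumes "finite V" "S \<subseteq> V" "T \<subseteq> V" "S \<inter> T = {}" "y \<in> V \<rightarrow>\<^sub>E UNIV"
    and G: "G \<in> borel_measurable (lebesgue_on_coords V)"
    and split: "\<And>z. splits_at G S T y z"
  shows "G y * coord_integral (S \<union> T) G y = coord_integral S G y * coord_integral T G y"
proof -
  have fin: "finite S" "finite T" using assms(1-3) by (auto intro: finite_subset)
  note mS = measurable_coord_integrand[OF assms(2) G assms(5)]
  note mT = measurable_coord_integrand[OF assms(3) G assms(5)]
  have mST: "(\<lambda>z. G (override_on y z (S \<union> T))) \<in> borel_measurable (lebesgue_on_coords (S \<union> T))"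
    using measurable_coord_integrand[of "S \<union> T" V G y] assms by auto
  have eq: "G y * G (override_on y (merge S T (s, t)) (S \<union> T)) =
      G (override_on y s S) * G (override_on y t T)" for s t
  proof -
    have "override_on y (merge S T (s, t)) S = override_on y s S"
      "override_on y (merge S T (s, t)) T = override_on y t T"
      using assms(4) by (auto simp: override_on_def merge_def fun_eq_iff)
    with split[of "merge S T (s, t)"] show ?thesis by (simp add: splits_at_def)
  qed
  have "G y * coord_integral (S \<union> T) G y =
      (\<integral>\<^sup>+ z. G y * G (override_on y z (S \<union> T)) \<partial>lebesgue_on_coords (S \<union> T))"
    unfolding coord_integral_def by (rule nn_integral_cmult[symmetric, OF mST])
  also have "\<dots> = (\<integral>\<^sup>+ s. \<integral>\<^sup>+ t. G (override_on y s S) * G (override_on y t T)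
      \<partial>lebesgue_on_coords T \<partial>lebesgue_on_coords S)"
    by (subst coords.product_nn_integral_fold[OF assms(4) fin]) (use mST in \<open>auto simp: eq\<close>)
  also have "\<dots> = (\<integral>\<^sup>+ s. G (override_on y s S) * coord_integral T G y \<partial>lebesgue_on_coords S)"
    unfolding coord_integral_def by (simp add: nn_integral_cmult[OF mT])
  also have "\<dots> = coord_integral S G y * coord_integral T G y"
    by (subst nn_integral_multc[OF mS]) (simp add: coord_integral_def)
  finally show ?thesis .
qed

text \<open>This is conditional independence in density form: \<open>\<phi>\<close> and
  \<open>\<psi>\<close> will be indicators of events about the coordinates in \<open>S\<close> and
  in \<open>T\<close>. Multiplied by the constant \<open>?c\<close>, the function \<open>g\<close>
  becomes a product of two partial integrals, one depending on \<open>s\<close> and one on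
  \<open>t\<close>, so the integral with both weights factorizes.\<close>

lemma coord_integral_splits_weighted:
  fixes g :: "(nat \<Rightarrow> real) \<Rightarrow> ennreal"
  assumes "finite V" "S \<subseteq> V" "T \<subseteq> V" "S \<inter> T = {}" "y \<in> V \<rightarrow>\<^sub>E UNIV"
    and g [measurable]: "g \<in> borel_measurable (lebesgue_on_coords V)"
    and phi [measurable]: "\<phi> \<in> borel_measurable (lebesgue_on_coords V)"
    and psi [measurable]: "\<psi> \<in> borel_measurable (lebesgue_on_coords V)"
    and phi_dep: "\<And>x z. \<phi> (override_on x z T) = \<phi> x"
    and psi_dep: "\<And>x z. \<psi> (override_on x z S) = \<psi> x"
    and split: "\<And>x z. splits_at g S T x z"
  shows "coord_integral (S \<union> T) (\<lambda>x. g x * (\<phi> x * \<psi> x)) y * coord_integral (S \<union> T) g y =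
    coord_integral (S \<union> T) (\<lambda>x. g x * \<phi> x) y * coord_integral (S \<union> T) (\<lambda>x. g x * \<psi> x) y"
proof -
  let ?c = "coord_integral (S \<union> T) g y"
  have fin: "finite S" "finite T" using assms(1-3) by (auto intro: finite_subset)
  have "S \<union> T \<subseteq> V" using assms by auto
  have in_space: "override_on y z J \<in> V \<rightarrow>\<^sub>E UNIV" if "J \<subseteq> V" for z J
    using override_on_PiE[OF assms(5) that, of z] by simp
  define r where "r s = coord_integral T g (override_on y s S)" for s
  define c where "c t = coord_integral S g (override_on y t T)" for t
  have m [measurable]: "(\<lambda>x. g x * (\<phi> x * \<psi> x)) \<in> borel_measurable (lebesgue_on_coords V)"
    "(\<lambda>x. g x * \<phi> x) \<in> borel_measurable (lebesgue_on_coords V)"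
    "(\<lambda>x. g x * \<psi> x) \<in> borel_measurable (lebesgue_on_coords V)" by measurable
  have mr [measurable]: "r \<in> borel_measurable (lebesgue_on_coords S)"
    unfolding r_def using measurable_coord_integrand[OF assms(2) measurable_coord_integral[OF assms(1,3) g] assms(5)] .
  have mc [measurable]: "c \<in> borel_measurable (lebesgue_on_coords T)"
    unfolding c_def using measurable_coord_integrand[OF assms(3) measurable_coord_integral[OF assms(1,2) g] assms(5)] .
  have mphi [measurable]: "(\<lambda>s. \<phi> (override_on y s S)) \<in> borel_measurable (lebesgue_on_coords S)"
    by (rule measurable_coord_integrand[OF assms(2) phi assms(5)])
  have mpsi [measurable]: "(\<lambda>t. \<psi> (override_on y t T)) \<in> borel_measurable (lebesgue_on_coords T)"
    by (rule measurable_coord_integrand[OF assms(3) psi assms(5)])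
  \<comment> \<open>The integrated identity is applied at the replaced point, not at
    \<open>y\<close>. The integral over \<open>S \<union> T\<close> is the same there, and each of
    the other two depends on only one of \<open>s\<close> and \<open>t\<close>.\<close>
  have key: "?c * g (override_on y (merge S T (s, t)) (S \<union> T)) = r s * c t" for s t
  proof -
    let ?w = "override_on y (merge S T (s, t)) (S \<union> T)"
    have "g ?w * coord_integral (S \<union> T) g ?w = coord_integral S g ?w * coord_integral T g ?w"
      by (rule coord_integral_splits[OF assms(1-4) in_space g split]) fact
    moreover have "coord_integral (S \<union> T) g ?w = ?c"
      by (rule coord_integral_indep) (auto simp: override_on_def)
    moreover have "coord_integral S g ?w = c t"
      unfolding c_def using assms(4)
      by (intro coord_integral_indep) (auto simp: override_on_def merge_def)
    moreover have "coord_integral T g ?w = r s"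
      unfolding r_def using assms(4)
      by (intro coord_integral_indep) (auto simp: override_on_def merge_def)
    ultimately show ?thesis by (simp add: mult.commute)
  qed
  have phi': "\<phi> (override_on y (merge S T (s, t)) (S \<union> T)) = \<phi> (override_on y s S)"
    and psi': "\<psi> (override_on y (merge S T (s, t)) (S \<union> T)) = \<psi> (override_on y t T)" for s t
  proof -
    have "override_on y (merge S T (s, t)) (S \<union> T) = override_on (override_on y t T) s S"
      using assms(4) by (auto simp: override_on_def merge_def fun_eq_iff)
    then show "\<psi> (override_on y (merge S T (s, t)) (S \<union> T)) = \<psi> (override_on y t T)"
      by (simp add: psi_dep)
    show "\<phi> (override_on y (merge S T (s, t)) (S \<union> T)) = \<phi> (override_on y s S)"
      by (simp add: override_on_merge[OF assms(4)] phi_dep)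
  qed
  have weighted: "?c * coord_integral (S \<union> T) (\<lambda>x. g x * h x) y =
      (\<integral>\<^sup>+ s. p s * r s \<partial>lebesgue_on_coords S) * (\<integral>\<^sup>+ t. q t * c t \<partial>lebesgue_on_coords T)"
    if h [measurable]: "h \<in> borel_measurable (lebesgue_on_coords V)"
      and [measurable]: "p \<in> borel_measurable (lebesgue_on_coords S)"
        "q \<in> borel_measurable (lebesgue_on_coords T)"
      and eq: "\<And>s t. h (override_on y (merge S T (s, t)) (S \<union> T)) = p s * q t"
    for h p q
  proof -
    have mh: "(\<lambda>z. ?c * (g (override_on y z (S \<union> T)) * h (override_on y z (S \<union> T))))
        \<in> borel_measurable (lebesgue_on_coords (S \<union> T))"
      using measurable_coord_integrand[OF \<open>S \<union> T \<subseteq> V\<close> _ assms(5), of "\<lambda>x. ?c * (g x * h x)"] by simp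
    have "?c * coord_integral (S \<union> T) (\<lambda>x. g x * h x) y = coord_integral (S \<union> T) (\<lambda>x. ?c * (g x * h x)) y"
      by (rule coord_integral_cmult[symmetric, OF \<open>S \<union> T \<subseteq> V\<close> _ assms(5)]) simp
    also have "\<dots> = (\<integral>\<^sup>+ s. \<integral>\<^sup>+ t. (?c * g (override_on y (merge S T (s, t)) (S \<union> T))) *
        h (override_on y (merge S T (s, t)) (S \<union> T)) \<partial>lebesgue_on_coords T \<partial>lebesgue_on_coords S)"
      unfolding coord_integral_def
      by (subst coords.product_nn_integral_fold[OF assms(4) fin])
        (use mh in \<open>auto simp: coord_integral_def mult.assoc\<close>)
    also have "\<dots> = (\<integral>\<^sup>+ s. \<integral>\<^sup>+ t. (p s * r s) * (q t * c t) \<partial>lebesgue_on_coords T \<partial>lebesgue_on_coords S)"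
      unfolding key eq by (simp add: mult_ac)
    also have "\<dots> = (\<integral>\<^sup>+ s. (p s * r s) * (\<integral>\<^sup>+ t. q t * c t \<partial>lebesgue_on_coords T) \<partial>lebesgue_on_coords S)"
      by (intro nn_integral_cong nn_integral_cmult) simp
    also have "\<dots> = (\<integral>\<^sup>+ s. p s * r s \<partial>lebesgue_on_coords S) * (\<integral>\<^sup>+ t. q t * c t \<partial>lebesgue_on_coords T)"
      by (rule nn_integral_multc) simp
    finally show ?thesis .
  qed
  let ?P = "\<integral>\<^sup>+ s. \<phi> (override_on y s S) * r s \<partial>lebesgue_on_coords S"
  let ?Q = "\<integral>\<^sup>+ t. \<psi> (override_on y t T) * c t \<partial>lebesgue_on_coords T"
  have "?P = coord_integral S (coord_integral T (\<lambda>x. g x * \<phi> x)) y"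
  proof -
    have "\<phi> (override_on y s S) * r s = coord_integral T (\<lambda>x. g x * \<phi> x) (override_on y s S)" for s
      unfolding r_def
      by (subst coord_integral_cmult[OF assms(3) g, symmetric])
        (auto intro!: coord_integral_cong in_space assms(2) simp: phi_dep mult.commute)
    then show ?thesis by (simp add: coord_integral_def[of S])
  qed
  then have P: "?P = coord_integral (S \<union> T) (\<lambda>x. g x * \<phi> x) y"
    using coord_integral_union[OF assms(1-5) m(2)] by simp
  have "?Q = coord_integral T (coord_integral S (\<lambda>x. g x * \<psi> x)) y"
  proof -
    have "\<psi> (override_on y t T) * c t = coord_integral S (\<lambda>x. g x * \<psi> x) (override_on y t T)" for t
      unfolding c_def
      by (subst coord_integral_cmult[OF assms(2) g, symmetric])
        (auto intro!: coord_integral_cong in_space assms(3) simp: psi_dep mult.commute)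
    then show ?thesis by (simp add: coord_integral_def[of T])
  qed
  then have Q: "?Q = coord_integral (S \<union> T) (\<lambda>x. g x * \<psi> x) y"
    using coord_integral_union[OF assms(1,3,2) _ assms(5) m(3)] assms(4) by (simp add: Int_commute Un_commute)
  have "?c * coord_integral (S \<union> T) (\<lambda>x. g x * (\<phi> x * \<psi> x)) y = ?P * ?Q"
    by (rule weighted) (auto simp: phi' psi')
  then show ?thesis unfolding P Q by (simp add: mult.commute)
qed

section \<open>Conditional independence in terms of densities\<close>

text \<open>The weight \<open>u\<close> carries the event whose conditional probability is sought,
  and \<open>h\<close> tests against functions of the coordinates in \<open>B\<close>. With
  \<open>u = 1\<close> the partial integral is the marginal density of these coordinates.\<close>

lemma distributed_nn_integral_coords:
  assumes "finite V" "B \<subseteq> V" and Y: "distributed N (lebesgue_on_coords V) Y g"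
    and u: "u \<in> borel_measurable (lebesgue_on_coords V)"
    and h: "h \<in> borel_measurable (lebesgue_on_coords B)"
  shows "(\<integral>\<^sup>+ \<omega>. h (restrict (Y \<omega>) B) * u (Y \<omega>) \<partial>N) =
    (\<integral>\<^sup>+ b. h b * coord_integral (V - B) (\<lambda>x. g x * u x) b \<partial>lebesgue_on_coords B)"
proof -
  have g: "g \<in> borel_measurable (lebesgue_on_coords V)"
    using Y by (simp add: distributed_def)
  have h': "(\<lambda>x. h (restrict x B)) \<in> borel_measurable (lebesgue_on_coords V)"
    by (rule measurable_compose[OF measurable_restrict_subset[OF assms(2)] h])
  have "(\<integral>\<^sup>+ \<omega>. h (restrict (Y \<omega>) B) * u (Y \<omega>) \<partial>N) =
      (\<integral>\<^sup>+ x. g x * (h (restrict x B) * u x) \<partial>lebesgue_on_coords V)"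
    by (rule distributed_nn_integral[OF Y borel_measurable_times_ennreal[OF h' u], symmetric])
  also have "\<dots> = (\<integral>\<^sup>+ b. coord_integral (V - B) (\<lambda>x. g x * (h (restrict x B) * u x)) b \<partial>lebesgue_on_coords B)"
    by (rule nn_integral_coords_split[OF assms(1,2) borel_measurable_times_ennreal[OF g borel_measurable_times_ennreal[OF h' u]]])
  also have "\<dots> = (\<integral>\<^sup>+ b. h b * coord_integral (V - B) (\<lambda>x. g x * u x) b \<partial>lebesgue_on_coords B)"
  proof (rule nn_integral_cong)
    fix b assume "b \<in> space (lebesgue_on_coords B)"
    then have b: "b \<in> B \<rightarrow>\<^sub>E UNIV" by simp
    have m: "(\<lambda>z. g (merge B (V - B) (b, z)) * u (merge B (V - B) (b, z)))
        \<in> borel_measurable (lebesgue_on_coords (V - B))"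
    proof -
      have V: "B \<union> (V - B) = V" using assms(2) by auto
      have "(\<lambda>z. (b, z)) \<in> measurable (lebesgue_on_coords (V - B)) (lebesgue_on_coords B \<Otimes>\<^sub>M lebesgue_on_coords (V - B))"
        by (rule measurable_Pair1') (use b in simp)
      from measurable_compose[OF this measurable_merge]
      have "(\<lambda>z. merge B (V - B) (b, z)) \<in> measurable (lebesgue_on_coords (V - B)) (lebesgue_on_coords V)"
        unfolding V .
      from measurable_compose[OF this borel_measurable_times_ennreal[OF g u]] show ?thesis .
    qed
    have "restrict (merge B (V - B) (b, z)) B = b" for z
      using b by (auto simp: merge_def fun_eq_iff PiE_iff extensional_def)
    then have "coord_integral (V - B) (\<lambda>x. g x * (h (restrict x B) * u x)) b =
        (\<integral>\<^sup>+ z. h b * (g (merge B (V - B) (b, z)) * u (merge B (V - B) (b, z))) \<partial>lebesgue_on_coords (V - B))"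
      unfolding coord_integral_def override_on_eq_merge[OF b assms(2)] by (simp add: mult_ac)
    also have "\<dots> = h b * coord_integral (V - B) (\<lambda>x. g x * u x) b"
      unfolding coord_integral_def override_on_eq_merge[OF b assms(2)] by (rule nn_integral_cmult) (rule m)
    finally show "coord_integral (V - B) (\<lambda>x. g x * (h (restrict x B) * u x)) b =
      h b * coord_integral (V - B) (\<lambda>x. g x * u x) b" .
  qed
  finally show ?thesis .
qed

context
  fixes N :: "'a measure" and V B :: "nat set" and Y g
  assumes prob: "prob_space N" and fin: "finite V" and B: "B \<subseteq> V"
    and Y: "distributed N (lebesgue_on_coords V) Y g"
begin

lemma density_measurable [measurable]: "g \<in> borel_measurable (lebesgue_on_coords V)"
  and Y_measurable [measurable]: "Y \<in> measurable N (lebesgue_on_coords V)"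
  using Y by (simp_all add: distributed_def)

lemma restrict_Y_measurable [measurable]:
  "A \<subseteq> V \<Longrightarrow> (\<lambda>\<omega>. restrict (Y \<omega>) A) \<in> measurable N (lebesgue_on_coords A)"
  by (rule measurable_compose[OF Y_measurable measurable_restrict_subset])

lemma Y_in_space: "\<omega> \<in> space N \<Longrightarrow> Y \<omega> \<in> V \<rightarrow>\<^sub>E UNIV"
  using measurable_space[OF Y_measurable] by simp

lemma coord_integral_finite_AE:
  "AE b in lebesgue_on_coords B. coord_integral (V - B) g b \<noteq> \<infinity>"
proof (rule nn_integral_noteq_infinite)
  interpret prob_space N by (rule prob)
  show "coord_integral (V - B) g \<in> borel_measurable (lebesgue_on_coords B)"
    by (rule measurable_coord_integral_restricted[OF fin B density_measurable])
  have "(\<integral>\<^sup>+ b. coord_integral (V - B) g b \<partial>lebesgue_on_coords B) = integral\<^sup>N N (\<lambda>_. 1)"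
    using distributed_nn_integral_coords[OF fin B Y, of "\<lambda>_. 1" "\<lambda>_. 1", symmetric]
    by (simp only: borel_measurable_const mult_1_left mult_1_right simp_thms)
  then show "(\<integral>\<^sup>+ b. coord_integral (V - B) g b \<partial>lebesgue_on_coords B) \<noteq> \<infinity>"
    by (simp add: emeasure_space_1)
qed

text \<open>The probability of the bad set is the integral of the marginal density over it. The
  zeros contribute nothing, and the infinities form a Lebesgue null set. This permits division by
  the marginal density almost surely.\<close>

lemma coord_integral_pos_finite_AE:
  "AE \<omega> in N. coord_integral (V - B) g (Y \<omega>) \<noteq> 0 \<and> coord_integral (V - B) g (Y \<omega>) \<noteq> \<infinity>"
proof -
  let ?p = "coord_integral (V - B) g"
  let ?Z = "{b \<in> space (lebesgue_on_coords B). ?p b = 0 \<or> ?p b = \<infinity>}"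
  have p [measurable]: "?p \<in> borel_measurable (lebesgue_on_coords B)"
    by (rule measurable_coord_integral_restricted[OF fin B]) simp
  have Z [measurable]: "?Z \<in> sets (lebesgue_on_coords B)" by measurable
  have "(\<integral>\<^sup>+ \<omega>. indicator ?Z (restrict (Y \<omega>) B) \<partial>N) =
      (\<integral>\<^sup>+ b. indicator ?Z b * ?p b \<partial>lebesgue_on_coords B)"
    using distributed_nn_integral_coords[OF fin B Y, of "\<lambda>_. 1", OF _ borel_measurable_indicator[OF Z]]
    by (simp del: space_coords)
  also have "\<dots> = (\<integral>\<^sup>+ b. 0 \<partial>lebesgue_on_coords B)"
    using coord_integral_finite_AE
    by (intro nn_integral_cong_AE) (auto simp: indicator_def)
  finally have "(\<integral>\<^sup>+ \<omega>. indicator ?Z (restrict (Y \<omega>) B) \<partial>N) = 0" by simp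
  moreover have "(\<lambda>\<omega>. indicator ?Z (restrict (Y \<omega>) B) :: ennreal) \<in> borel_measurable N"
    by (rule measurable_compose[OF restrict_Y_measurable[OF B] borel_measurable_indicator[OF Z]])
  ultimately have "AE \<omega> in N. indicator ?Z (restrict (Y \<omega>) B) = (0 :: ennreal)"
    by (simp add: nn_integral_0_iff_AE)
  then show ?thesis
  proof (rule AE_mp, intro AE_I2 impI)
    fix \<omega> assume \<omega>: "\<omega> \<in> space N" "indicator ?Z (restrict (Y \<omega>) B) = (0 :: ennreal)"
    have "restrict (Y \<omega>) B \<in> space (lebesgue_on_coords B)" by simp
    moreover have "?p (restrict (Y \<omega>) B) = ?p (Y \<omega>)"
      using Y_in_space[OF \<omega>(1)] by (intro coord_integral_restrict[OF _ B]) (simp add: PiE_iff)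
    ultimately show "?p (Y \<omega>) \<noteq> 0 \<and> ?p (Y \<omega>) \<noteq> \<infinity>"
      using \<omega>(2) by (auto simp: indicator_def split: if_splits)
  qed
qed

text \<open>Bayes' formula. The quotient is a function of the \<open>B\<close>-part of the vector,
  and its integrals over the events determined by that part are the right ones; these two properties
  characterize the conditional expectation.\<close>

lemma real_cond_exp_coords:
  assumes E [measurable]: "E \<in> sets (lebesgue_on_coords V)"
  shows "AE \<omega> in N. real_cond_exp N
      (vimage_algebra (space N) (\<lambda>\<omega>. restrict (Y \<omega>) B) (Pi\<^sub>M B (\<lambda>_. borel)))
      (indicator (Y -` E \<inter> space N)) \<omega> =
    enn2real (coord_integral (V - B) (\<lambda>x. g x * indicator E x) (Y \<omega>) / coord_integral (V - B) g (Y \<omega>))"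
proof -
  interpret prob_space N by (rule prob)
  let ?F = "vimage_algebra (space N) (\<lambda>\<omega>. restrict (Y \<omega>) B) (Pi\<^sub>M B (\<lambda>_. borel :: real measure))"
  have sets_B: "sets (Pi\<^sub>M B (\<lambda>_. borel :: real measure)) = sets (lebesgue_on_coords B)"
    by (rule sets_PiM_cong) auto
  have YB: "(\<lambda>\<omega>. restrict (Y \<omega>) B) \<in> measurable N (Pi\<^sub>M B (\<lambda>_. borel))"
    using restrict_Y_measurable[OF B] by (simp add: measurable_cong_sets[OF refl sets_B])
  have sub: "subalgebra N ?F"
    unfolding subalgebra_def using measurable_iff_sets[THEN iffD1, OF YB] by simp
  interpret finite_measure_subalgebra N ?F by standard (rule sub)
  interpret sigma_finite_subalgebra N ?F
    by (rule finite_measure_subalgebra_is_sigma_finite) standard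
  let ?p = "coord_integral (V - B) g"
  let ?pE = "coord_integral (V - B) (\<lambda>x. g x * indicator E x)"
  have p [measurable]: "?p \<in> borel_measurable (lebesgue_on_coords B)"
    by (rule measurable_coord_integral_restricted[OF fin B]) simp
  have pE [measurable]: "?pE \<in> borel_measurable (lebesgue_on_coords B)"
    by (rule measurable_coord_integral_restricted[OF fin B]) simp
  have pE_le: "?pE b \<le> ?p b" for b
    by (rule coord_integral_mono) (auto simp: indicator_def)
  have ext: "?p (restrict (Y \<omega>) B) = ?p (Y \<omega>)" "?pE (restrict (Y \<omega>) B) = ?pE (Y \<omega>)"
    if "\<omega> \<in> space N" for \<omega>
    using Y_in_space[OF that] by (auto intro!: coord_integral_restrict[OF _ B] simp: PiE_iff)
  define h where "h b = ?pE b / ?p b" for b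
  have h [measurable]: "h \<in> borel_measurable (lebesgue_on_coords B)"
    unfolding h_def by measurable
  have YF: "(\<lambda>\<omega>. restrict (Y \<omega>) B) \<in> measurable ?F (lebesgue_on_coords B)"
    unfolding measurable_cong_sets[OF refl sets_B[symmetric]]
    by (rule measurable_vimage_algebra1) (use measurable_space[OF YB] in auto)
  have "AE \<omega> in N. h (restrict (Y \<omega>) B) = nn_cond_exp N ?F (indicator (Y -` E \<inter> space N)) \<omega>"
  proof (rule nn_cond_exp_charact)
    show "indicator (Y -` E \<inter> space N) \<in> borel_measurable N" by measurable
    show "(\<lambda>\<omega>. h (restrict (Y \<omega>) B)) \<in> borel_measurable ?F"
      by (rule measurable_compose[OF YF h])
  next
    fix A assume "A \<in> sets ?F"
    then obtain H where H: "H \<in> sets (Pi\<^sub>M B (\<lambda>_. borel :: real measure))"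
      and A: "A = (\<lambda>\<omega>. restrict (Y \<omega>) B) -` H \<inter> space N"
      using measurable_space[OF YB] by (subst (asm) sets_vimage_algebra2) (auto simp: Pi_iff)
    have [measurable]: "H \<in> sets (lebesgue_on_coords B)" using H sets_B by simp
    have "(\<integral>\<^sup>+ \<omega>\<in>A. indicator (Y -` E \<inter> space N) \<omega> \<partial>N) =
        (\<integral>\<^sup>+ \<omega>. indicator H (restrict (Y \<omega>) B) * indicator E (Y \<omega>) \<partial>N)"
      by (rule nn_integral_cong) (auto simp: A indicator_def)
    also have "\<dots> = (\<integral>\<^sup>+ b. indicator H b * ?pE b \<partial>lebesgue_on_coords B)"
      by (rule distributed_nn_integral_coords[OF fin B Y]) simp_all
    also have "\<dots> = (\<integral>\<^sup>+ b. (indicator H b * h b) * ?p b \<partial>lebesgue_on_coords B)"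
    proof (rule nn_integral_cong_AE, rule AE_mp[OF coord_integral_finite_AE], intro AE_I2 impI)
      fix b assume "?p b \<noteq> \<infinity>"
      \<comment> \<open>Where the denominator vanishes, so does the numerator by
        \<open>pE_le\<close>, and the value assigned to \<open>0 / 0\<close> does not
        matter.\<close>
      then have "?pE b = h b * ?p b"
      proof (cases "?p b = 0")
        case True
        then show ?thesis using pE_le[of b] by simp
      next
        case False
        then show ?thesis using \<open>?p b \<noteq> \<infinity>\<close>
          unfolding h_def ennreal_divide_times by (subst ennreal_divide_self) (auto simp: less_top)
      qed
      then show "indicator H b * ?pE b = (indicator H b * h b) * ?p b" by (simp add: mult.assoc)
    qed
    also have "\<dots> = (\<integral>\<^sup>+ \<omega>. indicator H (restrict (Y \<omega>) B) * h (restrict (Y \<omega>) B) \<partial>N)"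
      using distributed_nn_integral_coords[OF fin B Y, of "\<lambda>_. 1" "\<lambda>b. indicator H b * h b"] by simp
    also have "\<dots> = (\<integral>\<^sup>+ \<omega>\<in>A. h (restrict (Y \<omega>) B) \<partial>N)"
      by (rule nn_integral_cong) (auto simp: A indicator_def)
    finally show "(\<integral>\<^sup>+ \<omega>\<in>A. indicator (Y -` E \<inter> space N) \<omega> \<partial>N) =
      (\<integral>\<^sup>+ \<omega>\<in>A. h (restrict (Y \<omega>) B) \<partial>N)" .
  qed
  \<comment> \<open>\<open>real_cond_exp\<close> is the difference of the conditional expectations
    of the positive and the negative part. The negative part of an indicator is 0, but its
    conditional expectation is known to be 0 only almost surely.\<close>
  moreover have "AE \<omega> in N. 0 = nn_cond_exp N ?F (\<lambda>_. 0) \<omega>"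
    by (rule nn_cond_exp_charact) auto
  ultimately show ?thesis
    using AE_space
  proof eventually_elim
    case (elim \<omega>)
    then have \<omega>: "\<omega> \<in> space N" and eq: "0 = nn_cond_exp N ?F (\<lambda>_. 0) \<omega>"
      "h (restrict (Y \<omega>) B) = nn_cond_exp N ?F (indicator (Y -` E \<inter> space N)) \<omega>"
      by simp_all
    have i: "(\<lambda>x. ennreal (indicator (Y -` E \<inter> space N) x)) = indicator (Y -` E \<inter> space N)"
      "(\<lambda>x. ennreal (- indicator (Y -` E \<inter> space N) x)) = (\<lambda>_. 0)"
      by (auto simp: indicator_def fun_eq_iff ennreal_neg)
    show "real_cond_exp N ?F (indicator (Y -` E \<inter> space N)) \<omega> = enn2real (?pE (Y \<omega>) / ?p (Y \<omega>))"
      unfolding real_cond_exp_def i eq[symmetric] by (simp add: h_def ext[OF \<omega>])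
  qed
qed


lemma enn2real_quotient_eq_iff:
  fixes a b c q :: ennreal
  assumes "q \<noteq> 0" "q \<noteq> \<infinity>" "a \<le> q" "b \<le> q" "c \<le> q"
  shows "enn2real (a / q) = enn2real (b / q) * enn2real (c / q) \<longleftrightarrow> a * q = b * c"
proof -
  have "a \<noteq> \<infinity>" "b \<noteq> \<infinity>" "c \<noteq> \<infinity>" using assms by (auto simp: top_unique)
  then obtain a' b' c' q' where eqs: "a = ennreal a'" "b = ennreal b'" "c = ennreal c'" "q = ennreal q'"
    and nn: "0 \<le> a'" "0 \<le> b'" "0 \<le> c'" "0 \<le> q'"
    using assms by (cases a; cases b; cases c; cases q) auto
  moreover have "0 < q'" using assms eqs nn by (auto simp: less_le)
  ultimately show ?thesis
    by (simp add: divide_ennreal ennreal_mult''[symmetric] field_simps)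
qed

text \<open>The three conditional probabilities are quotients with the same denominator, the
  marginal density of the \<open>B\<close>-part. It is almost surely positive and finite, so it can
  be cleared.\<close>

lemma cond_indep_coords_iff:
  assumes A: "A \<subseteq> V" and C: "C \<subseteq> V"
  shows "cond_indep_coords N Y A C B \<longleftrightarrow>
    (\<forall>FA\<in>sets (lebesgue_on_coords A). \<forall>FC\<in>sets (lebesgue_on_coords C). AE \<omega> in N.
      coord_integral (V - B) (\<lambda>x. g x * (indicator FA (restrict x A) * indicator FC (restrict x C))) (Y \<omega>) *
        coord_integral (V - B) g (Y \<omega>) =
      coord_integral (V - B) (\<lambda>x. g x * indicator FA (restrict x A)) (Y \<omega>) *
        coord_integral (V - B) (\<lambda>x. g x * indicator FC (restrict x C)) (Y \<omega>))"
proof -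
  have sets_eq: "sets (Pi\<^sub>M I (\<lambda>_. borel :: real measure)) = sets (lebesgue_on_coords I)" for I :: "nat set"
    by (rule sets_PiM_cong) auto
  have meas: "(\<lambda>\<omega>. restrict (Y \<omega>) I) \<in> measurable N (Pi\<^sub>M I (\<lambda>_. borel))" if "I \<subseteq> V" for I
    using restrict_Y_measurable[OF that] unfolding measurable_cong_sets[OF refl sets_eq] .
  let ?F = "vimage_algebra (space N) (\<lambda>\<omega>. restrict (Y \<omega>) B) (Pi\<^sub>M B (\<lambda>_. borel :: real measure))"
  let ?E = "\<lambda>I F. {x \<in> space (lebesgue_on_coords V). restrict x I \<in> F}"
  let ?X = "\<lambda>I F. (\<lambda>\<omega>. restrict (Y \<omega>) I) -` F"
  have main: "(AE \<omega> in N. real_cond_exp N ?F (indicator (?X A FA \<inter> ?X C FC \<inter> space N)) \<omega> =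
        real_cond_exp N ?F (indicator (?X A FA \<inter> space N)) \<omega> *
        real_cond_exp N ?F (indicator (?X C FC \<inter> space N)) \<omega>) \<longleftrightarrow>
      (AE \<omega> in N.
        coord_integral (V - B) (\<lambda>x. g x * (indicator FA (restrict x A) * indicator FC (restrict x C))) (Y \<omega>) *
          coord_integral (V - B) g (Y \<omega>) =
        coord_integral (V - B) (\<lambda>x. g x * indicator FA (restrict x A)) (Y \<omega>) *
          coord_integral (V - B) (\<lambda>x. g x * indicator FC (restrict x C)) (Y \<omega>))"
    (is "?L \<longleftrightarrow> ?R")
    if FA: "FA \<in> sets (lebesgue_on_coords A)" and FC: "FC \<in> sets (lebesgue_on_coords C)" for FA FC
  proof -
    have "?E I F = (\<lambda>x. restrict x I) -` F \<inter> space (lebesgue_on_coords V)" for I F by auto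
    then have EA: "?E A FA \<in> sets (lebesgue_on_coords V)" and EC: "?E C FC \<in> sets (lebesgue_on_coords V)"
      using measurable_sets[OF measurable_restrict_subset[OF A] FA]
        measurable_sets[OF measurable_restrict_subset[OF C] FC] by simp_all
    have pre: "?X A FA \<inter> space N = Y -` ?E A FA \<inter> space N"
      "?X C FC \<inter> space N = Y -` ?E C FC \<inter> space N"
      "?X A FA \<inter> ?X C FC \<inter> space N = Y -` (?E A FA \<inter> ?E C FC) \<inter> space N"
      using Y_in_space by auto
    have in_space: "override_on (Y \<omega>) z (V - B) \<in> space (lebesgue_on_coords V)" if "\<omega> \<in> space N" for \<omega> z
      using override_on_PiE[OF Y_in_space[OF that], of "V - B" z] by simp
    have ci: "coord_integral (V - B) (\<lambda>x. g x * indicator (?E A FA) x) (Y \<omega>) =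
          coord_integral (V - B) (\<lambda>x. g x * indicator FA (restrict x A)) (Y \<omega>)"
        "coord_integral (V - B) (\<lambda>x. g x * indicator (?E C FC) x) (Y \<omega>) =
          coord_integral (V - B) (\<lambda>x. g x * indicator FC (restrict x C)) (Y \<omega>)"
        "coord_integral (V - B) (\<lambda>x. g x * indicator (?E A FA \<inter> ?E C FC) x) (Y \<omega>) =
          coord_integral (V - B) (\<lambda>x. g x * (indicator FA (restrict x A) * indicator FC (restrict x C))) (Y \<omega>)"
      if "\<omega> \<in> space N" for \<omega>
      using in_space[OF that] by (auto intro!: coord_integral_cong simp: indicator_def)
    have "AE \<omega> in N. (real_cond_exp N ?F (indicator (?X A FA \<inter> ?X C FC \<inter> space N)) \<omega> =
          real_cond_exp N ?F (indicator (?X A FA \<inter> space N)) \<omega> *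
          real_cond_exp N ?F (indicator (?X C FC \<inter> space N)) \<omega>) \<longleftrightarrow>
        (coord_integral (V - B) (\<lambda>x. g x * (indicator FA (restrict x A) * indicator FC (restrict x C))) (Y \<omega>) *
          coord_integral (V - B) g (Y \<omega>) =
        coord_integral (V - B) (\<lambda>x. g x * indicator FA (restrict x A)) (Y \<omega>) *
          coord_integral (V - B) (\<lambda>x. g x * indicator FC (restrict x C)) (Y \<omega>))"
      using real_cond_exp_coords[OF EA] real_cond_exp_coords[OF EC]
        real_cond_exp_coords[OF sets.Int[OF EA EC]] coord_integral_pos_finite_AE AE_space
    proof eventually_elim
      case (elim \<omega>)
      have le: "coord_integral (V - B) (\<lambda>x. g x * indicator E x) (Y \<omega>) \<le> coord_integral (V - B) g (Y \<omega>)" for E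
        by (rule coord_integral_mono) (auto simp: indicator_def)
      note quot = enn2real_quotient_eq_iff[OF conjunct1[OF elim(4)] conjunct2[OF elim(4)] le le le]
      show ?case
        unfolding pre elim(1-3) quot unfolding ci[OF elim(5)] by (rule refl)
    qed
    from AE_cong_simp[OF refl] this show ?thesis
      by (auto elim: AE_mp)
  qed
  show ?thesis
    unfolding cond_indep_coords_def cond_indep_var_def sets_eq
    using meas[OF A] meas[OF B] meas[OF C] main by (simp cong: ball_cong)
qed

text \<open>Events about the coordinates in \<open>A\<close> and in \<open>C\<close> are in
  particular events about those in \<open>S\<close> and in \<open>T\<close>, so their indicators are
  admissible weights. \<open>A\<close> and \<open>C\<close> may be smaller than \<open>S\<close> and
  \<open>T\<close>, as the global Markov property requires.\<close>

lemma cond_indep_coords_if_splits: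
  assumes V: "V = S \<union> B \<union> T" and disj: "S \<inter> B = {}" "S \<inter> T = {}" "B \<inter> T = {}"
    and A: "A \<subseteq> S" and C: "C \<subseteq> T" and split: "\<And>x z. splits_at g S T x z"
  shows "cond_indep_coords N Y A C B"
proof -
  have sub: "A \<subseteq> V" "C \<subseteq> V" "S \<subseteq> V" "T \<subseteq> V" using V A C by auto
  have VB: "V - B = S \<union> T" using V disj by auto
  show ?thesis
    unfolding cond_indep_coords_iff[OF sub(1,2)]
  proof (intro ballI AE_I2)
    fix FA FC \<omega>
    assume FA: "FA \<in> sets (lebesgue_on_coords A)" and FC: "FC \<in> sets (lebesgue_on_coords C)"
      and "\<omega> \<in> space N"
    show "coord_integral (V - B) (\<lambda>x. g x * (indicator FA (restrict x A) * indicator FC (restrict x C))) (Y \<omega>) *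
        coord_integral (V - B) g (Y \<omega>) =
      coord_integral (V - B) (\<lambda>x. g x * indicator FA (restrict x A)) (Y \<omega>) *
        coord_integral (V - B) (\<lambda>x. g x * indicator FC (restrict x C)) (Y \<omega>)"
      unfolding VB
    proof (rule coord_integral_splits_weighted[OF fin sub(3,4) disj(2) Y_in_space[OF \<open>\<omega> \<in> space N\<close>] density_measurable])
      show "(\<lambda>x. indicator FA (restrict x A) :: ennreal) \<in> borel_measurable (lebesgue_on_coords V)"
        by (rule measurable_compose[OF measurable_restrict_subset[OF sub(1)] borel_measurable_indicator[OF FA]])
      show "(\<lambda>x. indicator FC (restrict x C) :: ennreal) \<in> borel_measurable (lebesgue_on_coords V)"
        by (rule measurable_compose[OF measurable_restrict_subset[OF sub(2)] borel_measurable_indicator[OF FC]])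
      fix x z :: "nat \<Rightarrow> real"
      have "restrict (override_on x z T) A = restrict x A" "restrict (override_on x z S) C = restrict x C"
        using A C disj by (auto simp: override_on_def restrict_def fun_eq_iff)
      then show "indicator FA (restrict (override_on x z T) A) = (indicator FA (restrict x A) :: ennreal)"
        "indicator FC (restrict (override_on x z S) C) = (indicator FC (restrict x C) :: ennreal)"
        by simp_all
      show "splits_at g S T x z" by (rule split)
    qed
  qed
qed

text \<open>The conditional laws of the two coordinates cancel, which leaves an identity that involves
  only integrals of the joint density.\<close>

lemma cond_indep_coords_pair_AE:
  assumes ij: "i \<in> V" "j \<in> V" and B_eq: "B = V - {i, j}" and ci: "cond_indep_coords N Y {i} {j} B"
    and sets: "U \<in> sets borel" "U' \<in> sets borel" "W \<in> sets borel" "W' \<in> sets borel"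
  defines "Q \<equiv> \<lambda>U W y. coord_integral {i, j} (\<lambda>x. g x * (indicator U (x i) * indicator W (x j))) y"
  shows "AE \<omega> in N. Q U W (Y \<omega>) * Q U' W' (Y \<omega>) = Q U W' (Y \<omega>) * Q U' W (Y \<omega>)"
proof -
  have VB: "V - B = {i, j}" using B_eq ij by auto
  have sub: "{i} \<subseteq> V" "{j} \<subseteq> V" using ij by auto
  let ?C = "\<lambda>l F. {x \<in> space (lebesgue_on_coords {l}). x l \<in> F}"
  have C: "?C l F \<in> sets (lebesgue_on_coords {l})" if "F \<in> sets borel" for l F
  proof -
    have "?C l F = (\<lambda>x. x l) -` F \<inter> space (lebesgue_on_coords {l})" by auto
    then show ?thesis
      using measurable_sets[OF measurable_component_singleton[of l "{l}" "\<lambda>_. lborel"], of F] that by simp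
  qed
  have ind: "indicator (?C l F) (restrict x {l}) = (indicator F (x l) :: ennreal)" for l F and x :: "nat \<Rightarrow> real"
    by (auto simp: indicator_def)
  let ?q = "coord_integral {i, j} g"
  let ?I = "\<lambda>U. coord_integral {i, j} (\<lambda>x. g x * indicator U (x i))"
  let ?J = "\<lambda>W. coord_integral {i, j} (\<lambda>x. g x * indicator W (x j))"
  have prod: "AE \<omega> in N. Q U W (Y \<omega>) * ?q (Y \<omega>) = ?I U (Y \<omega>) * ?J W (Y \<omega>)"
    if "U \<in> sets borel" "W \<in> sets borel" for U W
    using ci[unfolded cond_indep_coords_iff[OF sub], rule_format, OF C[OF that(1)] C[OF that(2)]]
    unfolding VB ind Q_def .
  from prod[OF sets(1,3)] prod[OF sets(2,4)] prod[OF sets(1,4)] prod[OF sets(2,3)] coord_integral_pos_finite_AE[unfolded VB]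
  show ?thesis
  proof eventually_elim
    case (elim \<omega>)
    \<comment> \<open>Multiplication by the square of the marginal density turns each product into a
      product of four one-sided integrals, which agree up to order; the square is cancelled at the
      end.\<close>
    let ?r = "?q (Y \<omega>) * ?q (Y \<omega>)"
    have "(Q U W (Y \<omega>) * Q U' W' (Y \<omega>)) * ?r =
        (Q U W (Y \<omega>) * ?q (Y \<omega>)) * (Q U' W' (Y \<omega>) * ?q (Y \<omega>))" by (simp only: mult_ac)
    also have "\<dots> = (?I U (Y \<omega>) * ?J W' (Y \<omega>)) * (?I U' (Y \<omega>) * ?J W (Y \<omega>))"
      unfolding elim(1,2) by (simp only: mult_ac)
    also have "\<dots> = (Q U W' (Y \<omega>) * Q U' W (Y \<omega>)) * ?r"
      unfolding elim(3,4)[symmetric] by (simp only: mult_ac)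
    finally show ?case
      using elim(5) by (metis mult_divide_eq_ennreal ennreal_mult_eq_top_iff infinity_ennreal_def mult_eq_0_iff)
  qed
qed

end

section \<open>Functions that split along non-adjacent coordinates\<close>

abbreviation pos_orthant :: "nat set \<Rightarrow> (nat \<Rightarrow> real) set" where
  "pos_orthant V \<equiv> V \<rightarrow>\<^sub>E {0<..}"

definition splits_on :: "nat set \<Rightarrow> ((nat \<Rightarrow> real) \<Rightarrow> real) \<Rightarrow> nat set \<Rightarrow> nat set \<Rightarrow> bool" where
  "splits_on V f S T \<longleftrightarrow> (\<forall>y\<in>pos_orthant V. \<forall>z\<in>pos_orthant V. splits_at f S T y z)"

lemma override_on_pos_orthant:
  "y \<in> pos_orthant V \<Longrightarrow> z \<in> pos_orthant V \<Longrightarrow> J \<subseteq> V \<Longrightarrow> override_on y z J \<in> pos_orthant V"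
  by (rule override_on_PiE) (auto simp: PiE_iff)

lemma splits_at_mult:
  fixes f g :: "_ \<Rightarrow> 'b::comm_semiring_1"
  assumes "splits_at f S T y z" "splits_at g S T y z"
  shows "splits_at (\<lambda>x. f x * g x) S T y z"
proof -
  have "(f y * f (override_on y z (S \<union> T))) * (g y * g (override_on y z (S \<union> T))) =
      (f (override_on y z S) * f (override_on y z T)) * (g (override_on y z S) * g (override_on y z T))"
    using assms by (simp only: splits_at_def)
  then show ?thesis by (simp add: splits_at_def mult_ac)
qed

text \<open>Replacing the coordinates in \<open>S\<close> has no effect, so both sides are
  \<open>f y\<close> times the value with the coordinates in \<open>T\<close> replaced. Marginals
  whose index set misses a vertex and indicators of a single coordinate are of this kind.\<close>

lemma splits_at_indep:
  fixes f :: "_ \<Rightarrow> 'b::comm_semiring_1"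
  assumes "\<And>y. f (override_on y z S) = f y"
  shows "splits_at f S T y z"
proof -
  have "f (override_on y z (S \<union> T)) = f (override_on (override_on y z T) z S)"
    by (simp add: Un_commute)
  then show ?thesis using assms by (simp only: splits_at_def)
qed

lemma splits_on_symm: "splits_on V f S T \<Longrightarrow> splits_on V f T S"
  by (simp add: splits_on_def splits_at_symm)

lemma splits_on_mult:
  "splits_on V f S T \<Longrightarrow> splits_on V g S T \<Longrightarrow> splits_on V (\<lambda>x. f x * g x) S T"
  by (simp add: splits_on_def splits_at_mult)

text \<open>No positivity is required: \<open>inverse\<close> is multiplicative even at 0.\<close>

lemma splits_on_inverse: "splits_on V f S T \<Longrightarrow> splits_on V (\<lambda>x. inverse (f x)) S T"
  unfolding splits_on_def splits_at_def by (metis inverse_mult_distrib)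

lemma splits_on_divide:
  "splits_on V f S T \<Longrightarrow> splits_on V g S T \<Longrightarrow> splits_on V (\<lambda>x. f x / g x) S T"
  using splits_on_mult[OF _ splits_on_inverse] by (simp add: divide_inverse)

lemma splits_on_prod:
  "(\<And>i. i \<in> I \<Longrightarrow> splits_on V (f i) S T) \<Longrightarrow> splits_on V (\<lambda>x. \<Prod>i\<in>I. f i x) S T"
  by (induction I rule: infinite_finite_induct)
    (auto intro!: splits_on_mult simp: splits_on_def[of _ "\<lambda>_. 1"] splits_at_def)

lemma splits_on_indep:
  assumes "\<And>y z. f (override_on y z S) = f y"
  shows "splits_on V f S T"
  using assms by (simp add: splits_on_def splits_at_indep)

lemma splits_on_cong:
  assumes "\<And>y. y \<in> pos_orthant V \<Longrightarrow> f y = g y" "S \<subseteq> V" "T \<subseteq> V" "splits_on V f S T"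
  shows "splits_on V g S T"
  using assms override_on_pos_orthant[of _ V] unfolding splits_on_def splits_at_def
  by (metis Un_least)

text \<open>Change the coordinates in \<open>T\<^sub>1\<close> first and those in \<open>T\<^sub>2\<close> afterwards, and cancel the common
  value at the intermediate point.\<close>

lemma splits_on_union:
  assumes pos: "\<And>y. y \<in> pos_orthant V \<Longrightarrow> 0 < f y" and sub: "S \<subseteq> V" "T\<^sub>1 \<subseteq> V" "T\<^sub>2 \<subseteq> V"
    and 1: "splits_on V f S T\<^sub>1" and 2: "splits_on V f S T\<^sub>2"
  shows "splits_on V f S (T\<^sub>1 \<union> T\<^sub>2)"
  unfolding splits_on_def
proof (intro ballI)
  fix y z assume yz: "y \<in> pos_orthant V" "z \<in> pos_orthant V"
  define w where "w = override_on y z T\<^sub>1"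
  have w: "w \<in> pos_orthant V" unfolding w_def using yz sub by (intro override_on_pos_orthant)
  let ?f = "\<lambda>J. f (override_on y z J)"
  have posJ: "0 < ?f J" if "J \<subseteq> V" for J using pos override_on_pos_orthant[OF yz that] .
  have e1: "f y * ?f (S \<union> T\<^sub>1) = ?f S * ?f T\<^sub>1"
    using 1 yz by (simp add: splits_on_def splits_at_def)
  have e2: "?f T\<^sub>1 * ?f (S \<union> (T\<^sub>1 \<union> T\<^sub>2)) = ?f (S \<union> T\<^sub>1) * ?f (T\<^sub>1 \<union> T\<^sub>2)"
  proof -
    have "T\<^sub>1 \<union> (S \<union> T\<^sub>2) = S \<union> (T\<^sub>1 \<union> T\<^sub>2)" "T\<^sub>1 \<union> S = S \<union> T\<^sub>1" by auto
    moreover have "f w * f (override_on w z (S \<union> T\<^sub>2)) = f (override_on w z S) * f (override_on w z T\<^sub>2)"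
      using 2 w yz(2) unfolding splits_on_def splits_at_def by blast
    ultimately show ?thesis unfolding w_def by (simp only: override_on_same)
  qed
  have "(f y * ?f (S \<union> (T\<^sub>1 \<union> T\<^sub>2))) * (?f T\<^sub>1 * ?f (S \<union> T\<^sub>1)) =
      (f y * ?f (S \<union> T\<^sub>1)) * (?f T\<^sub>1 * ?f (S \<union> (T\<^sub>1 \<union> T\<^sub>2)))" by (simp add: mult_ac)
  also have "\<dots> = (?f S * ?f (T\<^sub>1 \<union> T\<^sub>2)) * (?f T\<^sub>1 * ?f (S \<union> T\<^sub>1))"
    unfolding e1 e2 by (simp add: mult_ac)
  finally show "splits_at f S (T\<^sub>1 \<union> T\<^sub>2) y z"
    using posJ[of "T\<^sub>1"] posJ[of "S \<union> T\<^sub>1"] sub by (simp add: splits_at_def)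
qed

text \<open>Two inductions by \<open>splits_on_union\<close>: \<open>T\<close> is built up against a
  single vertex of \<open>S\<close>, then \<open>S\<close> is built up with the two sides exchanged
  by symmetry.\<close>

lemma splits_on_sets:
  assumes pos: "\<And>y. y \<in> pos_orthant V \<Longrightarrow> 0 < f y" and sub: "S \<subseteq> V" "T \<subseteq> V" and "finite V"
    and pairs: "\<And>a c. a \<in> S \<Longrightarrow> c \<in> T \<Longrightarrow> splits_on V f {a} {c}"
  shows "splits_on V f S T"
proof -
  have empty: "splits_on V f R {}" for R by (simp add: splits_on_def splits_at_def)
  have fin: "finite S" "finite T" using assms by (auto intro: finite_subset)
  have right: "splits_on V f {a} T" if "a \<in> S" for a
    using fin(2) sub(2) pairs[OF that]
  proof (induction T)
    case (insert c T)
    then have "splits_on V f {a} ({c} \<union> T)"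
      using that sub(1) by (intro splits_on_union[OF pos]) auto
    then show ?case by simp
  qed (rule empty)
  have "splits_on V f T S"
    using fin(1) sub(1) right
  proof (induction S)
    case (insert a S)
    then have "splits_on V f T ({a} \<union> S)"
      using sub(2) by (intro splits_on_union[OF pos] splits_on_symm[of V f "{a}"]) auto
    then show ?case by simp
  qed (rule empty)
  then show ?thesis by (rule splits_on_symm)
qed

text \<open>Extension from the open orthant to all replacements \<open>z\<close>, as needed for
  integrating over whole coordinate spaces. \<open>W\<close> collects the coordinates whose
  non-positivity makes \<open>G\<close> vanish; in the application to marginals the other
  coordinates have been integrated out. A non-positive coordinate makes both sides zero.\<close>

lemma splits_at_extend:
  fixes G :: "(nat \<Rightarrow> real) \<Rightarrow> ennreal"
  assumes split: "splits_on V (\<lambda>y. enn2real (G y)) S T"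
    and sets: "S \<subseteq> W" "T \<subseteq> W" "W \<subseteq> V" "S \<inter> T = {}"
    and finite: "\<And>y. y \<in> pos_orthant V \<Longrightarrow> G y \<noteq> \<infinity>"
    and dep: "\<And>y. G (restrict y V) = G y"
    and zero: "\<And>y i. i \<in> W \<Longrightarrow> y i \<le> 0 \<Longrightarrow> G y = 0"
    and y: "\<And>i. i \<in> V - W \<Longrightarrow> 0 < y i"
  shows "splits_at G S T y z"
proof (cases "(\<forall>i\<in>W. 0 < y i) \<and> (\<forall>i\<in>S \<union> T. 0 < z i)")
  case True
  define y' where "y' = restrict y V"
  \<comment> \<open>Outside \<open>S \<union> T\<close> the vector \<open>z\<close> is arbitrary, so
    its entries there are replaced by those of \<open>y'\<close>.\<close>
  define z' where "z' = override_on y' z (S \<union> T)"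
  have y': "y' \<in> pos_orthant V" using True y sets by (auto simp: y'_def)
  have z': "z' \<in> pos_orthant V"
    unfolding z'_def using True sets by (intro override_on_PiE[OF y']) auto
  have G: "G (override_on y' z' J) = G (override_on y z J)" if "J \<subseteq> S \<union> T" for J
  proof -
    have "override_on y' z' J = restrict (override_on y z J) V"
      using that sets by (auto simp: override_on_def y'_def z'_def fun_eq_iff restrict_def)
    then show ?thesis by (simp add: dep)
  qed
  have real: "G (override_on y' z' J) = ennreal (enn2real (G (override_on y' z' J)))" if "J \<subseteq> V" for J
    using finite[OF override_on_pos_orthant[OF y' z' that]] by (simp add: less_top)
  have "splits_at (\<lambda>y. enn2real (G y)) S T y' z'" using split y' z' by (simp add: splits_on_def)
  then have e: "enn2real (G (override_on y' z' {})) * enn2real (G (override_on y' z' (S \<union> T))) =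
      enn2real (G (override_on y' z' S)) * enn2real (G (override_on y' z' T))"
    by (simp add: splits_at_def)
  have "G (override_on y' z' {}) * G (override_on y' z' (S \<union> T)) = G (override_on y' z' S) * G (override_on y' z' T)"
    using sets by (subst (1 2 3 4) real) (auto simp: ennreal_mult''[symmetric] e[simplified] simp del: ennreal_enn2real)
  then show ?thesis
    using G[of "{}"] G[of S] G[of T] G[of "S \<union> T"] by (simp add: splits_at_def)
next
  case False
  then consider i where "i \<in> W" "y i \<le> 0" | i where "i \<in> S \<union> T" "z i \<le> 0"
    by (meson not_less)
  then show ?thesis
  proof cases
    \<comment> \<open>As \<open>S\<close> and \<open>T\<close> are disjoint, at least one of the
      one-sided replacements leaves the bad coordinate of \<open>y\<close> unchanged.\<close>
    case 1
    then have "G y = 0" by (rule zero)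
    moreover have "G (override_on y z S) = 0 \<or> G (override_on y z T) = 0"
    proof (cases "i \<in> S")
      case True
      then have "override_on y z T i = y i" using sets by (auto simp: override_on_def)
      then show ?thesis using 1 zero[of i "override_on y z T"] by simp
    next
      case False
      then have "override_on y z S i = y i" by (auto simp: override_on_def)
      then show ?thesis using 1 zero[of i "override_on y z S"] by simp
    qed
    ultimately show ?thesis by (auto simp: splits_at_def)
  next
    case 2
    then have "G (override_on y z (S \<union> T)) = 0"
      using sets by (intro zero[of i]) (auto simp: override_on_def)
    moreover have "G (override_on y z S) = 0 \<or> G (override_on y z T) = 0"
      using 2 sets zero[of i "override_on y z S"] zero[of i "override_on y z T"]
      by (auto simp: override_on_def)
    ultimately show ?thesis by (auto simp: splits_at_def)
  qed
qed

section \<open>Graph theory\<close>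

lemma graph_path_of_rtrancl:
  assumes "(u, v) \<in> (E \<inter> U \<times> U)\<^sup>*" "u \<in> U" "U \<subseteq> V"
  shows "\<exists>p. graph_path V E p \<and> hd p = u \<and> last p = v \<and> set p \<subseteq> U"
  using assms(1)
proof (induction rule: rtrancl_induct)
  case base
  have "graph_path V E [u]" using assms by (auto simp: graph_path_def)
  then show ?case using assms by (intro exI[of _ "[u]"]) auto
next
  case (step w x)
  then obtain p where p: "graph_path V E p" "hd p = u" "last p = w" "set p \<subseteq> U" by auto
  show ?case
  proof (cases "x \<in> set p")
    case True
    \<comment> \<open>A \<open>graph_path\<close> has distinct vertices, so a walk that returns to a
      visited vertex is cut back to that vertex.\<close>
    then obtain p1 p2 where split: "p = p1 @ x # p2" by (auto simp: in_set_conv_decomp)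
    then have "graph_path V E (p1 @ [x])"
      using p(1) by (auto simp: graph_path_def successively_append_iff)
    moreover have "hd (p1 @ [x]) = u" using p(2) split by (cases p1) auto
    ultimately show ?thesis using p(4) split by (intro exI[of _ "p1 @ [x]"]) auto
  next
    case False
    have "graph_path V E (p @ [x])"
      using p step(2) False assms(3) by (auto simp: graph_path_def successively_append_iff)
    then show ?thesis using p step(2) by (intro exI[of _ "p @ [x]"]) (auto simp: graph_path_def)
  qed
qed

text \<open>\<open>S\<close> is everything reachable from \<open>A\<close> outside \<open>B\<close>,
  and \<open>T\<close> is the rest. The density criterion for conditional independence needs such a
  partition of all of \<open>V\<close>, whereas \<open>A\<close>, \<open>B\<close> and
  \<open>C\<close> need not cover \<open>V\<close>.\<close>

lemma graph_separates_partition: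
  assumes sep: "graph_separates V E B A C"
    and sub: "A \<subseteq> V" "B \<subseteq> V" "C \<subseteq> V" and disj: "A \<inter> B = {}" "B \<inter> C = {}"
  obtains S T where "V = S \<union> B \<union> T" "S \<inter> B = {}" "S \<inter> T = {}" "B \<inter> T = {}" "A \<subseteq> S" "C \<subseteq> T"
    "\<And>s t. s \<in> S \<Longrightarrow> t \<in> T \<Longrightarrow> (s, t) \<notin> E"
proof -
  let ?r = "E \<inter> (V - B) \<times> (V - B)"
  define S where "S = ?r\<^sup>* `` A"
  have S: "S \<subseteq> V - B"
  proof
    fix x assume "x \<in> S"
    then obtain a where a: "a \<in> A" "(a, x) \<in> ?r\<^sup>*" by (auto simp: S_def)
    then show "x \<in> V - B" using sub disj by (cases rule: rtranclE[OF a(2)]) auto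
  qed
  define T where "T = V - B - S"
  have "C \<subseteq> T"
  proof
    fix c assume c: "c \<in> C"
    have "c \<notin> S"
    proof
      assume "c \<in> S"
      then obtain a where a: "a \<in> A" "(a, c) \<in> ?r\<^sup>*" by (auto simp: S_def)
      then have "a \<in> V - B" using sub disj by auto
      from graph_path_of_rtrancl[OF a(2) this, of V] sep a(1) c show False
        by (fastforce simp: graph_separates_def)
    qed
    then show "c \<in> T" using c sub disj by (auto simp: T_def)
  qed
  moreover have "(s, t) \<notin> E" if "s \<in> S" "t \<in> T" for s t
  proof
    assume "(s, t) \<in> E"
    moreover have "s \<in> V - B" "t \<in> V - B" using that S by (auto simp: T_def)
    ultimately have "(s, t) \<in> ?r" by auto
    then have "t \<in> S" using that(1) by (auto simp: S_def intro: rtrancl_into_rtrancl)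
    then show False using that by (simp add: T_def)
  qed
  moreover have "A \<subseteq> S" by (auto simp: S_def)
  ultimately show ?thesis using S sub by (intro that[of S T]) (auto simp: T_def)
qed

text \<open>Two vertices without a joining path are separated by the empty set, so the partition for
  \<open>B = {}\<close> cuts the vertex set into two non-empty parts without an edge from the first
  to the second.\<close>

lemma connected_graphI:
  assumes "\<And>S T. V = S \<union> T \<Longrightarrow> S \<inter> T = {} \<Longrightarrow> S \<noteq> {} \<Longrightarrow> T \<noteq> {} \<Longrightarrow> \<exists>s\<in>S. \<exists>t\<in>T. (s, t) \<in> E"
  shows "connected_graph V E"
  unfolding connected_graph_def
proof (intro ballI, rule ccontr)
  fix u v assume uv: "u \<in> V" "v \<in> V" and no: "\<not> (\<exists>p. graph_path V E p \<and> hd p = u \<and> last p = v)"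
  have "graph_separates V E {} {u} {v}"
    using no by (auto simp: graph_separates_def)
  then obtain S T where "V = S \<union> {} \<union> T" "S \<inter> T = {}" "{u} \<subseteq> S" "{v} \<subseteq> T"
    "\<And>s t. s \<in> S \<Longrightarrow> t \<in> T \<Longrightarrow> (s, t) \<notin> E"
    by (rule graph_separates_partition) (use uv in auto)
  with assms[of S T] show False by auto
qed

text \<open>A path that avoids all other vertices consists of \<open>i\<close> and \<open>j\<close>
  only, so its second vertex would be \<open>j\<close>, adjacent to \<open>i\<close>. Hence the
  pairwise property is an instance of the global one.\<close>

lemma graph_separates_nonadjacent:
  assumes "i \<noteq> j" "(i, j) \<notin> E"
  shows "graph_separates V E (V - {i, j}) {i} {j}"
  unfolding graph_separates_def
proof (intro allI impI, rule ccontr)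
  fix p assume p: "graph_path V E p \<and> hd p \<in> {i} \<and> last p \<in> {j}" and "\<not> set p \<inter> (V - {i, j}) \<noteq> {}"
  then have sub: "set p \<subseteq> {i, j}" and gp: "p \<noteq> []" "distinct p" "successively (\<lambda>u v. (u, v) \<in> E) p"
    by (auto simp: graph_path_def)
  obtain q where q: "p = i # q" using p gp by (cases p) auto
  obtain x r where r: "q = x # r" using p q assms by (cases q) auto
  then have "x = j" using sub gp q by auto
  then show False using gp q r assms by simp
qed

lemma complete_subset_in_clique:
  assumes "finite V" "complete_subset V E K"
  obtains C where "C \<in> cliques V E" "K \<subseteq> C"
proof -
  have "finite {K. complete_subset V E K}"
    by (rule finite_subset[of _ "Pow V"]) (use assms in \<open>auto simp: complete_subset_def\<close>)
  from finite_has_maximal2[OF this, of K] assms obtain C where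
    "complete_subset V E C" "K \<subseteq> C" "\<And>K'. complete_subset V E K' \<Longrightarrow> C \<subseteq> K' \<Longrightarrow> C = K'"
    by auto
  then show ?thesis by (intro that[of C]) (auto simp: cliques_def)
qed

context
  fixes V :: "nat set" and E :: "(nat \<times> nat) set" and Cs :: "nat set list"
  assumes graph: "undirected_graph V E" and Cs: "clique_sequence V E Cs"
begin

abbreviation initial_union :: "nat \<Rightarrow> nat set" where
  "initial_union n \<equiv> (\<Union>j<n. Cs ! j)"

lemma finite_vertices: "finite V"
  using graph by (simp add: undirected_graph_def)

lemma clique_nth: "n < length Cs \<Longrightarrow> Cs ! n \<in> cliques V E"
  using Cs nth_mem by (auto simp: clique_sequence_def)

lemma clique_nth_subset: "n < length Cs \<Longrightarrow> Cs ! n \<subseteq> V"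
  using clique_nth by (auto simp: cliques_def complete_subset_def)

lemma clique_nth_complete: "n < length Cs \<Longrightarrow> u \<in> Cs ! n \<Longrightarrow> v \<in> Cs ! n \<Longrightarrow> u \<noteq> v \<Longrightarrow> (u, v) \<in> E"
  using clique_nth by (auto simp: cliques_def complete_subset_def)

lemma initial_union_subset: "n \<le> length Cs \<Longrightarrow> initial_union n \<subseteq> V"
  by (rule UN_least) (rule clique_nth_subset, simp)

lemma complete_subset_in_nth:
  assumes "complete_subset V E K"
  obtains n where "n < length Cs" "K \<subseteq> Cs ! n"
proof -
  obtain C where "C \<in> cliques V E" "K \<subseteq> C"
    using complete_subset_in_clique[OF finite_vertices assms] .
  moreover from this obtain n where "n < length Cs" "Cs ! n = C"
    using Cs by (metis clique_sequence_def in_set_conv_nth)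
  ultimately show ?thesis using that by blast
qed

lemma initial_union_all: "initial_union (length Cs) = V"
proof
  show "V \<subseteq> initial_union (length Cs)"
  proof
    fix v assume "v \<in> V"
    then have "complete_subset V E {v}" by (auto simp: complete_subset_def)
    then show "v \<in> initial_union (length Cs)"
      by (rule complete_subset_in_nth) auto
  qed
qed (rule initial_union_subset, simp)

text \<open>Descent by the running intersection property: some clique \<open>m\<close> contains both
  ends. If \<open>n \<le> m\<close>, both ends also occur in earlier cliques, hence lie in the
  separator of \<open>m\<close>, which is contained in a single earlier clique.\<close>

lemma edge_in_initial_clique:
  assumes "n \<le> length Cs" "u \<in> initial_union n" "v \<in> initial_union n" "(u, v) \<in> E"
  shows "\<exists>l<n. u \<in> Cs ! l \<and> v \<in> Cs ! l"
proof -
  have uv: "u \<in> V" "v \<in> V" "(v, u) \<in> E"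
    using assms initial_union_subset graph by (auto simp: undirected_graph_def sym_def)
  then have "complete_subset V E {u, v}" using assms by (auto simp: complete_subset_def)
  then obtain m where "m < length Cs" "{u, v} \<subseteq> Cs ! m" by (rule complete_subset_in_nth)
  then show ?thesis
  proof (induction m rule: less_induct)
    case (less m)
    show ?case
    proof (cases "m < n")
      case False
      have "0 < n" using assms(2) by (cases n) auto
      then have "m \<in> {1..<length Cs}" using less False by auto
      then obtain l where l: "l < m" "separator Cs m \<subseteq> Cs ! l"
        using Cs unfolding clique_sequence_def by blast
      have "{u, v} \<subseteq> separator Cs m"
        using less.prems assms(2,3) False unfolding separator_def by fastforce
      then show ?thesis using less.IH[of l] l less.prems by auto
    qed (use less.prems in auto)
  qed
qed

text \<open>An edge would lie in one clique with index at most \<open>n\<close>. An index below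
  \<open>n\<close> puts \<open>r\<close> into the separator, and the index \<open>n\<close> puts
  \<open>a\<close> into it.\<close>

lemma residual_nonadjacent:
  assumes "n < length Cs" "r \<in> Cs ! n - separator Cs n" "a \<in> initial_union n - separator Cs n"
  shows "(r, a) \<notin> E"
proof
  assume "(r, a) \<in> E"
  moreover have "r \<in> initial_union (Suc n)" "a \<in> initial_union (Suc n)"
    using assms by (auto simp: lessThan_Suc)
  ultimately obtain l where "l < Suc n" "r \<in> Cs ! l" "a \<in> Cs ! l"
    using edge_in_initial_clique[of "Suc n" r a] assms by auto
  then show False using assms by (cases "l = n") (auto simp: separator_def)
qed

end

section \<open>Lebesgue measure on coordinates\<close>

lemma nn_integral_coords_scale:
  assumes "finite J" "0 < t" "F \<in> borel_measurable (lebesgue_on_coords J)"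
  shows "(\<integral>\<^sup>+ z. F (\<lambda>j\<in>J. t * z j) \<partial>lebesgue_on_coords J) =
    ennreal ((1 / t) ^ card J) * integral\<^sup>N (lebesgue_on_coords J) F"
  using assms(1,3)
proof (induction J arbitrary: F)
  case empty
  have "(\<lambda>j\<in>{}. t * z j) = z" if "z \<in> space (lebesgue_on_coords {})" for z
    using that by (auto simp: fun_eq_iff)
  then have "(\<integral>\<^sup>+ z. F (\<lambda>j\<in>{}. t * z j) \<partial>lebesgue_on_coords {}) = integral\<^sup>N (lebesgue_on_coords {}) F"
    by (intro nn_integral_cong) metis
  then show ?case by (simp only: card.empty power_0 ennreal_1 mult_1)
next
  case (insert i J)
  have scale: "(\<lambda>z. \<lambda>j\<in>K. t * z j) \<in> measurable (lebesgue_on_coords K) (lebesgue_on_coords K)" for K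
    by (rule measurable_restrict) simp
  have upd: "(\<lambda>j\<in>insert i J. t * (x(i := y)) j) = (\<lambda>j\<in>J. t * x j)(i := t * y)" for x y
    using insert.hyps by (auto simp: fun_eq_iff)
  have Fy: "(\<lambda>x. F (x(i := y))) \<in> borel_measurable (lebesgue_on_coords J)" for y
  proof -
    have "(\<lambda>x. x(i := y)) \<in> measurable (lebesgue_on_coords J) (lebesgue_on_coords (insert i J))"
      by (rule measurable_fun_upd[where J=J]) auto
    from measurable_compose[OF this insert.prems] show ?thesis .
  qed
  define H where "H y = (\<integral>\<^sup>+ x. F (x(i := y)) \<partial>lebesgue_on_coords J)" for y
  interpret J: sigma_finite_measure "lebesgue_on_coords J" using insert.hyps by simp
  have H: "H \<in> borel_measurable borel"
  proof -
    have "(\<lambda>(y, x). x(i := y)) \<in> measurable (borel \<Otimes>\<^sub>M lebesgue_on_coords J) (lebesgue_on_coords (insert i J))"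
      unfolding case_prod_beta by (rule measurable_fun_upd[where J=J]) auto
    from measurable_compose[OF this insert.prems]
    have "(\<lambda>(y, x). F (x(i := y))) \<in> borel_measurable (borel \<Otimes>\<^sub>M lebesgue_on_coords J)"
      by (simp only: case_prod_beta')
    then show ?thesis unfolding H_def by (rule J.borel_measurable_nn_integral)
  qed
  have "(\<integral>\<^sup>+ z. F (\<lambda>j\<in>insert i J. t * z j) \<partial>lebesgue_on_coords (insert i J)) =
      (\<integral>\<^sup>+ y. \<integral>\<^sup>+ x. F ((\<lambda>j\<in>J. t * x j)(i := t * y)) \<partial>lebesgue_on_coords J \<partial>lborel)"
    unfolding coords.product_nn_integral_insert_rev[OF insert.hyps measurable_compose[OF scale insert.prems]]
      upd by (rule refl)
  also have "\<dots> = (\<integral>\<^sup>+ y. ennreal ((1 / t) ^ card J) * H (t * y) \<partial>lborel)"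
    unfolding H_def by (intro nn_integral_cong insert.IH Fy)
  also have "\<dots> = ennreal ((1 / t) ^ card J) * (\<integral>\<^sup>+ y. H (t * y) \<partial>lborel)"
    by (rule nn_integral_cmult) (use measurable_compose[OF _ H, of "\<lambda>y. t * y" lborel] in simp)
  also have "(\<integral>\<^sup>+ y. H (t * y) \<partial>lborel) = ennreal (1 / t) * (\<integral>\<^sup>+ y. H y \<partial>lborel)"
  proof -
    have "(\<integral>\<^sup>+ y. H y \<partial>lborel) = ennreal t * (\<integral>\<^sup>+ y. H (t * y) \<partial>lborel)"
      using nn_integral_real_affine[OF H, of t 0] assms(2) by simp
    then show ?thesis
      using assms(2) by (simp add: mult.assoc[symmetric] ennreal_mult''[symmetric])
  qed
  also have "(\<integral>\<^sup>+ y. H y \<partial>lborel) = integral\<^sup>N (lebesgue_on_coords (insert i J)) F"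
    unfolding H_def by (rule coords.product_nn_integral_insert_rev[OF insert.hyps insert.prems, symmetric])
  finally show ?case
    using insert.hyps assms(2) by (simp add: mult.assoc[symmetric] ennreal_mult''[symmetric] mult.commute)
qed

lemma AE_coords_nonzero:
  assumes "finite J"
  shows "AE z in lebesgue_on_coords J. \<forall>j\<in>J. z j \<noteq> 0"
proof (rule AE_finite_allI[OF assms])
  fix j assume j: "j \<in> J"
  let ?A = "\<lambda>i. if i = j then {0} else UNIV :: real set"
  have "emeasure (lebesgue_on_coords J) (Pi\<^sub>E J ?A) = (\<Prod>i\<in>J. emeasure lborel (?A i))"
    by (rule coords.emeasure_PiM[OF assms]) auto
  also have "\<dots> = 0" using j assms by (intro prod_zero) auto
  finally have "emeasure (lebesgue_on_coords J) (Pi\<^sub>E J ?A) = 0" .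
  then show "AE z in lebesgue_on_coords J. z j \<noteq> 0"
    by (intro AE_I[of _ _ "Pi\<^sub>E J ?A"]) (use j assms in \<open>auto simp: PiE_iff extensional_def intro!: sets_PiM_I_finite\<close>)
qed

lemma emeasure_coords_box:
  assumes "finite J" "\<And>j. j \<in> J \<Longrightarrow> a j \<le> b j"
  shows "emeasure (lebesgue_on_coords J) (\<Pi>\<^sub>E j\<in>J. {a j<..<b j}) = ennreal (\<Prod>j\<in>J. b j - a j)"
  by (subst coords.emeasure_PiM[OF assms(1)]) (auto simp: assms prod_ennreal)

text \<open>An open box with non-degenerate sides has positive measure and is not contained in a
  null set. This turns almost-everywhere statements into points near a prescribed one.\<close>

lemma AE_ex_in_box:
  assumes "finite J" "\<And>j. j \<in> J \<Longrightarrow> a j < b j" "AE z in lebesgue_on_coords J. P z"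
  shows "\<exists>z \<in> (\<Pi>\<^sub>E j\<in>J. {a j<..<b j}). P z"
proof (rule ccontr)
  let ?B = "\<Pi>\<^sub>E j\<in>J. {a j<..<b j}"
  assume "\<not> ?thesis"
  then have "AE z in lebesgue_on_coords J. z \<notin> ?B"
    using assms(3) by (auto elim!: AE_mp)
  moreover have "?B \<in> sets (lebesgue_on_coords J)"
    by (rule sets_PiM_I_finite[OF assms(1)]) simp
  ultimately have "emeasure (lebesgue_on_coords J) ?B = 0"
    by (subst (asm) AE_iff_measurable[of ?B]) (auto dest: sets.sets_into_space)
  moreover have "0 < (\<Prod>j\<in>J. b j - a j)" using assms(2) by (intro prod_pos) auto
  ultimately show False
    using emeasure_coords_box[OF assms(1), of a b] assms(2) by (simp add: less_imp_le)
qed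

text \<open>Cutting off at \<open>c\<close> removes the singularity at 0, and \<open>1 < p\<close>
  makes the tail integrable. This is the one-dimensional factor of the majorant of
  \<open>lam\<close>.\<close>

lemma integrable_max_powr:
  fixes c p :: real
  assumes "0 < c" "1 < p"
  shows "integrable lborel (\<lambda>x. indicator {0..} x * max c x powr (- p))"
proof -
  have "(\<integral>\<^sup>+ x. ennreal (x powr (- p)) * indicator {c..} x \<partial>lborel) = ennreal (0 - c powr (1 - p) / (1 - p))"
  proof (rule nn_integral_FTC_atLeast)
    show "((\<lambda>x. x powr (1 - p) / (1 - p)) has_real_derivative x powr (- p)) (at x)" if "c \<le> x" for x
    proof -
      have "0 < x" using that assms by simp
      from DERIV_cdivide[OF has_real_derivative_powr[OF this, of "1 - p"], of "1 - p"]
      show ?thesis using assms by simp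
    qed
    have "((\<lambda>x. x powr (1 - p)) \<longlongrightarrow> 0) at_top"
      using assms by (intro tendsto_neg_powr filterlim_ident) auto
    then show "((\<lambda>x. x powr (1 - p) / (1 - p)) \<longlongrightarrow> 0) at_top"
      using assms tendsto_divide[OF _ tendsto_const, of "\<lambda>x. x powr (1 - p)" 0 at_top "1 - p"] by simp
  qed auto
  then have tail: "integrable lborel (\<lambda>x. x powr (- p) * indicator {c..} x)"
    by (intro integrableI_bounded) (auto simp: ennreal_mult' ennreal_indicator abs_mult)
  have head: "integrable lborel (\<lambda>x. c powr (- p) * indicator {0..<c} x)"
    by (intro integrable_mult_right integrable_real_indicator) (use assms in auto)
  have "integrable lborel (\<lambda>x. c powr (- p) * indicator {0..<c} x + x powr (- p) * indicator {c..} x)"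
    by (rule Bochner_Integration.integrable_add[OF head tail])
  also have "(\<lambda>x. c powr (- p) * indicator {0..<c} x + x powr (- p) * indicator {c..} x) =
      (\<lambda>x. indicator {0..} x * max c x powr (- p))"
    using assms by (auto simp: fun_eq_iff indicator_def max_def)
  finally show ?thesis .
qed

text \<open>Vectors indexed by \<open>I\<close> form a full product of sets in which every index
  outside \<open>I\<close> has the factor \<open>{undefined}\<close>, so Tychonoff's theorem
  applies.\<close>

lemma compact_coords_PiE:
  fixes A :: "nat \<Rightarrow> real set"
  assumes "\<And>i. i \<in> I \<Longrightarrow> compact (A i)"
  shows "compact (Pi\<^sub>E I A)"
proof -
  have eq: "Pi\<^sub>E I A = Pi\<^sub>E UNIV (\<lambda>i. if i \<in> I then A i else {undefined})"
    by (auto simp: PiE_iff extensional_def split: if_splits)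
  have "compactin (product_topology (\<lambda>_. euclidean) UNIV) (Pi\<^sub>E UNIV (\<lambda>i. if i \<in> I then A i else {undefined}))"
    using assms by (simp add: compactin_PiE)
  then show ?thesis unfolding eq by (simp add: euclidean_product_topology)
qed

lemma tendsto_coordinatewise:
  fixes x :: "'b \<Rightarrow> nat \<Rightarrow> real"
  assumes "\<And>i. ((\<lambda>n. x n i) \<longlongrightarrow> y i) F"
  shows "(x \<longlongrightarrow> y) F"
proof -
  have "limitin (product_topology (\<lambda>_. euclidean) UNIV) x y F"
    using assms by (simp add: limitin_componentwise)
  then show ?thesis by (simp add: euclidean_product_topology)
qed

section \<open>Exponent measure densities\<close>

lemma orthant_iff: "y \<in> orthant I \<longleftrightarrow> y \<in> I \<rightarrow>\<^sub>E {0..} \<and> (\<exists>i\<in>I. 0 < y i)"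
proof -
  have "y = (\<lambda>i\<in>I. 0) \<longleftrightarrow> (\<forall>i\<in>I. y i = 0)" if "y \<in> I \<rightarrow>\<^sub>E {0..}"
    using that by (auto simp: fun_eq_iff PiE_iff extensional_def)
  then show ?thesis by (force simp: orthant_def PiE_iff)
qed

lemma pareto_space_iff: "y \<in> pareto_space d \<longleftrightarrow> y \<in> {1..d} \<rightarrow>\<^sub>E {0..} \<and> (\<exists>k\<in>{1..d}. 1 < y k)"
proof (cases "d = 0")
  case True
  then show ?thesis by (auto simp: pareto_space_def orthant_iff)
next
  case False
  have "1 < (MAX i\<in>{1..d}. \<bar>y i\<bar>) \<longleftrightarrow> (\<exists>k\<in>{1..d}. 1 < y k)" if "y \<in> {1..d} \<rightarrow>\<^sub>E {0..}"
    using False that by (subst Max_gr_iff) (auto simp: PiE_iff abs_of_nonneg)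
  then show ?thesis by (force simp: pareto_space_def orthant_iff)
qed

lemma continuous_on_coords_scale: "continuous_on X (\<lambda>x :: nat \<Rightarrow> real. \<lambda>i\<in>I. t * x i)"
proof (rule continuous_on_coordinatewise_then_product)
  fix i
  show "continuous_on X (\<lambda>x. (\<lambda>i\<in>I. t * x i) i)"
    by (cases "i \<in> I")
      (auto intro!: continuous_intros continuous_on_product_then_coordinatewise[OF continuous_on_id, unfolded id_def])
qed

locale pareto_model =
  fixes d :: nat and \<Lambda> :: "(nat \<Rightarrow> real) measure" and lam :: "(nat \<Rightarrow> real) \<Rightarrow> real"
  assumes d: "2 \<le> d"
    and exponent: "exponent_measure d \<Lambda> lam"
    and density_pos: "\<forall>y \<in> pareto_space d. (\<forall>i\<in>{1..d}. 0 < y i) \<longrightarrow> 0 < pareto_density d \<Lambda> lam y"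
    and density_cont: "continuous_on (pareto_space d) (pareto_density d \<Lambda> lam)"
begin

abbreviation V :: "nat set" where "V \<equiv> {1..d}"

abbreviation mass :: real where "mass \<equiv> exponent_function d \<Lambda> (\<lambda>_. 1)"

lemma lam_nonneg: "y \<in> orthant V \<Longrightarrow> 0 \<le> lam y"
  using exponent by (simp add: exponent_measure_def)

lemma lam_scale: "0 < t \<Longrightarrow> y \<in> orthant V \<Longrightarrow> lam (\<lambda>i\<in>V. t * y i) = t powr (- (real d + 1)) * lam y"
  using exponent unfolding exponent_measure_def homogeneous_def by blast

lemma orthant_scale: "0 < t \<Longrightarrow> y \<in> orthant I \<Longrightarrow> (\<lambda>i\<in>I. t * y i) \<in> orthant I"
  by (force simp: orthant_iff PiE_iff)

lemma lam_unscale: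
  assumes "0 < t" "y \<in> orthant V"
  shows "lam y = t powr (real d + 1) * lam (\<lambda>i\<in>V. t * y i)"
proof -
  have "t powr (real d + 1) * t powr (- (real d + 1)) = 1"
    using assms(1) by (simp only: powr_add[symmetric]) simp
  then show ?thesis using lam_scale[OF assms] by (simp add: mult.assoc[symmetric])
qed

lemma pareto_space_subset: "pareto_space d \<subseteq> orthant V"
  by (auto simp: pareto_space_def)

text \<open>If the measure of the exceedance region were 0 or infinite, \<open>measure\<close> would
  return 0, and division by 0 would make the density vanish at a point where it is positive.\<close>

lemma mass_pos: "0 < mass"
proof -
  have "(\<lambda>i\<in>V. 2) \<in> pareto_space d" using d by (auto simp: pareto_space_iff intro!: bexI[of _ 1])
  then have "pareto_density d \<Lambda> lam (\<lambda>i\<in>V. 2) > 0" using density_pos by auto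
  moreover have "0 \<le> mass" by (simp add: exponent_function_def)
  ultimately show ?thesis 
    unfolding pareto_density_def by (cases "mass = 0") (auto split: if_splits)
qed

lemma lam_eq_density: "y \<in> pareto_space d \<Longrightarrow> lam y = mass * pareto_density d \<Lambda> lam y"
  using mass_pos by (simp add: pareto_density_def)

lemma lam_pos: assumes "y \<in> pos_orthant V" shows "0 < lam y"
proof -
  have y1: "1 \<in> V" "0 < y 1" using d assms by auto
  \<comment> \<open>The first coordinate becomes 2, which moves the point into
    \<open>pareto_space\<close>, where positivity is assumed.\<close>
  define t where "t = 2 / y 1"
  have t: "0 < t" "1 < t * y 1" using y1 by (auto simp: t_def)
  have y: "y \<in> orthant V" using assms y1 by (auto simp: orthant_iff PiE_iff less_imp_le intro!: bexI[of _ 1])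
  have w: "(\<lambda>i\<in>V. t * y i) \<in> pareto_space d"
    using assms t y1 by (auto simp: pareto_space_iff PiE_iff less_imp_le intro!: bexI[of _ 1])
  moreover have "\<forall>i\<in>V. 0 < (\<lambda>i\<in>V. t * y i) i" using assms t by (auto simp: PiE_iff)
  ultimately have "0 < pareto_density d \<Lambda> lam (\<lambda>i\<in>V. t * y i)" using density_pos by blast
  then have "0 < lam (\<lambda>i\<in>V. t * y i)" using lam_eq_density[OF w] mass_pos by simp
  then show ?thesis using lam_scale[OF t(1) y] t(1) by (simp add: zero_less_mult_iff)
qed

lemma lam_continuous: "continuous_on (orthant V) lam"
  unfolding continuous_on_eq_continuous_within
proof
  fix y assume y: "y \<in> orthant V"
  then obtain k where k: "k \<in> V" "0 < y k" by (auto simp: orthant_iff)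
  define t where "t = 2 / y k"
  \<comment> \<open>One factor \<open>t\<close> serves a whole neighbourhood: if the
    \<open>k\<close>-th coordinate of \<open>x\<close> exceeds half of \<open>y k\<close>, then
    scaling by \<open>t\<close> makes it exceed 1. So continuity on \<open>pareto_space\<close>
    transfers through homogeneity.\<close>
  have t: "0 < t" using k by (simp add: t_def)
  define U where "U = {x :: nat \<Rightarrow> real. y k / 2 < x k}"
  have "open U" unfolding U_def
    by (intro open_Collect_less continuous_intros continuous_on_product_then_coordinatewise[OF continuous_on_id, unfolded id_def])
  have eq: "lam x = t powr (real d + 1) * (mass * pareto_density d \<Lambda> lam (\<lambda>i\<in>V. t * x i))"
    and scaled: "(\<lambda>i\<in>V. t * x i) \<in> pareto_space d" if "x \<in> U \<inter> orthant V" for x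
  proof -
    have x: "x \<in> orthant V" "1 < t * x k" using that k by (auto simp: U_def t_def field_simps)
    then show "(\<lambda>i\<in>V. t * x i) \<in> pareto_space d"
      using orthant_scale[OF t x(1)] k by (auto simp: pareto_space_iff orthant_iff)
    then show "lam x = t powr (real d + 1) * (mass * pareto_density d \<Lambda> lam (\<lambda>i\<in>V. t * x i))"
      using lam_unscale[OF t x(1)] lam_eq_density by simp
  qed
  have "continuous_on (U \<inter> orthant V) (\<lambda>x. pareto_density d \<Lambda> lam (\<lambda>i\<in>V. t * x i))"
    by (rule continuous_on_compose2[OF density_cont continuous_on_coords_scale]) (use scaled in blast)
  then have "continuous_on (U \<inter> orthant V) (\<lambda>x. t powr (real d + 1) * (mass * pareto_density d \<Lambda> lam (\<lambda>i\<in>V. t * x i)))"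
    by (intro continuous_intros)
  then have "continuous_on (U \<inter> orthant V) lam"
    by (rule continuous_on_eq) (simp add: eq)
  moreover have "y \<in> U \<inter> orthant V" using y k by (simp add: U_def)
  ultimately have "continuous (at y within U \<inter> orthant V) lam"
    by (simp add: continuous_on_eq_continuous_within)
  moreover have "at y within U \<inter> orthant V = at y within orthant V"
    by (rule at_within_nhd[of y U]) (use \<open>y \<in> U \<inter> orthant V\<close> \<open>open U\<close> in auto)
  ultimately show "continuous (at y within orthant V) lam" by simp
qed

text \<open>\<open>lam\<close> is bounded on a compact sphere of the maximum norm, and homogeneity
  carries the bound to every other radius.\<close>

lemma lam_le_max_powr:
  obtains K where "0 \<le> K"
    and "\<And>y k. y \<in> orthant V \<Longrightarrow> k \<in> V \<Longrightarrow> (\<And>i. i \<in> V \<Longrightarrow> y i \<le> y k) \<Longrightarrow>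
      lam y \<le> K * y k powr (- (real d + 1))"
proof -
  \<comment> \<open>The radius is 2 because \<open>pareto_space\<close>, where continuity is
    assumed, contains only points of norm strictly above 1.\<close>
  define X where "X = (\<Union>k\<in>V. \<Pi>\<^sub>E i\<in>V. if i = k then {2} else {0..2 :: real})"
  have "compact X" unfolding X_def by (intro compact_UN compact_coords_PiE) auto
  moreover have sub: "X \<subseteq> pareto_space d"
  proof (rule subsetI)
    fix x assume "x \<in> X"
    then obtain k where k: "k \<in> V" and x: "x \<in> (\<Pi>\<^sub>E i\<in>V. if i = k then {2} else {0..2})"
      by (auto simp: X_def)
    have "x i \<in> {0..}" if "i \<in> V" for i using PiE_mem[OF x that] by (auto split: if_splits)
    moreover have "x k = 2" using PiE_mem[OF x k] by simp
    ultimately show "x \<in> pareto_space d"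
      using x k by (auto simp: pareto_space_iff PiE_iff intro!: bexI[of _ k])
  qed
  ultimately have "compact (pareto_density d \<Lambda> lam ` X)"
    using continuous_on_subset[OF density_cont] compact_continuous_image by blast
  from compact_imp_bounded[OF this]
  obtain K where K: "\<And>x. x \<in> X \<Longrightarrow> \<bar>pareto_density d \<Lambda> lam x\<bar> \<le> K"
    by (auto simp: bounded_iff)
  have "0 \<le> \<bar>K\<bar> * mass * 2 powr (real d + 1)" using mass_pos by simp
  then show ?thesis
  proof (rule that)
    fix y k assume y: "y \<in> orthant V" and k: "k \<in> V" and max: "\<And>i. i \<in> V \<Longrightarrow> y i \<le> y k"
    have yk: "0 < y k" using y max by (auto simp: orthant_iff intro: less_le_trans)
    define t where "t = 2 / y k"
    have t: "0 < t" using yk by (simp add: t_def)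
    let ?w = "\<lambda>i\<in>V. t * y i"
    have "?w \<in> (\<Pi>\<^sub>E i\<in>V. if i = k then {2} else {0..2})"
      using y k yk max by (auto simp: t_def orthant_iff PiE_iff field_simps)
    then have w: "?w \<in> X" using k by (auto simp: X_def)
    have "lam ?w = mass * pareto_density d \<Lambda> lam ?w" using w sub by (intro lam_eq_density) auto
    also have "\<dots> \<le> mass * \<bar>K\<bar>" using K[OF w] mass_pos by (intro mult_left_mono) auto
    finally have "t powr (real d + 1) * lam ?w \<le> t powr (real d + 1) * (mass * \<bar>K\<bar>)"
      by (rule mult_left_mono) simp
    then have "lam y \<le> \<bar>K\<bar> * mass * t powr (real d + 1)"
      using lam_unscale[OF t y] by (simp add: mult_ac)
    also have "t powr (real d + 1) = 2 powr (real d + 1) * y k powr (- (real d + 1))"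
      using yk powr_divide[of 2 "y k" "real d + 1"]
      unfolding t_def powr_minus divide_inverse[symmetric] by simp
    finally show "lam y \<le> \<bar>K\<bar> * mass * 2 powr (real d + 1) * y k powr (- (real d + 1))"
      by (simp add: mult_ac)
  qed
qed

text \<open>Spreading the total decay exponent \<open>d + 1\<close> evenly over the \<open>d\<close> coordinates leaves the
  exponent \<open>(d + 1) / d > 1\<close> for each, so the bound is integrable in any of them.\<close>

definition decay :: real where "decay = (real d + 1) / real d"

lemma decay: "1 < decay" "decay * real d = real d + 1"
  using d by (auto simp: decay_def field_simps)

text \<open>The power of the largest coordinate is written as \<open>d\<close> equal factors. Each
  is enlarged separately: the largest coordinate is at least \<open>c\<close>, and at least
  \<open>max c (y j)\<close> for every \<open>j\<close>. The bound no longer involves the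
  coordinates in \<open>I\<close>, which makes it uniform in them.\<close>

lemma lam_le_prod:
  assumes "0 < c" "I \<subseteq> V"
  obtains K where "0 \<le> K"
    and "\<And>y. y \<in> V \<rightarrow>\<^sub>E {0..} \<Longrightarrow> \<exists>i\<in>I. c \<le> y i \<Longrightarrow>
      lam y \<le> K * (\<Prod>j\<in>V - I. max c (y j) powr (- decay))"
proof -
  obtain K where K: "0 \<le> K" "\<And>y k. y \<in> orthant V \<Longrightarrow> k \<in> V \<Longrightarrow> (\<And>i. i \<in> V \<Longrightarrow> y i \<le> y k) \<Longrightarrow>
      lam y \<le> K * y k powr (- (real d + 1))"
    by (rule lam_le_max_powr) blast
  have fin: "finite I" using assms finite_subset by auto
  have "0 \<le> K * (c powr (- decay)) ^ card I" using K(1) by simp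
  then show ?thesis
  proof (rule that)
    fix y assume y: "y \<in> V \<rightarrow>\<^sub>E {0..}" and "\<exists>i\<in>I. c \<le> y i"
    then obtain i where i: "i \<in> I" "c \<le> y i" by blast
    have "V \<noteq> {}" using d by auto
    then obtain k where k: "k \<in> V" "\<And>i. i \<in> V \<Longrightarrow> y i \<le> y k"
      using Max_in[of "y ` V"] Max_ge[of "y ` V"] by fastforce
    have c_le: "c \<le> y k" using i k(2)[of i] assms by auto
    have y': "y \<in> orthant V" using y k(1) c_le assms(1) by (auto simp: orthant_iff intro!: bexI[of _ k])
    have anti: "y k powr (- decay) \<le> u powr (- decay)" if "0 < u" "u \<le> y k" for u
      using that decay by (simp add: powr_minus powr_mono2 le_imp_inverse_le)
    have "y k powr (- (real d + 1)) = (y k powr (- decay)) ^ d"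
      using c_le assms decay by (simp add: powr_power mult.commute)
    also have "\<dots> = (\<Prod>j\<in>V. y k powr (- decay))" by simp
    also have "\<dots> = (\<Prod>j\<in>I. y k powr (- decay)) * (\<Prod>j\<in>V - I. y k powr (- decay))"
      using assms by (metis prod.subset_diff finite_atLeastAtMost mult.commute)
    also have "\<dots> \<le> (\<Prod>j\<in>I. c powr (- decay)) * (\<Prod>j\<in>V - I. max c (y j) powr (- decay))"
      using assms c_le k by (intro mult_mono prod_mono prod_nonneg conjI anti) auto
    finally have "y k powr (- (real d + 1)) \<le> (c powr (- decay)) ^ card I * (\<Prod>j\<in>V - I. max c (y j) powr (- decay))"
      by simp
    then have "K * y k powr (- (real d + 1)) \<le> K * ((c powr (- decay)) ^ card I * (\<Prod>j\<in>V - I. max c (y j) powr (- decay)))"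
      using K(1) by (rule mult_left_mono)
    with K(2)[OF y' k] show "lam y \<le> K * (c powr (- decay)) ^ card I * (\<Prod>j\<in>V - I. max c (y j) powr (- decay))"
      by (simp add: mult.assoc)
  qed
qed

end

section \<open>Extensions of the density by zero and their partial integrals\<close>

lemma ennreal_scale_fixpoint:
  fixes X :: ennreal
  assumes "X = ennreal a * X" "a \<noteq> 1" "0 \<le> a"
  shows "X = 0 \<or> X = \<infinity>"
  using assms by (cases X) (auto simp: ennreal_mult''[symmetric])

context pareto_model
begin

text \<open>Two extensions of \<open>lam\<close> by zero, differing only on the faces of the orthant: the first one
  splits everywhere if \<open>lam\<close> splits on the open orthant, the second one computes the marginals also
  at boundary points.\<close>

definition lam_int :: "(nat \<Rightarrow> real) \<Rightarrow> ennreal" where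
  "lam_int x = (if \<forall>i\<in>V. 0 < x i then ennreal (lam (restrict x V)) else 0)"

definition lam_ext :: "(nat \<Rightarrow> real) \<Rightarrow> ennreal" where
  "lam_ext x = (if restrict x V \<in> orthant V then ennreal (lam (restrict x V)) else 0)"

lemma lam_int_restrict [simp]: "lam_int (restrict x V) = lam_int x"
  by (simp add: lam_int_def)

lemma lam_ext_restrict [simp]: "lam_ext (restrict x V) = lam_ext x"
  by (simp add: lam_ext_def)

lemma lam_ext_finite [simp]: "lam_ext x \<noteq> \<infinity>" "lam_ext x \<noteq> \<top>" "lam_ext x < \<top>"
  by (simp_all add: lam_ext_def)

lemma lam_int_finite [simp]: "lam_int x \<noteq> \<infinity>" "lam_int x \<noteq> \<top>" "lam_int x < \<top>"
  by (simp_all add: lam_int_def)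

lemma lam_int_eq: "x \<in> pos_orthant V \<Longrightarrow> lam_int x = ennreal (lam x)"
  by (auto simp: lam_int_def PiE_iff extensional_restrict)

lemma lam_ext_eq: "x \<in> orthant V \<Longrightarrow> lam_ext x = ennreal (lam x)"
  by (auto simp: lam_ext_def orthant_iff PiE_iff extensional_restrict)

lemma lam_int_eq_ext: "(\<And>i. i \<in> V \<Longrightarrow> x i \<noteq> 0) \<Longrightarrow> lam_int x = lam_ext x"
proof (cases "\<forall>i\<in>V. 0 < x i")
  case True
  then have "restrict x V \<in> orthant V" using d by (auto simp: orthant_iff PiE_iff less_imp_le intro!: bexI[of _ 1])
  then show ?thesis using True by (simp add: lam_int_def lam_ext_def)
next
  case False
  assume nz: "\<And>i. i \<in> V \<Longrightarrow> x i \<noteq> 0"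
  from False obtain i where i: "i \<in> V" "x i \<le> 0" by (auto simp: not_less simp del: atLeastAtMost_iff)
  then have "\<not> 0 \<le> restrict x V i" using nz[OF i(1)] by (simp del: atLeastAtMost_iff)
  then have "restrict x V \<notin> orthant V" using i(1) by (auto simp: orthant_iff PiE_iff simp del: atLeastAtMost_iff)
  then show ?thesis using False unfolding lam_int_def lam_ext_def by (simp only: if_False)
qed

lemma orthant_measurable: "orthant V \<in> sets (lebesgue_on_coords V)"
proof -
  have "orthant V = {x \<in> space (lebesgue_on_coords V). (\<forall>i\<in>V. 0 \<le> x i) \<and> (\<exists>i\<in>V. 0 < x i)}"
    by (auto simp: orthant_iff PiE_iff simp del: atLeastAtMost_iff)
  also have "\<dots> \<in> sets (lebesgue_on_coords V)" by measurable
  finally show ?thesis .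
qed

lemma lam_ext_measurable [measurable]: "lam_ext \<in> borel_measurable (lebesgue_on_coords V)"
proof -
  have "lam \<in> borel_measurable (restrict_space (lebesgue_on_coords V) (orthant V))"
    using exponent by (simp add: exponent_measure_def)
  then have "(\<lambda>x. ennreal (lam x)) \<in> borel_measurable (restrict_space (lebesgue_on_coords V) (orthant V))"
    by (rule measurable_compose) simp
  moreover have "orthant V \<inter> space (lebesgue_on_coords V) \<in> sets (lebesgue_on_coords V)"
    using orthant_measurable by (rule sets.Int) simp
  ultimately have "(\<lambda>x. ennreal (lam x) * indicator (orthant V) x) \<in> borel_measurable (lebesgue_on_coords V)"
    by (simp only: borel_measurable_restrict_space_iff_ennreal)
  then show ?thesis
    by (rule measurable_cong[THEN iffD1, rotated])
      (auto simp: lam_ext_def indicator_def PiE_iff extensional_restrict)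
qed

lemma lam_int_measurable [measurable]: "lam_int \<in> borel_measurable (lebesgue_on_coords V)"
proof -
  have "(\<lambda>x. if \<forall>i\<in>V. 0 < x i then lam_ext x else 0) \<in> borel_measurable (lebesgue_on_coords V)"
    by measurable
  moreover have "(\<lambda>x. if \<forall>i\<in>V. 0 < x i then lam_ext x else 0) = lam_int"
  proof
    fix x
    show "(if \<forall>i\<in>V. 0 < x i then lam_ext x else 0) = lam_int x"
    proof (cases "\<forall>i\<in>V. 0 < x i")
      case True
      then have "lam_int x = lam_ext x" by (intro lam_int_eq_ext) force
      then show ?thesis using True by simp
    qed (auto simp: lam_int_def)
  qed
  ultimately show ?thesis by simp
qed

lemma measurable_lam_ext_override:
  assumes "J \<subseteq> V"
  shows "(\<lambda>z. lam_ext (override_on y z J)) \<in> borel_measurable (lebesgue_on_coords J)"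
proof -
  have "lam_ext (override_on y z J) = lam_ext (override_on (restrict y V) z J)" for z :: "nat \<Rightarrow> real"
  proof -
    have "restrict (override_on y z J) V = restrict (override_on (restrict y V) z J) V"
      by (auto simp: override_on_def fun_eq_iff)
    then show ?thesis by (metis lam_ext_restrict)
  qed
  then show ?thesis
    using measurable_coord_integrand[OF assms lam_ext_measurable, of "restrict y V"] by simp
qed

lemma lam_int_restrict_override: "lam_int (override_on (restrict y V) z J) = lam_int (override_on y z J)"
proof -
  have "restrict (override_on (restrict y V) z J) V = restrict (override_on y z J) V"
    by (auto simp: override_on_def fun_eq_iff)
  then show ?thesis by (metis lam_int_restrict)
qed

text \<open>The two extensions differ only where some coordinate is zero. For integrated coordinates
  this is a null set, and for the fixed ones it is excluded by assumption.\<close>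

lemma coord_integral_int_eq_ext:
  assumes "J \<subseteq> V" "\<And>i. i \<in> V - J \<Longrightarrow> y i \<noteq> 0"
  shows "coord_integral J lam_int y = coord_integral J lam_ext y"
  unfolding coord_integral_def
proof (rule nn_integral_cong_AE, rule AE_mp[OF AE_coords_nonzero], rule finite_subset[OF assms(1)], simp,
    intro AE_I2 impI)
  fix z :: "nat \<Rightarrow> real" assume "\<forall>j\<in>J. z j \<noteq> 0"
  then show "lam_int (override_on y z J) = lam_ext (override_on y z J)"
    using assms by (intro lam_int_eq_ext) (auto simp: override_on_def)
qed

lemma lam_ext_scale:
  assumes "0 < t" "\<And>i. i \<in> V \<Longrightarrow> x' i = t * x i"
  shows "lam_ext x' = ennreal (t powr (- (real d + 1))) * lam_ext x"
proof -
  note atLeastAtMost_iff [simp del]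
  have eq: "restrict x' V = (\<lambda>i\<in>V. t * restrict x V i)"
    using assms by (auto simp: fun_eq_iff)
  have iff: "restrict x' V \<in> orthant V \<longleftrightarrow> restrict x V \<in> orthant V"
    using assms by (auto simp: orthant_iff PiE_iff zero_le_mult_iff zero_less_mult_iff)
  show ?thesis
  proof (cases "restrict x V \<in> orthant V")
    case True
    then show ?thesis
      using iff lam_scale[OF assms(1) True] lam_nonneg[OF True]
      unfolding lam_ext_def eq by (simp add: ennreal_mult'')
  qed (use iff in \<open>simp add: lam_ext_def\<close>)
qed

text \<open>Homogeneity contributes \<open>t powr (- (real d + 1))\<close>, and rescaling the
  integrated variables contributes one factor \<open>t\<close> for each of them.\<close>

lemma coord_integral_lam_ext_scale:
  assumes "J \<subseteq> V" "0 < t" "\<And>i. i \<in> V - J \<Longrightarrow> y' i = t * y i"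
  shows "coord_integral J lam_ext y' =
    ennreal (t powr (- (real d + 1)) * t ^ card J) * coord_integral J lam_ext y"
proof -
  have fin: "finite J" using assms finite_subset by auto
  let ?H = "\<lambda>z. lam_ext (override_on y' z J)"
  have "ennreal ((1 / t) ^ card J) * coord_integral J lam_ext y' =
      (\<integral>\<^sup>+ z. ?H (\<lambda>j\<in>J. t * z j) \<partial>lebesgue_on_coords J)"
    unfolding coord_integral_def
    by (rule nn_integral_coords_scale[symmetric, OF fin assms(2) measurable_lam_ext_override[OF assms(1)]])
  also have "\<dots> = (\<integral>\<^sup>+ z. ennreal (t powr (- (real d + 1))) * lam_ext (override_on y z J) \<partial>lebesgue_on_coords J)"
    using assms by (intro nn_integral_cong lam_ext_scale) (auto simp: override_on_def)
  also have "\<dots> = ennreal (t powr (- (real d + 1))) * coord_integral J lam_ext y"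
    unfolding coord_integral_def by (rule nn_integral_cmult[OF measurable_lam_ext_override[OF assms(1)]])
  finally have "ennreal (t ^ card J) * (ennreal ((1 / t) ^ card J) * coord_integral J lam_ext y') =
      ennreal (t ^ card J) * (ennreal (t powr (- (real d + 1))) * coord_integral J lam_ext y)"
    by simp
  moreover have "t ^ card J * (1 / t) ^ card J = 1"
    using assms(2) by (simp add: power_mult_distrib[symmetric])
  ultimately show ?thesis
    using assms(2) by (simp add: mult.assoc[symmetric] ennreal_mult''[symmetric] mult.commute)
qed

text \<open>Doubling fixes the origin, so the integral equals itself times a factor below 1, since
  at most \<open>d\<close> coordinates are integrated against the decay \<open>d + 1\<close>. The
  case \<open>I = {}\<close> concerns the total mass.\<close>

lemma coord_integral_lam_ext_zero:
  assumes "I \<subseteq> V" "\<And>i. i \<in> I \<Longrightarrow> y i = 0"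
  shows "coord_integral (V - I) lam_ext y = 0 \<or> coord_integral (V - I) lam_ext y = \<infinity>"
proof (rule ennreal_scale_fixpoint)
  let ?a = "2 powr (- (real d + 1)) * 2 ^ card (V - I) :: real"
  have VI: "V - (V - I) = I" using assms by auto
  show "coord_integral (V - I) lam_ext y = ennreal ?a * coord_integral (V - I) lam_ext y"
    by (rule coord_integral_lam_ext_scale) (use assms VI in auto)
  have "card (V - I) \<le> d" using card_mono[of V "V - I"] by auto
  then have "(2::real) ^ card (V - I) \<le> 2 ^ d" by (rule power_increasing) simp
  also have "\<dots> < 2 powr (real d + 1)" by (simp add: powr_add powr_realpow)
  finally have "?a < 2 powr (- (real d + 1)) * 2 powr (real d + 1)" by (intro mult_strict_left_mono) auto
  also have "\<dots> = 1" by (simp only: powr_add[symmetric]) simp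
  finally show "?a \<noteq> 1" by simp
qed simp

text \<open>The total mass is 0 or infinite by scaling, and the normalization on the half-space of
  the first coordinate makes it at least 1.\<close>

lemma coord_integral_all_infinite: "coord_integral V lam_int y = \<infinity>"
proof -
  have "(\<integral>\<^sup>+ x \<in> {x \<in> orthant V. 1 < x 1}. ennreal (lam x) \<partial>lebesgue_on_coords V) = 1"
    using exponent d by (simp add: exponent_measure_def)
  moreover have "(\<integral>\<^sup>+ x \<in> {x \<in> orthant V. 1 < x 1}. ennreal (lam x) \<partial>lebesgue_on_coords V) \<le>
      integral\<^sup>N (lebesgue_on_coords V) lam_ext"
    by (intro nn_integral_mono) (auto simp: indicator_def lam_ext_eq)
  moreover have "integral\<^sup>N (lebesgue_on_coords V) lam_ext = coord_integral V lam_ext (restrict y V)"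
    by (rule coord_integral_all[symmetric]) simp
  moreover have "\<dots> = coord_integral V lam_int (restrict y V)"
    by (rule coord_integral_int_eq_ext[symmetric]) auto
  moreover have "\<dots> = coord_integral V lam_int y"
    by (rule coord_integral_cong) (rule lam_int_restrict_override)
  ultimately show ?thesis
    using coord_integral_lam_ext_zero[of "{}" "restrict y V"] by auto
qed

definition dominating :: "real \<Rightarrow> real \<Rightarrow> nat set \<Rightarrow> (nat \<Rightarrow> real) \<Rightarrow> real" where
  "dominating K c J z = K * (\<Prod>j\<in>J. indicator {0..} (z j) * max c (z j) powr (- decay))"

lemma integrable_dominating:
  "finite J \<Longrightarrow> 0 < c \<Longrightarrow> integrable (lebesgue_on_coords J) (dominating K c J)"
  unfolding dominating_def
  by (intro integrable_mult_right coords.product_integrable_prod integrable_max_powr decay)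

text \<open>The majorant depends on the fixed coordinates only through the lower bound
  \<open>c\<close> for one of them. It therefore gives finiteness of the partial integrals and also
  serves all members of a convergent sequence in dominated convergence.\<close>

lemma lam_ext_le_dominating:
  assumes "0 < c" "I \<subseteq> V"
  obtains K where "0 \<le> K"
    and "\<And>y z i. i \<in> I \<Longrightarrow> c \<le> y i \<Longrightarrow>
      lam_ext (override_on y z (V - I)) \<le> ennreal (dominating K c (V - I) z)"
proof -
  obtain K where K: "0 \<le> K" "\<And>y. y \<in> V \<rightarrow>\<^sub>E {0..} \<Longrightarrow> \<exists>i\<in>I. c \<le> y i \<Longrightarrow>
      lam y \<le> K * (\<Prod>j\<in>V - I. max c (y j) powr (- decay))"
    by (rule lam_le_prod[OF assms]) blast
  show ?thesis
  proof (rule that[OF K(1)])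
    fix y z :: "nat \<Rightarrow> real" and i assume i: "i \<in> I" "c \<le> y i"
    let ?x = "restrict (override_on y z (V - I)) V"
    show "lam_ext (override_on y z (V - I)) \<le> ennreal (dominating K c (V - I) z)"
    proof (cases "?x \<in> orthant V")
      case True
      then have x: "?x \<in> V \<rightarrow>\<^sub>E {0..}" by (simp add: orthant_iff)
      have xj: "?x j = z j" if "j \<in> V - I" for j using that by (simp add: override_on_def)
      have "i \<in> V" using i assms by blast
      then have "?x i = y i" using i(1) by (simp add: override_on_def)
      then have "c \<le> ?x i" using i(2) by (simp only:)
      then have "lam ?x \<le> K * (\<Prod>j\<in>V - I. max c (?x j) powr (- decay))"
        by (intro K(2)[OF x] bexI[OF _ i(1)])
      also have "(\<Prod>j\<in>V - I. max c (?x j) powr (- decay)) =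
          (\<Prod>j\<in>V - I. indicator {0..} (z j) * max c (z j) powr (- decay))"
      proof (rule prod.cong[OF refl])
        fix j assume j: "j \<in> V - I"
        have "0 \<le> z j" using PiE_mem[OF x, of j] j xj[OF j] by auto
        then show "max c (?x j) powr (- decay) = indicator {0..} (z j) * max c (z j) powr (- decay)"
          unfolding xj[OF j] by simp
      qed
      finally show ?thesis
        unfolding lam_ext_def dominating_def using True by (simp only: if_True ennreal_leI)
    qed (simp add: lam_ext_def)
  qed
qed

lemma coord_integral_lam_ext_finite:
  assumes "I \<subseteq> V" "i \<in> I" "0 < y i"
  shows "coord_integral (V - I) lam_ext y < \<infinity>"
proof -
  obtain K where K: "0 \<le> K" "\<And>y' z i'. i' \<in> I \<Longrightarrow> y i \<le> y' i' \<Longrightarrow>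
      lam_ext (override_on y' z (V - I)) \<le> ennreal (dominating K (y i) (V - I) z)"
    by (rule lam_ext_le_dominating[OF assms(3,1)]) blast
  have "coord_integral (V - I) lam_ext y \<le> (\<integral>\<^sup>+ z. ennreal (dominating K (y i) (V - I) z) \<partial>lebesgue_on_coords (V - I))"
    unfolding coord_integral_def by (intro nn_integral_mono K(2)[OF assms(2)]) simp
  also have "\<dots> < \<infinity>"
  proof -
    have "integrable (lebesgue_on_coords (V - I)) (dominating K (y i) (V - I))"
      by (rule integrable_dominating) (use assms in auto)
    then show ?thesis
      by (subst nn_integral_eq_integral)
        (auto simp: dominating_def intro!: AE_I2 mult_nonneg_nonneg prod_nonneg K(1))
  qed
  finally show ?thesis .
qed

lemma coord_integral_lam_int_finite:
  assumes "I \<subseteq> V" "I \<noteq> {}" "y \<in> pos_orthant V"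
  shows "coord_integral (V - I) lam_int y < \<infinity>"
proof -
  obtain i where "i \<in> I" using assms by auto
  then have "coord_integral (V - I) lam_ext y < \<infinity>"
    using assms by (intro coord_integral_lam_ext_finite[of I i]) auto
  moreover have "y i \<noteq> 0" if "i \<in> V" for i using PiE_mem[OF assms(3) that] by auto
  ultimately show ?thesis by (subst coord_integral_int_eq_ext) auto
qed

lemma coord_integral_lam_ext_pos:
  assumes "I \<subseteq> V" "\<And>i. i \<in> I \<Longrightarrow> 0 < y i"
  shows "coord_integral (V - I) lam_ext y \<noteq> 0"
proof
  assume "coord_integral (V - I) lam_ext y = 0"
  then have "AE z in lebesgue_on_coords (V - I). lam_ext (override_on y z (V - I)) = 0"
    unfolding coord_integral_def using measurable_lam_ext_override[of "V - I" y]
    by (subst (asm) nn_integral_0_iff_AE) auto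
  from AE_ex_in_box[OF _ _ this, of "\<lambda>_. 0" "\<lambda>_. 1"]
  obtain z where z: "z \<in> (\<Pi>\<^sub>E j\<in>V - I. {0<..<1})" and "lam_ext (override_on y z (V - I)) = 0" by auto
  moreover have x: "restrict (override_on y z (V - I)) V \<in> pos_orthant V"
    using z assms by (auto simp: override_on_def PiE_iff)
  moreover have "restrict (override_on y z (V - I)) V \<in> orthant V"
    using x d by (force simp: orthant_iff PiE_iff intro!: bexI[of _ 1])
  ultimately show False using lam_pos[OF x] by (simp add: lam_ext_def)
qed

end

section \<open>Marginal densities: positivity, homogeneity and continuity\<close>

lemma override_on_orthant:
  assumes "I \<subseteq> W" and y: "y \<in> I \<rightarrow>\<^sub>E {0..}" and z: "\<And>j. j \<in> W - I \<Longrightarrow> 0 \<le> z j"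
    and nz: "(\<exists>i\<in>I. 0 < y i) \<or> (\<exists>j\<in>W - I. 0 < z j)"
  shows "override_on y z (W - I) \<in> orthant W"
proof -
  have "y x = undefined" if "x \<notin> W" for x using PiE_arb[OF y] assms(1) that by blast
  then have "override_on y z (W - I) \<in> W \<rightarrow>\<^sub>E {0..}"
    using z PiE_mem[OF y] by (auto simp: override_on_def)
  moreover have "\<exists>i\<in>W. 0 < override_on y z (W - I) i"
    using nz assms(1) by (force simp: override_on_def)
  ultimately show ?thesis by (simp add: orthant_iff)
qed

context pareto_model
begin

lemma lam_ext_negative:
  assumes "j \<in> J" "j \<in> V" "z j < 0"
  shows "lam_ext (override_on y z J) = 0"
proof -
  have "restrict (override_on y z J) V j = z j" using assms by (simp add: override_on_def)
  then have "restrict (override_on y z J) V \<notin> orthant V"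
    using assms PiE_mem[of _ V "\<lambda>_. {0..}" j] unfolding orthant_iff by (metis atLeast_iff not_le)
  then show ?thesis by (simp add: lam_ext_def)
qed

text \<open>The value of \<open>lam\<close> at the origin is unconstrained, whereas
  \<open>lam_ext\<close> is 0 there. The origin matters only if nothing is integrated and
  \<open>y\<close> itself is zero, which the last assumption excludes; otherwise it is not met or is
  a null set.\<close>

lemma marginal_density_integral:
  assumes "I \<subseteq> V" "I \<noteq> {}" "y \<in> I \<rightarrow>\<^sub>E {0..}" "y \<in> orthant I \<or> I \<noteq> V"
  shows "marginal_density d lam I y =
    (LINT z | lebesgue_on_coords (V - I). enn2real (lam_ext (override_on y z (V - I))))"
proof -
  let ?J = "V - I"
  let ?f = "\<lambda>z. indicator (?J \<rightarrow>\<^sub>E {0..}) z * lam (merge I ?J (y, z))"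
  let ?g = "\<lambda>z. enn2real (lam_ext (override_on y z ?J))"
  let ?c = "lam (merge I ?J (y, \<lambda>j\<in>?J. 0))"
  have eq: "?f z = ?g z" if z: "z \<in> ?J \<rightarrow>\<^sub>E UNIV" and nz: "(\<exists>i\<in>I. y i \<noteq> 0) \<or> (\<exists>j\<in>?J. z j \<noteq> 0)" for z
  proof -
    have ov: "merge I ?J (y, z) = override_on y z ?J"
      by (rule override_on_eq_merge[OF assms(3,1), symmetric])
    show ?thesis
    proof (cases "z \<in> ?J \<rightarrow>\<^sub>E {0..}")
      case True
      have "0 \<le> y i" if "i \<in> I" for i using PiE_mem[OF assms(3) that] by simp
      moreover have "0 \<le> z j" if "j \<in> ?J" for j using PiE_mem[OF True that] by simp
      ultimately have "override_on y z ?J \<in> orthant V"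
        using nz by (intro override_on_orthant[OF assms(1,3)]) (auto simp: less_le simp del: atLeastAtMost_iff)
      then show ?thesis unfolding ov using True lam_nonneg by (simp add: lam_ext_eq)
    next
      case False
      then obtain j where j: "j \<in> ?J" "\<not> 0 \<le> z j" using z by (auto simp: PiE_iff)
      then have "lam_ext (override_on y z ?J) = 0" by (intro lam_ext_negative[of j]) auto
      then show ?thesis using False by simp
    qed
  qed
  have g: "?g \<in> borel_measurable (lebesgue_on_coords ?J)"
    by (rule measurable_compose[OF measurable_lam_ext_override]) auto
  have f: "?f \<in> borel_measurable (lebesgue_on_coords ?J)"
  proof (cases "\<exists>i\<in>I. y i \<noteq> 0")
    case True
    then show ?thesis using g eq
      by (subst measurable_cong[where g="?g"]) (simp_all del: indicator_eq_0_iff)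
  next
    \<comment> \<open>For \<open>y = 0\<close> the integrand may have any value at the origin and
      equals \<open>?g\<close> elsewhere, so measurability requires a separate argument.\<close>
    case False
    have "(\<lambda>z. if \<forall>j\<in>?J. z j = 0 then ?c else ?g z) \<in> borel_measurable (lebesgue_on_coords ?J)"
    proof (rule measurable_If)
      show "{z \<in> space (lebesgue_on_coords ?J). \<forall>j\<in>?J. z j = 0} \<in> sets (lebesgue_on_coords ?J)"
        by measurable
    qed (use g in simp_all)
    moreover have "?f z = (if \<forall>j\<in>?J. z j = 0 then ?c else ?g z)" if z: "z \<in> ?J \<rightarrow>\<^sub>E UNIV" for z
    proof (cases "\<forall>j\<in>?J. z j = 0")
      case True
      then have "z = (\<lambda>j\<in>?J. 0)"
        using z by (force simp: fun_eq_iff PiE_iff extensional_def restrict_def)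
      then show ?thesis by (simp add: PiE_iff)
    next
      case False
      then show ?thesis using eq[OF z] by (simp only: if_False) blast
    qed
    ultimately show ?thesis by (subst measurable_cong) auto
  qed
  have "AE z in lebesgue_on_coords ?J. ?f z = ?g z"
  proof (cases "y \<in> orthant I")
    case True
    then have "\<exists>i\<in>I. y i \<noteq> 0" unfolding orthant_iff by force
    then show ?thesis using eq by (intro AE_I2) (simp only: space_coords simp_thms)
  next
    case False
    then obtain j where j: "j \<in> ?J" using assms by blast
    have "AE z in lebesgue_on_coords ?J. \<forall>j\<in>?J. z j \<noteq> 0" by (rule AE_coords_nonzero) simp
    then show ?thesis
    proof (rule AE_mp, intro AE_I2 impI)
      fix z assume "z \<in> space (lebesgue_on_coords ?J)" "\<forall>j\<in>?J. z j \<noteq> 0"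
      then show "?f z = ?g z" using j by (intro eq) (simp, blast)
    qed
  qed
  then have "integral\<^sup>L (lebesgue_on_coords ?J) ?f = integral\<^sup>L (lebesgue_on_coords ?J) ?g"
    by (rule integral_cong_AE[OF f g])
  then show ?thesis
    using assms(2) by (simp add: marginal_density_def set_lebesgue_integral_def)
qed

text \<open>Divergence is covered as well: the library's integral is then 0, and
  \<open>enn2real\<close> maps \<open>\<infinity>\<close> to 0.\<close>

lemma marginal_density_eq:
  assumes "I \<subseteq> V" "I \<noteq> {}" "y \<in> I \<rightarrow>\<^sub>E {0..}" "y \<in> orthant I \<or> I \<noteq> V"
  shows "marginal_density d lam I y = enn2real (coord_integral (V - I) lam_ext y)"
proof -
  have "(\<lambda>z. enn2real (lam_ext (override_on y z (V - I)))) \<in> borel_measurable (lebesgue_on_coords (V - I))"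
    by (rule measurable_compose[OF measurable_lam_ext_override]) auto
  then show ?thesis
    unfolding marginal_density_integral[OF assms] coord_integral_def
    by (subst integral_eq_nn_integral) simp_all
qed

lemma marginal_density_origin:
  assumes "I \<subseteq> V" "I \<noteq> {}" "I \<noteq> V"
  shows "marginal_density d lam I (\<lambda>i\<in>I. 0) = 0"
  using marginal_density_eq[of I "\<lambda>i\<in>I. 0"] coord_integral_lam_ext_zero[of I "\<lambda>i\<in>I. 0"] assms by auto

lemma marginal_density_pos:
  assumes "I \<subseteq> V" "I \<noteq> {}" "y \<in> pos_orthant I"
  shows "0 < marginal_density d lam I y"
proof -
  obtain i where i: "i \<in> I" using assms by auto
  have pos: "0 < y j" if "j \<in> I" for j using PiE_mem[OF assms(3) that] by simp
  have y: "y \<in> I \<rightarrow>\<^sub>E {0..}" using assms(3) by (auto simp: PiE_iff less_imp_le)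
  then have "y \<in> orthant I" using pos i by (auto simp: orthant_iff)
  then show ?thesis
    using marginal_density_eq[OF assms(1,2) y] coord_integral_lam_ext_pos[OF assms(1) pos]
      coord_integral_lam_ext_finite[of I i y, OF assms(1) i pos[OF i]]
    by (simp add: enn2real_positive_iff zero_less_iff_neq_zero)
qed

lemma marginal_density_homogeneous:
  assumes "I \<subseteq> V" "I \<noteq> {}"
  shows "homogeneous I (- (real (card I) + 1)) (marginal_density d lam I)"
  unfolding homogeneous_def
proof (intro allI impI ballI)
  fix t :: real and y assume t: "0 < t" and y: "y \<in> orthant I"
  have fin: "finite I" using assms finite_subset by auto
  let ?a = "t powr (- (real d + 1)) * t ^ card (V - I)"
  have "card I \<le> d" using card_mono[of V I] assms by auto
  then have "real (card (V - I)) = real d - real (card I)"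
    using card_Diff_subset[OF fin assms(1)] by simp
  moreover have "?a = t powr (- (real d + 1) + real (card (V - I)))"
    unfolding powr_add using t by (simp add: powr_realpow)
  moreover have "- (real d + 1) + (real d - real (card I)) = - (real (card I) + 1)" by simp
  ultimately have a: "?a = t powr (- (real (card I) + 1))" by (simp only:)
  have ty: "(\<lambda>i\<in>I. t * y i) \<in> orthant I" by (rule orthant_scale[OF t y])
  have "coord_integral (V - I) lam_ext (\<lambda>i\<in>I. t * y i) = ennreal ?a * coord_integral (V - I) lam_ext y"
    by (rule coord_integral_lam_ext_scale) (use t assms in auto)
  then show "marginal_density d lam I (\<lambda>i\<in>I. t * y i) = t powr (- (real (card I) + 1)) * marginal_density d lam I y"
    using marginal_density_eq[OF assms, of y] marginal_density_eq[OF assms, of "\<lambda>i\<in>I. t * y i"] y ty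
    unfolding a by (simp add: orthant_iff enn2real_mult)
qed

lemma marginal_density_continuous:
  assumes "I \<subseteq> V" "I \<noteq> {}"
  shows "continuous_on (orthant I) (marginal_density d lam I)"
  unfolding continuous_on_sequentially
proof (intro allI ballI impI, elim conjE)
  fix x :: "nat \<Rightarrow> nat \<Rightarrow> real" and a assume a: "a \<in> orthant I" and x: "\<forall>n. x n \<in> orthant I" and lim: "x \<longlonglongrightarrow> a"
  let ?J = "V - I"
  have lim_coord: "(\<lambda>n. x n i) \<longlonglongrightarrow> a i" for i
    using continuous_on_tendsto_compose[OF continuous_on_product_coordinates[of i] lim] by simp
  obtain k where k: "k \<in> I" "0 < a k" using a by (auto simp: orthant_iff)
  have "eventually (\<lambda>n. a k / 2 < x n k) sequentially"
    using order_tendstoD(1)[OF lim_coord[of k], of "a k / 2"] k by simp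
  then obtain N where N: "\<And>n. N \<le> n \<Longrightarrow> a k / 2 < x n k" by (auto simp: eventually_sequentially)
  \<comment> \<open>Half of \<open>a k\<close> is eventually a lower bound for the
    \<open>k\<close>-th coordinates along the sequence, so a single majorant suffices. The shift by
    \<open>N\<close> makes it valid for every index.\<close>
  obtain K where K: "0 \<le> K" "\<And>y z i. i \<in> I \<Longrightarrow> a k / 2 \<le> y i \<Longrightarrow>
      lam_ext (override_on y z ?J) \<le> ennreal (dominating K (a k / 2) ?J z)"
    by (rule lam_ext_le_dominating[of "a k / 2" I]) (use k assms in auto)
  have dom_nonneg: "0 \<le> dominating K (a k / 2) ?J z" for z
    unfolding dominating_def using K(1) by (intro mult_nonneg_nonneg prod_nonneg) auto
  let ?g = "\<lambda>y z. enn2real (lam_ext (override_on y z ?J))"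
  have eq: "marginal_density d lam I y = (LINT z | lebesgue_on_coords ?J. ?g y z)" if "y \<in> orthant I" for y
    using that by (intro marginal_density_integral assms) (auto simp: orthant_iff)
  have "(\<lambda>n. LINT z | lebesgue_on_coords ?J. ?g (x (n + N)) z) \<longlonglongrightarrow> (LINT z | lebesgue_on_coords ?J. ?g a z)"
  proof (rule integral_dominated_convergence)
    show "integrable (lebesgue_on_coords ?J) (dominating K (a k / 2) ?J)"
      using k by (intro integrable_dominating) auto
    show "?g a \<in> borel_measurable (lebesgue_on_coords ?J)"
      "\<And>n. ?g (x (n + N)) \<in> borel_measurable (lebesgue_on_coords ?J)"
      by (rule measurable_compose[OF measurable_lam_ext_override]; auto)+
    show "AE z in lebesgue_on_coords ?J. norm (?g (x (n + N)) z) \<le> dominating K (a k / 2) ?J z" for n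
    proof (rule AE_I2)
      fix z
      have "lam_ext (override_on (x (n + N)) z ?J) \<le> ennreal (dominating K (a k / 2) ?J z)"
        using N[of "n + N"] by (intro K(2)[OF k(1)]) simp
      then show "norm (?g (x (n + N)) z) \<le> dominating K (a k / 2) ?J z"
        using enn2real_mono[of _ "ennreal (dominating K (a k / 2) ?J z)"] dom_nonneg[of z] by simp
    qed
    show "AE z in lebesgue_on_coords ?J. (\<lambda>n. ?g (x (n + N)) z) \<longlonglongrightarrow> ?g a z"
    proof (rule AE_I2, rule LIMSEQ_ignore_initial_segment)
      fix z assume "z \<in> space (lebesgue_on_coords ?J)"
      show "(\<lambda>n. ?g (x n) z) \<longlonglongrightarrow> ?g a z"
      proof (cases "\<forall>j\<in>?J. 0 \<le> z j")
        case True
        have in_orthant: "override_on y z ?J \<in> orthant V" if y: "y \<in> orthant I" for y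
          using True y by (intro override_on_orthant[OF assms(1)]) (auto simp: orthant_iff simp del: atLeastAtMost_iff)
        have "(\<lambda>n. override_on (x n) z ?J) \<longlonglongrightarrow> override_on a z ?J"
          using lim_coord by (intro tendsto_coordinatewise) (auto simp: override_on_def)
        then have "(\<lambda>n. lam (override_on (x n) z ?J)) \<longlonglongrightarrow> lam (override_on a z ?J)"
          by (rule continuous_on_tendsto_compose[OF lam_continuous])
            (use in_orthant a x in auto)
        moreover have "?g y z = lam (override_on y z ?J)" if "y \<in> orthant I" for y
          using in_orthant[OF that] lam_nonneg by (simp add: lam_ext_eq)
        ultimately show ?thesis using a x by simp
      next
        case False
        then obtain j where j: "j \<in> ?J" "\<not> 0 \<le> z j" by blast
        have "lam_ext (override_on y z ?J) = 0" for y
          using j by (intro lam_ext_negative[of j]) auto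
        then show ?thesis by simp
      qed
    qed
  qed
  then have "(\<lambda>n. marginal_density d lam I (x (n + N))) \<longlonglongrightarrow> marginal_density d lam I a"
    using eq a x by simp
  then have "(\<lambda>n. marginal_density d lam I (x n)) \<longlonglongrightarrow> marginal_density d lam I a"
    by (rule LIMSEQ_offset)
  then show "(marginal_density d lam I \<circ> x) \<longlonglongrightarrow> marginal_density d lam I a"
    by (simp add: comp_def)
qed

text \<open>The marginal as a function of the full vector, based on \<open>lam_int\<close> so that
  it inherits the splitting everywhere. For the empty index set it is the total mass
  \<open>\<infinity>\<close>, unlike \<open>marginal_density\<close>, which is 1 by
  convention.\<close>

definition marg :: "nat set \<Rightarrow> (nat \<Rightarrow> real) \<Rightarrow> ennreal" where
  "marg I = coord_integral (V - I) lam_int"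

lemma marginal_density_marg:
  assumes "I \<subseteq> V" "I \<noteq> {}" "y \<in> pos_orthant V"
  shows "marginal_density d lam I (restrict y I) = enn2real (marg I y)"
proof -
  have pos: "0 < y i" if "i \<in> V" for i using PiE_mem[OF assms(3) that] by simp
  obtain i where i: "i \<in> I" using assms by auto
  have r: "restrict y I \<in> I \<rightarrow>\<^sub>E {0..}" "restrict y I \<in> orthant I"
    using i pos assms(1) by (auto simp: orthant_iff less_imp_le subset_eq)
  have "coord_integral (V - I) lam_ext (restrict y I) = coord_integral (V - I) lam_ext y"
    by (rule coord_integral_restrict[OF _ assms(1)]) (use assms(3) in \<open>simp add: PiE_iff\<close>)
  also have "\<dots> = marg I y"
    unfolding marg_def by (rule coord_integral_int_eq_ext[symmetric]) (use pos in force)+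
  finally show ?thesis using marginal_density_eq[OF assms(1,2) r(1)] r(2) by simp
qed

section \<open>Markov properties of Pareto vectors\<close>

definition lam_splits :: "(nat \<times> nat) set \<Rightarrow> bool" where
  "lam_splits E \<longleftrightarrow> (\<forall>i\<in>V. \<forall>j\<in>V. i \<noteq> j \<and> (i, j) \<notin> E \<longrightarrow> splits_on V lam {i} {j})"

lemma lam_int_splits:
  assumes "lam_splits E" "S \<subseteq> V" "T \<subseteq> V" "S \<inter> T = {}"
    and "\<And>s t. s \<in> S \<Longrightarrow> t \<in> T \<Longrightarrow> (s, t) \<notin> E"
  shows "splits_at lam_int S T x z"
proof -
  have pairs: "splits_on V lam {s} {t}" if "s \<in> S" "t \<in> T" for s t
  proof -
    have "s \<in> V" "t \<in> V" "s \<noteq> t" using that assms(2-4) by blast+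
    then show ?thesis using assms(1) assms(5)[OF that] unfolding lam_splits_def by blast
  qed
  have lam: "splits_on V lam S T"
    by (rule splits_on_sets[where f=lam]) (fact lam_pos assms(2,3) finite_atLeastAtMost pairs)+
  have "splits_on V (\<lambda>y. enn2real (lam_int y)) S T"
    by (rule splits_on_cong[OF _ assms(2,3) lam]) (simp add: lam_int_eq lam_pos less_imp_le)
  then show ?thesis
  proof (rule splits_at_extend[OF _ assms(2,3) order_refl assms(4)])
    show "lam_int y = 0" if "i \<in> V" "y i \<le> 0" for y i
      using that unfolding lam_int_def by (meson not_less)
  qed (rule lam_int_finite lam_int_restrict | blast)+
qed

text \<open>For a split without conditioning coordinates the remaining factor would be the total mass of
  \<open>lam\<close>, which is infinite, whereas the marginals are finite.\<close>

lemma lam_splits_connected: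
  assumes "lam_splits E"
  shows "connected_graph V E"
proof (rule connected_graphI, rule ccontr)
  fix S T assume V: "V = S \<union> T" and "S \<inter> T = {}" "S \<noteq> {}" "T \<noteq> {}" and no: "\<not> (\<exists>s\<in>S. \<exists>t\<in>T. (s, t) \<in> E)"
  let ?y = "\<lambda>i\<in>V. 1 :: real"
  have sub: "S \<subseteq> V" "T \<subseteq> V" and ST: "V - S = T" "V - T = S" using V \<open>S \<inter> T = {}\<close> by auto
  have y: "?y \<in> V \<rightarrow>\<^sub>E UNIV" "?y \<in> pos_orthant V" by auto
  have "lam_int ?y * coord_integral (S \<union> T) lam_int ?y = coord_integral S lam_int ?y * coord_integral T lam_int ?y"
    by (rule coord_integral_splits[OF _ sub \<open>S \<inter> T = {}\<close> y(1) lam_int_measurable])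
      (use no in \<open>auto intro!: lam_int_splits[OF assms sub \<open>S \<inter> T = {}\<close>]\<close>)
  moreover have "coord_integral (S \<union> T) lam_int ?y = \<infinity>"
    unfolding V[symmetric] by (rule coord_integral_all_infinite)
  moreover have "lam_int ?y \<noteq> 0" unfolding lam_int_eq[OF y(2)] using lam_pos[OF y(2)] by simp
  moreover have "coord_integral S lam_int ?y < \<infinity>" "coord_integral T lam_int ?y < \<infinity>"
    using coord_integral_lam_int_finite[OF sub(1) \<open>S \<noteq> {}\<close> y(2)]
      coord_integral_lam_int_finite[OF sub(2) \<open>T \<noteq> {}\<close> y(2)] unfolding ST by simp_all
  ultimately show False
    by (metis ennreal_mult_eq_top_iff infinity_ennreal_def less_irrefl)
qed

text \<open>The density of \<open>Y\<close> given that coordinate \<open>k\<close> exceeds 1. By the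
  normalization of \<open>lam\<close> this event has probability \<open>1 / mass\<close>, which
  cancels the constant in the density of \<open>Y\<close>.\<close>

definition exceed_density :: "nat \<Rightarrow> (nat \<Rightarrow> real) \<Rightarrow> ennreal" where
  "exceed_density k x = lam_int x * indicator {1<..} (x k)"

lemma exceed_density_measurable [measurable]:
  "k \<in> V \<Longrightarrow> exceed_density k \<in> borel_measurable (lebesgue_on_coords V)"
  unfolding exceed_density_def[abs_def] by measurable

text \<open>The indicator involves only the coordinate \<open>k\<close>, which lies outside
  \<open>S\<close> or outside \<open>T\<close>, so it splits; products of splitting functions
  split.\<close>

lemma exceed_density_splits:
  assumes "lam_splits E" "S \<subseteq> V" "T \<subseteq> V" "S \<inter> T = {}"
    and "\<And>s t. s \<in> S \<Longrightarrow> t \<in> T \<Longrightarrow> (s, t) \<notin> E"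
  shows "splits_at (exceed_density k) S T x z"
  unfolding exceed_density_def[abs_def]
proof (rule splits_at_mult)
  show "splits_at lam_int S T x z" by (rule lam_int_splits) fact+
  have "splits_at (\<lambda>x. indicator {1<..} (x k) :: ennreal) S T x z" if "k \<notin> S" for S T :: "nat set"
    using that by (intro splits_at_indep) (simp add: override_on_def)
  then show "splits_at (\<lambda>x. indicator {1<..} (x k) :: ennreal) S T x z"
    using assms(4) by (cases "k \<in> S") (auto intro: splits_at_symm)
qed

end

section \<open>Laws of the conditioned vectors and the global Markov property\<close>

locale pareto_vector = pareto_model +
  fixes M :: "'a measure" and Y :: "'a \<Rightarrow> nat \<Rightarrow> real"
  assumes vector: "multivariate_pareto d \<Lambda> lam M Y"
begin

lemma Y_distributed:
  "distributed M (lebesgue_on_coords V) Y (\<lambda>y. ennreal (pareto_density d \<Lambda> lam y))"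
  using vector by (simp add: multivariate_pareto_def)

text \<open>Once one coordinate exceeds 1, membership in \<open>pareto_space\<close> and in the
  orthant coincide, so the support restriction in the density of \<open>Y\<close> is
  invisible.\<close>

lemma pareto_density_exceed:
  assumes "k \<in> V" "x \<in> V \<rightarrow>\<^sub>E UNIV"
  shows "ennreal (pareto_density d \<Lambda> lam x) * indicator {1<..} (x k) =
    ennreal (1 / mass) * (lam_ext x * indicator {1<..} (x k))"
proof (cases "1 < x k")
  case True
  have r: "restrict x V = x" using assms(2) by (simp add: PiE_iff extensional_restrict)
  have "0 < x k" using True by simp
  then have iff: "x \<in> pareto_space d \<longleftrightarrow> x \<in> orthant V"
    using True assms(1) unfolding pareto_space_iff orthant_iff by blast
  show ?thesis
  proof (cases "x \<in> orthant V")
    case True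
    then have "pareto_density d \<Lambda> lam x = 1 / mass * lam x"
      unfolding pareto_density_def using iff by simp
    then show ?thesis
      unfolding lam_ext_eq[OF True] using mass_pos lam_nonneg[OF True] by (simp only: ennreal_mult'' mult.assoc)
  next
    case False
    then show ?thesis using iff by (simp add: pareto_density_def lam_ext_def r[simplified])
  qed
qed simp

lemma emeasure_exceed:
  assumes k: "k \<in> V" and F: "F \<in> sets (lebesgue_on_coords V)"
  shows "emeasure M ({\<omega> \<in> space M. 1 < Y \<omega> k} \<inter> (Y -` F \<inter> space M)) =
    ennreal (1 / mass) * (\<integral>\<^sup>+ x. exceed_density k x * indicator F x \<partial>lebesgue_on_coords V)"
proof -
  have [measurable]: "Y \<in> measurable M (lebesgue_on_coords V)"
    using Y_distributed by (simp add: distributed_def)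
  let ?A = "{x \<in> space (lebesgue_on_coords V). 1 < x k}"
  have A: "?A \<in> sets (lebesgue_on_coords V)" using k by measurable
  have "{\<omega> \<in> space M. 1 < Y \<omega> k} \<inter> (Y -` F \<inter> space M) = Y -` (?A \<inter> F) \<inter> space M"
    using sets.sets_into_space[OF F] by auto
  then have "emeasure M ({\<omega> \<in> space M. 1 < Y \<omega> k} \<inter> (Y -` F \<inter> space M)) =
      (\<integral>\<^sup>+ x. ennreal (pareto_density d \<Lambda> lam x) * indicator (?A \<inter> F) x \<partial>lebesgue_on_coords V)"
    using distributed_emeasure[OF Y_distributed sets.Int[OF A F]] by simp
  also have "\<dots> = (\<integral>\<^sup>+ x. ennreal (1 / mass) * (exceed_density k x * indicator F x) \<partial>lebesgue_on_coords V)"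
  proof (rule nn_integral_cong_AE, rule AE_mp[OF AE_coords_nonzero], simp, intro AE_I2 impI)
    fix x assume x: "x \<in> space (lebesgue_on_coords V)" "\<forall>j\<in>V. x j \<noteq> 0"
    have "ennreal (pareto_density d \<Lambda> lam x) * indicator (?A \<inter> F) x =
        (ennreal (pareto_density d \<Lambda> lam x) * indicator {1<..} (x k)) * indicator F x"
      using x by (auto simp: indicator_def)
    also have "\<dots> = ennreal (1 / mass) * (lam_ext x * indicator {1<..} (x k)) * indicator F x"
      using x by (subst pareto_density_exceed[OF k]) auto
    also have "lam_ext x = lam_int x" using x(2) by (intro lam_int_eq_ext[symmetric]) blast
    finally show "ennreal (pareto_density d \<Lambda> lam x) * indicator (?A \<inter> F) x =
        ennreal (1 / mass) * (exceed_density k x * indicator F x)"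
      by (simp add: exceed_density_def mult.assoc)
  qed
  also have "\<dots> = ennreal (1 / mass) * (\<integral>\<^sup>+ x. exceed_density k x * indicator F x \<partial>lebesgue_on_coords V)"
    using F by (intro nn_integral_cmult borel_measurable_times_ennreal exceed_density_measurable[OF k]) auto
  finally show ?thesis .
qed

lemma exceed_density_total:
  assumes k: "k \<in> V"
  shows "(\<integral>\<^sup>+ x. exceed_density k x \<partial>lebesgue_on_coords V) = 1"
proof -
  have "(\<integral>\<^sup>+ x. exceed_density k x \<partial>lebesgue_on_coords V) =
      (\<integral>\<^sup>+ x \<in> {x \<in> orthant V. 1 < x k}. ennreal (lam x) \<partial>lebesgue_on_coords V)"
  proof (rule nn_integral_cong_AE, rule AE_mp[OF AE_coords_nonzero], simp, intro AE_I2 impI)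
    fix x assume x: "x \<in> space (lebesgue_on_coords V)" "\<forall>j\<in>V. x j \<noteq> 0"
    have r: "restrict x V = x" using x(1) by (simp add: PiE_iff extensional_restrict)
    have "lam_int x = lam_ext x" using x(2) by (intro lam_int_eq_ext) blast
    then show "exceed_density k x = ennreal (lam x) * indicator {x \<in> orthant V. 1 < x k} x"
      unfolding exceed_density_def lam_ext_def r by (simp add: indicator_def)
  qed
  then show ?thesis using exponent k by (simp add: exponent_measure_def)
qed

lemma exceed_prob:
  assumes k: "k \<in> V"
  shows "{\<omega> \<in> space M. 1 < Y \<omega> k} \<in> sets M"
    and "emeasure M {\<omega> \<in> space M. 1 < Y \<omega> k} = ennreal (1 / mass)"
proof -
  have Y [measurable]: "Y \<in> measurable M (lebesgue_on_coords V)"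
    using Y_distributed by (simp add: distributed_def)
  have [measurable]: "(\<lambda>\<omega>. Y \<omega> k) \<in> borel_measurable M"
    using measurable_compose[OF Y measurable_component_singleton[OF k]] by simp
  show "{\<omega> \<in> space M. 1 < Y \<omega> k} \<in> sets M" by measurable
  have "{\<omega> \<in> space M. 1 < Y \<omega> k} \<inter> (Y -` space (lebesgue_on_coords V) \<inter> space M) = {\<omega> \<in> space M. 1 < Y \<omega> k}"
    using measurable_space[OF Y] by blast
  moreover have "(\<integral>\<^sup>+ x. exceed_density k x * indicator (space (lebesgue_on_coords V)) x \<partial>lebesgue_on_coords V) = 1"
    using exceed_density_total[OF k] by (subst nn_integral_cong[where v="exceed_density k"]) simp_all
  ultimately show "emeasure M {\<omega> \<in> space M. 1 < Y \<omega> k} = ennreal (1 / mass)"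
    using emeasure_exceed[OF k sets.top] by simp
qed

lemma prob_space_exceed:
  assumes "k \<in> V"
  shows "prob_space (cond_exceed M Y k)"
  unfolding cond_exceed_def
  by (rule prob_space_uniform_measure) (use exceed_prob[OF assms] mass_pos in auto)

lemma distributed_exceed:
  assumes k: "k \<in> V"
  shows "distributed (cond_exceed M Y k) (lebesgue_on_coords V) Y (exceed_density k)"
  unfolding distributed_def
proof (intro conjI)
  have Y: "Y \<in> measurable M (lebesgue_on_coords V)"
    using Y_distributed by (simp add: distributed_def)
  then show Y': "Y \<in> measurable (cond_exceed M Y k) (lebesgue_on_coords V)"
    by (simp add: cond_exceed_def)
  show "exceed_density k \<in> borel_measurable (lebesgue_on_coords V)"
    by (rule exceed_density_measurable[OF k])
  show "distr (cond_exceed M Y k) (lebesgue_on_coords V) Y = density (lebesgue_on_coords V) (exceed_density k)"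
  proof (rule measure_eqI)
    fix F assume "F \<in> sets (distr (cond_exceed M Y k) (lebesgue_on_coords V) Y)"
    then have F: "F \<in> sets (lebesgue_on_coords V)" by simp
    let ?I = "\<integral>\<^sup>+ x. exceed_density k x * indicator F x \<partial>lebesgue_on_coords V"
    have "emeasure (distr (cond_exceed M Y k) (lebesgue_on_coords V) Y) F =
        emeasure (cond_exceed M Y k) (Y -` F \<inter> space M)"
      by (subst emeasure_distr[OF Y' F]) (simp add: cond_exceed_def)
    also have "\<dots> = ennreal (1 / mass) * ?I / ennreal (1 / mass)"
      unfolding cond_exceed_def
      by (subst emeasure_uniform_measure[OF exceed_prob(1)[OF k] measurable_sets[OF Y F]])
        (simp only: emeasure_exceed[OF k F] exceed_prob(2)[OF k])
    also have "\<dots> = ?I"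
      using mass_pos by (subst mult.commute) (intro mult_divide_eq_ennreal; simp)
    also have "\<dots> = emeasure (density (lebesgue_on_coords V) (exceed_density k)) F"
      by (rule emeasure_density[symmetric, OF exceed_density_measurable[OF k] F])
    finally show "emeasure (distr (cond_exceed M Y k) (lebesgue_on_coords V) Y) F =
        emeasure (density (lebesgue_on_coords V) (exceed_density k)) F" .
  qed simp
qed

lemma lam_splits_global_markov:
  assumes "lam_splits E"
  shows "global_markov d E M Y"
  unfolding global_markov_def
proof (intro ballI allI impI, elim conjE)
  fix k A B C
  assume k: "k \<in> V" and sub: "A \<subseteq> V" "B \<subseteq> V" "C \<subseteq> V"
    and disj: "A \<inter> B = {}" "A \<inter> C = {}" "B \<inter> C = {}" and sep: "graph_separates V E B A C"
  obtain S T where ST: "V = S \<union> B \<union> T" "S \<inter> B = {}" "S \<inter> T = {}" "B \<inter> T = {}" "A \<subseteq> S" "C \<subseteq> T"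
    and no: "\<And>s t. s \<in> S \<Longrightarrow> t \<in> T \<Longrightarrow> (s, t) \<notin> E"
    using graph_separates_partition[OF sep sub disj(1,3)] by metis
  have "splits_at (exceed_density k) S T x z" for x z
    by (rule exceed_density_splits[OF assms _ _ ST(3) no]) (use ST(1) in auto)
  then show "cond_indep_coords (cond_exceed M Y k) Y A C B"
    by (intro cond_indep_coords_if_splits[OF prob_space_exceed[OF k] _ sub(2) distributed_exceed[OF k] ST]) simp_all
qed

lemma global_markov_pairwise_markov:
  assumes "global_markov d E M Y"
  shows "pairwise_markov d E M Y"
  unfolding pairwise_markov_def extremal_cond_indep_def
proof (intro ballI impI, elim conjE)
  fix i j k assume ij: "i \<in> V" "j \<in> V" and k: "k \<in> V" and "i \<noteq> j" "(i, j) \<notin> E"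
  then have "graph_separates V E (V - {i, j}) {i} {j}" by (intro graph_separates_nonadjacent)
  moreover have "{i} \<subseteq> V" "V - {i, j} \<subseteq> V" "{j} \<subseteq> V" "{i} \<inter> (V - {i, j}) = {}" "{i} \<inter> {j} = {}" "(V - {i, j}) \<inter> {j} = {}"
    using ij \<open>i \<noteq> j\<close> by blast+
  ultimately show "cond_indep_coords (cond_exceed M Y k) Y {i} {j} (V - {i, j})"
    using assms[unfolded global_markov_def, rule_format, OF k, of "{i}" "V - {i, j}" "{j}"] by blast
qed

end

section \<open>From pairwise conditional independence to the pointwise identity\<close>

context pareto_model
begin

lemma override_on_scale:
  "J \<subseteq> W \<Longrightarrow> override_on (\<lambda>i\<in>W. t * y i) (\<lambda>i\<in>W. t * z i) J = (\<lambda>i\<in>W. t * override_on y z J i)"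
  for y z :: "nat \<Rightarrow> real"
  by (auto simp: override_on_def fun_eq_iff)

lemma pos_orthant_subset_orthant: "pos_orthant V \<subseteq> orthant V"
proof
  fix y assume y: "y \<in> pos_orthant V"
  have "1 \<in> V" using d by simp
  then have "0 < y 1" using PiE_mem[OF y] by simp
  then show "y \<in> orthant V"
    using y \<open>1 \<in> V\<close> unfolding orthant_iff by (auto simp: PiE_iff less_imp_le simp del: atLeastAtMost_iff)
qed

text \<open>By homogeneity it suffices to look at points far away from the origin.\<close>

lemma splits_on_lam_if_far:
  assumes "S \<subseteq> V" "T \<subseteq> V" "k \<in> V"
    and far: "\<And>y z. y \<in> pos_orthant V \<Longrightarrow> z \<in> pos_orthant V \<Longrightarrow> 1 < y k \<Longrightarrow> 1 < z k \<Longrightarrow> splits_at lam S T y z"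
  shows "splits_on V lam S T"
  unfolding splits_on_def
proof (intro ballI)
  fix y z assume y: "y \<in> pos_orthant V" and z: "z \<in> pos_orthant V"
  have yz: "0 < y k" "0 < z k" using PiE_mem[OF y assms(3)] PiE_mem[OF z assms(3)] by simp_all
  define t where "t = 2 / min (y k) (z k)"
  have t: "0 < t" "1 < t * y k" "1 < t * z k"
    using yz by (auto simp: t_def min_def field_simps)
  let ?s = "\<lambda>y. \<lambda>i\<in>V. t * y i"
  have pos: "?s x \<in> pos_orthant V" if "x \<in> pos_orthant V" for x
    using that t(1) by (auto simp: PiE_iff)
  have "splits_at lam S T (?s y) (?s z)"
    using t assms(3) by (intro far pos y z) simp_all
  then have "lam (?s (override_on y z {})) * lam (?s (override_on y z (S \<union> T))) =
      lam (?s (override_on y z S)) * lam (?s (override_on y z T))"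
    using assms(1,2) unfolding splits_at_def by (simp add: override_on_scale del: One_nat_def)
  moreover have scaled: "lam (?s (override_on y z J)) = t powr (- (real d + 1)) * lam (override_on y z J)" if "J \<subseteq> V" for J
    using override_on_pos_orthant[OF y z that] pos_orthant_subset_orthant by (intro lam_scale[OF t(1)]) blast
  moreover have "t powr (- (real d + 1)) \<noteq> 0" using t(1) by simp
  ultimately have "(t powr (- (real d + 1)) * t powr (- (real d + 1))) * (lam (override_on y z {}) * lam (override_on y z (S \<union> T))) =
      (t powr (- (real d + 1)) * t powr (- (real d + 1))) * (lam (override_on y z S) * lam (override_on y z T))"
    using scaled[OF empty_subsetI] scaled[OF Un_least[OF assms(1,2)]] scaled[OF assms(1)] scaled[OF assms(2)]
    by (simp only: mult_ac)
  then show "splits_at lam S T y z"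
    using t(1) by (simp add: splits_at_def)
qed

text \<open>Continuity in the product topology, restated with one \<open>\<delta>\<close> for the
  finitely many relevant coordinates. Otherwise there are counterexamples within
  \<open>1 / (n + 1)\<close> of \<open>p\<close>, and they converge to \<open>p\<close>.\<close>

lemma lam_locally_close:
  assumes p: "p \<in> pos_orthant V" and k: "k \<in> V" "1 < p k" and "0 < e"
  obtains \<delta> where "0 < \<delta>"
    and "\<And>w. w \<in> V \<rightarrow>\<^sub>E UNIV \<Longrightarrow> (\<And>l. l \<in> V \<Longrightarrow> \<bar>w l - p l\<bar> < \<delta>) \<Longrightarrow>
      w \<in> pos_orthant V \<and> 1 < w k \<and> \<bar>lam w - lam p\<bar> < e"
proof (rule ccontr)
  assume no: "\<not> thesis"
  let ?ok = "\<lambda>w. w \<in> pos_orthant V \<and> 1 < w k \<and> \<bar>lam w - lam p\<bar> < e"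
  have "\<exists>w. w \<in> V \<rightarrow>\<^sub>E UNIV \<and> (\<forall>l\<in>V. \<bar>w l - p l\<bar> < 1 / real (Suc n)) \<and> \<not> ?ok w" for n
  proof (rule ccontr)
    assume none: "\<not> ?thesis"
    have thesis
    proof (rule that)
      show "0 < 1 / real (Suc n)" by simp
      show "?ok w" if "w \<in> V \<rightarrow>\<^sub>E UNIV" "\<And>l. l \<in> V \<Longrightarrow> \<bar>w l - p l\<bar> < 1 / real (Suc n)" for w
        using none that by blast
    qed
    with no show False ..
  qed
  then obtain w where w: "\<And>n. w n \<in> V \<rightarrow>\<^sub>E UNIV" "\<And>n l. l \<in> V \<Longrightarrow> \<bar>w n l - p l\<bar> < 1 / real (Suc n)"
    "\<And>n. \<not> ?ok (w n)"
    by metis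
  have coord: "(\<lambda>n. w n l) \<longlonglongrightarrow> p l" for l
  proof (cases "l \<in> V")
    case True
    have "(\<lambda>n. w n l - p l) \<longlonglongrightarrow> 0"
      by (rule Lim_null_comparison[OF _ LIMSEQ_inverse_real_of_nat])
        (use w(2)[OF True] in \<open>auto simp: inverse_eq_divide less_imp_le\<close>)
    then show ?thesis by (simp add: LIM_zero_iff)
  next
    case False
    then have "w n l = p l" for n using PiE_arb[OF w(1)] PiE_arb[OF p] by simp
    then show ?thesis by simp
  qed
  have "eventually (\<lambda>n. \<forall>l\<in>V. 0 < w n l) sequentially"
  proof (rule eventually_ball_finite)
    show "\<forall>l\<in>V. eventually (\<lambda>n. 0 < w n l) sequentially"
      using order_tendstoD(1)[OF coord] PiE_mem[OF p] by (simp del: atLeastAtMost_iff)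
  qed simp
  then have pos: "eventually (\<lambda>n. w n \<in> pos_orthant V) sequentially"
    by eventually_elim (use w(1) in \<open>auto simp: PiE_iff\<close>)
  then have "eventually (\<lambda>n. w n \<in> orthant V) sequentially"
    by eventually_elim (use pos_orthant_subset_orthant in blast)
  then have "(\<lambda>n. lam (w n)) \<longlonglongrightarrow> lam p"
    using pos_orthant_subset_orthant p
    by (intro continuous_on_tendsto_compose[OF lam_continuous tendsto_coordinatewise[OF coord]]) auto
  then have "eventually (\<lambda>n. \<bar>lam (w n) - lam p\<bar> < e) sequentially"
    using \<open>0 < e\<close> by (auto dest!: tendstoD simp: dist_real_def)
  moreover have "eventually (\<lambda>n. 1 < w n k) sequentially"
    using order_tendstoD(1)[OF coord k(2)] .
  ultimately have "eventually (\<lambda>n. ?ok (w n)) sequentially"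
    using pos by eventually_elim blast
  from eventually_happens'[OF sequentially_bot this] w(3) show False by blast
qed

end

text \<open>\<open>Q\<close> integrates \<open>g\<close> over a square of side
  \<open>2 * \<delta>\<close> centred at \<open>(a, b)\<close> in the coordinates \<open>i\<close>
  and \<open>j\<close>, hence the area \<open>4 * \<delta>\<^sup>2\<close>.\<close>

lemma coord_integral_box_bounds:
  fixes g :: "(nat \<Rightarrow> real) \<Rightarrow> ennreal"
  assumes "i \<noteq> j" "0 < \<delta>"
    and g: "\<And>z. \<bar>z i - a\<bar> < \<delta> \<Longrightarrow> \<bar>z j - b\<bar> < \<delta> \<Longrightarrow>
      ennreal lo \<le> g (override_on w z {i, j}) \<and> g (override_on w z {i, j}) \<le> ennreal hi"
  defines "Q \<equiv> coord_integral {i, j} (\<lambda>x. g x *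
    (indicator {a - \<delta><..<a + \<delta>} (x i) * indicator {b - \<delta><..<b + \<delta>} (x j))) w"
  shows "ennreal lo * ennreal (4 * \<delta>\<^sup>2) \<le> Q" "Q \<le> ennreal hi * ennreal (4 * \<delta>\<^sup>2)"
proof -
  let ?c = "\<lambda>l. if l = i then a else b"
  let ?B = "\<Pi>\<^sub>E l\<in>{i, j}. {?c l - \<delta><..<?c l + \<delta>}"
  have B: "?B \<in> sets (lebesgue_on_coords {i, j})" by (rule sets_PiM_I_finite) auto
  have "emeasure (lebesgue_on_coords {i, j}) ?B = ennreal (\<Prod>l\<in>{i, j}. (?c l + \<delta>) - (?c l - \<delta>))"
    by (rule emeasure_coords_box) (use assms(2) in auto)
  also have "(\<Prod>l\<in>{i, j}. (?c l + \<delta>) - (?c l - \<delta>)) = 4 * \<delta>\<^sup>2"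
    using assms(1) by (simp add: power2_eq_square)
  finally have m: "emeasure (lebesgue_on_coords {i, j}) ?B = ennreal (4 * \<delta>\<^sup>2)" .
  have ind: "indicator {a - \<delta><..<a + \<delta>} (z i) * indicator {b - \<delta><..<b + \<delta>} (z j) = (indicator ?B z :: ennreal)"
    if "z \<in> {i, j} \<rightarrow>\<^sub>E UNIV" for z
    using that assms(1) by (auto simp: indicator_def PiE_iff)
  have Q: "Q = (\<integral>\<^sup>+ z. g (override_on w z {i, j}) * indicator ?B z \<partial>lebesgue_on_coords {i, j})"
    unfolding Q_def coord_integral_def
  proof (rule nn_integral_cong)
    fix z assume "z \<in> space (lebesgue_on_coords {i, j})"
    then have "z \<in> {i, j} \<rightarrow>\<^sub>E UNIV" by simp
    from ind[OF this] show "g (override_on w z {i, j}) *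
        (indicator {a - \<delta><..<a + \<delta>} (override_on w z {i, j} i) *
         indicator {b - \<delta><..<b + \<delta>} (override_on w z {i, j} j)) =
      g (override_on w z {i, j}) * indicator ?B z" by simp
  qed
  have close: "\<bar>z i - a\<bar> < \<delta>" "\<bar>z j - b\<bar> < \<delta>" if "z \<in> ?B" for z
    using PiE_mem[OF that, of i] PiE_mem[OF that, of j] assms(1) by (auto simp: abs_less_iff)
  have "ennreal lo * ennreal (4 * \<delta>\<^sup>2) = (\<integral>\<^sup>+ z. ennreal lo * indicator ?B z \<partial>lebesgue_on_coords {i, j})"
    using B by (simp add: nn_integral_cmult_indicator m)
  also have "\<dots> \<le> Q"
    unfolding Q using g close by (intro nn_integral_mono) (auto simp: indicator_def simp del: PiE_iff)
  finally show "ennreal lo * ennreal (4 * \<delta>\<^sup>2) \<le> Q" .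
  have "Q \<le> (\<integral>\<^sup>+ z. ennreal hi * indicator ?B z \<partial>lebesgue_on_coords {i, j})"
    unfolding Q using g close by (intro nn_integral_mono) (auto simp: indicator_def simp del: PiE_iff)
  also have "\<dots> = ennreal hi * ennreal (4 * \<delta>\<^sup>2)"
    using B by (simp add: nn_integral_cmult_indicator m)
  finally show "Q \<le> ennreal hi * ennreal (4 * \<delta>\<^sup>2)" .
qed

context pareto_vector
begin

text \<open>If the product inequality were strict at some point, it would persist on small boxes around
  that point by continuity, which contradicts the almost sure identity for integrals over boxes.\<close>

lemma cond_indep_coords_no_excess:
  assumes ij: "i \<in> V" "j \<in> V" "i \<noteq> j" and k: "k \<in> V"
    and ci: "cond_indep_coords (cond_exceed M Y k) Y {i} {j} (V - {i, j})"
    and y: "y \<in> pos_orthant V" "1 < y k" and z: "z \<in> pos_orthant V" "1 < z k"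
  shows "lam y * lam (override_on y z {i, j}) \<le> lam (override_on y z {i}) * lam (override_on y z {j})"
proof (rule ccontr)
  let ?p = "\<lambda>J. override_on y z J"
  let ?l = "\<lambda>J. lam (?p J)"
  have p: "?p J \<in> pos_orthant V" "1 < ?p J k" if "J \<subseteq> V" for J
    using override_on_pos_orthant[OF y(1) z(1) that] y(2) z(2) by (auto simp: override_on_def)
  have sub: "{} \<subseteq> V" "{i, j} \<subseteq> V" "{i} \<subseteq> V" "{j} \<subseteq> V" using ij by blast+
  have lp: "0 < ?l J" if "J \<subseteq> V" for J using lam_pos[OF p(1)[OF that]] .
  assume "\<not> ?thesis"
  then have excess: "?l {i} * ?l {j} < ?l {} * ?l {i, j}" by simp
  \<comment> \<open>The excess is continuous in the perturbation \<open>e\<close>, so it stays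
    positive for small \<open>e > 0\<close>. Keeping \<open>e\<close> below the values at
    \<open>y\<close> and at the doubly replaced point makes the lower bounds positive, as needed to
    return from \<open>ennreal\<close> to reals.\<close>
  have "((\<lambda>e. (?l {} - e) * (?l {i, j} - e) - (?l {i} + e) * (?l {j} + e)) \<longlongrightarrow>
      (?l {} - 0) * (?l {i, j} - 0) - (?l {i} + 0) * (?l {j} + 0)) (at_right 0)"
    by (intro tendsto_intros)
  from order_tendstoD(1)[OF this, of 0] excess
  have "eventually (\<lambda>e. 0 < (?l {} - e) * (?l {i, j} - e) - (?l {i} + e) * (?l {j} + e)) (at_right 0)" by simp
  moreover have "eventually (\<lambda>e. e < min (?l {}) (?l {i, j})) (at_right 0)"
    using lp[OF sub(1)] lp[OF sub(2)] by (intro eventually_at_right_less[THEN eventually_mono] order_tendstoD(2)[OF tendsto_ident_at]) auto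
  moreover have "eventually (\<lambda>e::real. 0 < e) (at_right 0)" by (rule eventually_at_right_less)
  ultimately have "eventually (\<lambda>e. 0 < e \<and> e < min (?l {}) (?l {i, j}) \<and>
      (?l {i} + e) * (?l {j} + e) < (?l {} - e) * (?l {i, j} - e)) (at_right 0)"
    by eventually_elim simp
  from eventually_happens'[OF trivial_limit_at_right_real this]
  obtain e where e_all: "0 < e \<and> e < min (?l {}) (?l {i, j}) \<and>
      (?l {i} + e) * (?l {j} + e) < (?l {} - e) * (?l {i, j} - e)" by blast
  then have e: "0 < e" "e < ?l {}" "e < ?l {i, j}"
    and gap: "(?l {i} + e) * (?l {j} + e) < (?l {} - e) * (?l {i, j} - e)"
    by linarith+
  have "\<exists>\<delta>>0. \<forall>w \<in> V \<rightarrow>\<^sub>E UNIV. (\<forall>l\<in>V. \<bar>w l - ?p J l\<bar> < \<delta>) \<longrightarrow>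
      w \<in> pos_orthant V \<and> 1 < w k \<and> \<bar>lam w - ?l J\<bar> < e" if "J \<subseteq> V" for J
    by (rule lam_locally_close[OF p(1)[OF that] k p(2)[OF that] e(1)]) blast
  then obtain D where D: "\<And>J. J \<subseteq> V \<Longrightarrow> 0 < D J"
    "\<And>J w. J \<subseteq> V \<Longrightarrow> w \<in> V \<rightarrow>\<^sub>E UNIV \<Longrightarrow> (\<And>l. l \<in> V \<Longrightarrow> \<bar>w l - ?p J l\<bar> < D J) \<Longrightarrow>
      w \<in> pos_orthant V \<and> 1 < w k \<and> \<bar>lam w - ?l J\<bar> < e"
    by metis
  define \<delta> where "\<delta> = Min (D ` {{}, {i}, {j}, {i, j}})"
  have \<delta>: "0 < \<delta>" "\<delta> \<le> D {}" "\<delta> \<le> D {i}" "\<delta> \<le> D {j}" "\<delta> \<le> D {i, j}"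
    unfolding \<delta>_def using D(1)[OF sub(1)] D(1)[OF sub(2)] D(1)[OF sub(3)] D(1)[OF sub(4)]
    by (auto simp: Min_gr_iff)
  have near: "exceed_density k w = ennreal (lam w) \<and> \<bar>lam w - ?l J\<bar> < e"
    if "J \<subseteq> V" "\<delta> \<le> D J" "w \<in> V \<rightarrow>\<^sub>E UNIV" "\<And>l. l \<in> V \<Longrightarrow> \<bar>w l - ?p J l\<bar> < \<delta>" for J w
  proof -
    have "\<bar>w l - ?p J l\<bar> < D J" if "l \<in> V" for l using \<open>\<delta> \<le> D J\<close> \<open>\<And>l. l \<in> V \<Longrightarrow> \<bar>w l - ?p J l\<bar> < \<delta>\<close>[OF that] by simp
    from D(2)[OF \<open>J \<subseteq> V\<close> \<open>w \<in> V \<rightarrow>\<^sub>E UNIV\<close> this]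
    show ?thesis by (simp add: exceed_density_def lam_int_eq)
  qed
  define Q where "Q a b = coord_integral {i, j} (\<lambda>x. exceed_density k x *
    (indicator {a - \<delta><..<a + \<delta>} (x i) * indicator {b - \<delta><..<b + \<delta>} (x j)))" for a b
  let ?P = "\<lambda>w. Q (y i) (y j) w * Q (z i) (z j) w = Q (y i) (z j) w * Q (z i) (y j) w"
  have Qm [measurable]: "Q a b \<in> borel_measurable (lebesgue_on_coords V)" for a b
    unfolding Q_def
  proof (rule measurable_coord_integral[OF _ sub(2)])
    have [measurable]: "(\<lambda>x. x i) \<in> borel_measurable (lebesgue_on_coords V)" "(\<lambda>x. x j) \<in> borel_measurable (lebesgue_on_coords V)"
      using measurable_component_singleton[OF ij(1), of "\<lambda>_. lborel"] measurable_component_singleton[OF ij(2), of "\<lambda>_. lborel"] by simp_all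
    note exceed_density_measurable[OF k, measurable]
    show "(\<lambda>x. exceed_density k x * (indicator {a - \<delta><..<a + \<delta>} (x i) * indicator {b - \<delta><..<b + \<delta>} (x j)))
        \<in> borel_measurable (lebesgue_on_coords V)" by measurable
  qed simp
  have "AE \<omega> in cond_exceed M Y k. ?P (Y \<omega>)"
    unfolding Q_def
    by (rule cond_indep_coords_pair_AE[OF prob_space_exceed[OF k] _ Diff_subset distributed_exceed[OF k] ij(1,2) refl ci]) simp_all
  moreover have "{w \<in> space (lebesgue_on_coords V). ?P w} \<in> sets (lebesgue_on_coords V)"
    by measurable
  moreover have "Y \<in> measurable (cond_exceed M Y k) (lebesgue_on_coords V)"
    and law: "distr (cond_exceed M Y k) (lebesgue_on_coords V) Y = density (lebesgue_on_coords V) (exceed_density k)"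
    using distributed_exceed[OF k] by (simp_all only: distributed_def)
  ultimately have "AE w in density (lebesgue_on_coords V) (exceed_density k). ?P w"
    unfolding law[symmetric] by (subst AE_distr_iff)
  then have "AE w in lebesgue_on_coords V. 0 < exceed_density k w \<longrightarrow> ?P w"
    by (subst (asm) AE_density[OF exceed_density_measurable[OF k]])
  \<comment> \<open>The identity holds only almost surely, so \<open>y\<close> is exchanged for a
    nearby \<open>w\<close> at which it holds. The entries of \<open>w\<close> at \<open>i\<close>
    and \<open>j\<close> are integrated out; the others approximate those of all four corner points,
    which agree there.\<close>
  from AE_ex_in_box[OF _ _ this, of "\<lambda>l. y l - \<delta>" "\<lambda>l. y l + \<delta>"] \<delta>(1)
  obtain w where w: "w \<in> (\<Pi>\<^sub>E l\<in>V. {y l - \<delta><..<y l + \<delta>})" and P: "0 < exceed_density k w \<Longrightarrow> ?P w"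
    by auto
  have wV: "w \<in> V \<rightarrow>\<^sub>E UNIV" using w by (auto simp: PiE_iff)
  have wy: "\<bar>w l - y l\<bar> < \<delta>" if "l \<in> V" for l
    using PiE_mem[OF w that] by (auto simp: abs_less_iff)
  \<comment> \<open>The set \<open>J\<close> names the corner: its coordinates come from
    \<open>z\<close>, those of \<open>{i, j} - J\<close> from \<open>y\<close>. The first and last
    corner need lower bounds, the mixed ones upper bounds.\<close>
  have nearJ: "ennreal (?l J - e) \<le> exceed_density k (override_on w x {i, j}) \<and>
      exceed_density k (override_on w x {i, j}) \<le> ennreal (?l J + e)"
    if "J \<subseteq> {i, j}" "\<delta> \<le> D J" "\<bar>x i - ?p J i\<bar> < \<delta>" "\<bar>x j - ?p J j\<bar> < \<delta>" for J x
  proof -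
    have "exceed_density k (override_on w x {i, j}) = ennreal (lam (override_on w x {i, j})) \<and>
        \<bar>lam (override_on w x {i, j}) - ?l J\<bar> < e"
    proof (rule near[OF _ that(2)])
      show "J \<subseteq> V" using that(1) sub(2) by blast
      show "override_on w x {i, j} \<in> V \<rightarrow>\<^sub>E UNIV" by (rule override_on_PiE[OF wV sub(2)]) simp
      show "\<bar>override_on w x {i, j} l - ?p J l\<bar> < \<delta>" if "l \<in> V" for l
      proof (cases "l \<in> {i, j}")
        case True
        then show ?thesis using \<open>\<bar>x i - ?p J i\<bar> < \<delta>\<close> \<open>\<bar>x j - ?p J j\<bar> < \<delta>\<close> by (auto simp: override_on_def)
      next
        case False
        then show ?thesis using \<open>J \<subseteq> {i, j}\<close> wy[OF that] by (auto simp: override_on_def)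
      qed
    qed
    then show ?thesis by (auto intro!: ennreal_leI)
  qed
  have "0 < exceed_density k w"
    using near[OF sub(1) \<delta>(2) wV] wy e(2) by fastforce
  then have P: "?P w" by (rule P)
  have pij: "?p {} i = y i" "?p {} j = y j" "?p {i, j} i = z i" "?p {i, j} j = z j"
    "?p {i} i = z i" "?p {i} j = y j" "?p {j} i = y i" "?p {j} j = z j"
    using ij(3) by (simp_all add: override_on_def)
  note box = coord_integral_box_bounds[OF ij(3) \<delta>(1), where g="exceed_density k" and w=w]
  let ?m = "ennreal (4 * \<delta>\<^sup>2)"
  have 00: "ennreal (?l {} - e) * ?m \<le> Q (y i) (y j) w"
    unfolding Q_def by (rule box(1)[where hi="?l {} + e"], rule nearJ) (use \<delta> in \<open>auto simp: pij\<close>)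
  have 11: "ennreal (?l {i, j} - e) * ?m \<le> Q (z i) (z j) w"
    unfolding Q_def by (rule box(1)[where hi="?l {i, j} + e"], rule nearJ) (use \<delta> in \<open>auto simp: pij\<close>)
  have 10: "Q (z i) (y j) w \<le> ennreal (?l {i} + e) * ?m"
    unfolding Q_def by (rule box(2)[where lo="?l {i} - e"], rule nearJ) (use \<delta> in \<open>auto simp: pij\<close>)
  have 01: "Q (y i) (z j) w \<le> ennreal (?l {j} + e) * ?m"
    unfolding Q_def by (rule box(2)[where lo="?l {j} - e"], rule nearJ) (use \<delta> in \<open>auto simp: pij\<close>)
  have "(ennreal (?l {} - e) * ?m) * (ennreal (?l {i, j} - e) * ?m) \<le> Q (y i) (y j) w * Q (z i) (z j) w"
    by (rule mult_mono[OF 00 11]) simp_all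
  also have "\<dots> = Q (y i) (z j) w * Q (z i) (y j) w" by (rule P)
  also have "\<dots> \<le> (ennreal (?l {j} + e) * ?m) * (ennreal (?l {i} + e) * ?m)"
    by (rule mult_mono[OF 01 10]) simp_all
  finally have le: "(ennreal (?l {} - e) * ?m) * (ennreal (?l {i, j} - e) * ?m) \<le>
      (ennreal (?l {j} + e) * ?m) * (ennreal (?l {i} + e) * ?m)" .
  have conv: "a * m * (b * m) \<le> c * m * (c' * m)"
    if "0 \<le> a" "0 \<le> b" "0 \<le> c" "0 \<le> c'" "0 \<le> m"
      "ennreal a * ennreal m * (ennreal b * ennreal m) \<le> ennreal c * ennreal m * (ennreal c' * ennreal m)"
    for a b c c' m :: real
    using that by (simp add: ennreal_mult[symmetric])
  have "((?l {} - e) * (4 * \<delta>\<^sup>2)) * ((?l {i, j} - e) * (4 * \<delta>\<^sup>2)) \<le>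
      ((?l {j} + e) * (4 * \<delta>\<^sup>2)) * ((?l {i} + e) * (4 * \<delta>\<^sup>2))"
    by (rule conv[OF _ _ _ _ _ le]) (use e lp[OF sub(3)] lp[OF sub(4)] in auto)
  then have "((?l {} - e) * (?l {i, j} - e)) * ((4 * \<delta>\<^sup>2) * (4 * \<delta>\<^sup>2)) \<le>
      ((?l {i} + e) * (?l {j} + e)) * ((4 * \<delta>\<^sup>2) * (4 * \<delta>\<^sup>2))"
    by (simp only: mult_ac)
  moreover have "0 < (4 * \<delta>\<^sup>2) * (4 * \<delta>\<^sup>2)" using \<delta>(1) by simp
  ultimately have "(?l {} - e) * (?l {i, j} - e) \<le> (?l {i} + e) * (?l {j} + e)"
    by (rule mult_right_le_imp_le)
  with gap show False by (meson leD)
qed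

lemma pairwise_markov_lam_splits:
  assumes "pairwise_markov d E M Y"
  shows "lam_splits E"
  unfolding lam_splits_def
proof (intro ballI impI, elim conjE)
  fix i j assume ij: "i \<in> V" "j \<in> V" "i \<noteq> j" and "(i, j) \<notin> E"
  then have ci: "cond_indep_coords (cond_exceed M Y i) Y {i} {j} (V - {i, j})"
    using assms unfolding pairwise_markov_def extremal_cond_indep_def by blast
  have sub: "{i} \<subseteq> V" "{j} \<subseteq> V" using ij by blast+
  show "splits_on V lam {i} {j}"
  proof (rule splits_on_lam_if_far[OF sub ij(1)])
    fix y z assume yz: "y \<in> pos_orthant V" "z \<in> pos_orthant V" "1 < y i" "1 < z i"
    \<comment> \<open>Exchanging the \<open>i\<close>-th coordinates of \<open>y\<close> and
      \<open>z\<close> interchanges the two products, so the same inequality for the new points is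
      the opposite inequality for the old ones.\<close>
    let ?y = "override_on y z {i}" and ?z = "override_on z y {i}"
    have "lam y * lam (override_on y z {i, j}) \<le> lam (override_on y z {i}) * lam (override_on y z {j})"
      by (rule cond_indep_coords_no_excess[OF ij ij(1) ci yz(1,3,2,4)])
    moreover have "lam ?y * lam (override_on ?y ?z {i, j}) \<le> lam (override_on ?y ?z {i}) * lam (override_on ?y ?z {j})"
      using yz by (intro cond_indep_coords_no_excess[OF ij ij(1) ci] override_on_pos_orthant sub) simp_all
    moreover have "override_on ?y ?z {i, j} = override_on y z {j}" "override_on ?y ?z {i} = y"
      "override_on ?y ?z {j} = override_on y z {i, j}"
      using ij(3) by (auto simp: override_on_def fun_eq_iff)
    moreover have "{i} \<union> {j} = {i, j}" by blast
    ultimately show "splits_at lam {i} {j} y z"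
      unfolding splits_at_def by (simp only: mult.commute order.antisym)
  qed
qed

end

section \<open>Factorization over cliques and separators\<close>

lemma prod_mset_separators:
  "(\<Prod>D\<in>#separators Cs. f D) = (\<Prod>l\<in>{1..<length Cs}. f (separator Cs l))" for f :: "nat set \<Rightarrow> real"
  by (simp add: separators_def prod_unfold_prod_mset multiset.map_comp comp_def)

lemma separator_subset: "separator Cs l \<subseteq> Cs ! l"
  by (simp add: separator_def)

locale pareto_graph = pareto_model +
  fixes E :: "(nat \<times> nat) set" and Cs :: "nat set list"
  assumes graph: "undirected_graph V E" and cliques: "clique_sequence V E Cs"
begin

lemma prod_cliques: "(\<Prod>C\<in>set Cs. f C) = (\<Prod>l<length Cs. f (Cs ! l))" for f :: "nat set \<Rightarrow> real"
  using cliques by (intro prod.reindex_bij_betw[symmetric] bij_betw_nth) (auto simp: clique_sequence_def)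

lemmas clique_subset = clique_nth_subset[OF graph cliques]

lemma clique_nonempty:
  assumes "l < length Cs"
  shows "Cs ! l \<noteq> {}"
proof
  assume "Cs ! l = {}"
  then have "{} \<in> cliques V E" using clique_nth[OF graph cliques assms] by simp
  moreover have "complete_subset V E {1}" using d by (simp add: complete_subset_def)
  ultimately show False unfolding cliques_def by blast
qed

lemma cliques_nonempty: "0 < length Cs"
proof (rule ccontr)
  assume "\<not> ?thesis"
  then have "V = {}" using initial_union_all[OF graph cliques] by simp
  then show False using d by simp
qed

definition clique_marginals :: "(nat \<Rightarrow> real) \<Rightarrow> real" where
  "clique_marginals y = (\<Prod>C\<in>set Cs. marginal_density d lam C (restrict y C))"

definition separator_marginals :: "(nat \<Rightarrow> real) \<Rightarrow> real" where
  "separator_marginals y = (\<Prod>D\<in>#separators Cs. marginal_density d lam D (restrict y D))"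

lemma splits_on_marginal_density:
  assumes "i \<notin> I \<or> j \<notin> I"
  shows "splits_on V (\<lambda>y. marginal_density d lam I (restrict y I)) {i} {j}"
proof -
  have "splits_on V (\<lambda>y. marginal_density d lam I (restrict y I)) {i} {j}" if "i \<notin> I" for i j
  proof (rule splits_on_indep)
    fix y z :: "nat \<Rightarrow> real"
    have "restrict (override_on y z {i}) I = restrict y I"
      using that by (auto simp: override_on_def fun_eq_iff)
    then show "marginal_density d lam I (restrict (override_on y z {i}) I) = marginal_density d lam I (restrict y I)"
      by simp
  qed
  then show ?thesis using assms splits_on_symm by blast
qed

lemma separator_marginals_pos:
  assumes "y \<in> pos_orthant V"
  shows "0 < separator_marginals y"
  unfolding separator_marginals_def prod_mset_separators
proof (rule prod_pos)
  fix l assume "l \<in> {1..<length Cs}"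
  then have sub: "separator Cs l \<subseteq> V" using separator_subset clique_subset[of l] by fastforce
  show "0 < marginal_density d lam (separator Cs l) (restrict y (separator Cs l))"
  proof (cases "separator Cs l = {}")
    case True
    then show ?thesis by (simp add: marginal_density_def)
  next
    case False
    have "restrict y (separator Cs l) \<in> pos_orthant (separator Cs l)"
      using assms sub by (auto simp: PiE_iff)
    then show ?thesis by (rule marginal_density_pos[OF sub False])
  qed
qed

text \<open>No clique, and hence no separator, contains two non-adjacent vertices, so every factor
  of the quotient ignores one of them and splits. The formula is available on
  \<open>pareto_space\<close> only; homogeneity removes this restriction.\<close>

lemma density_factorizes_lam_splits:
  assumes "density_factorizes d Cs \<Lambda> lam"
  shows "lam_splits E"
  unfolding lam_splits_def
proof (intro ballI impI, elim conjE)
  fix i j assume ij: "i \<in> V" "j \<in> V" "i \<noteq> j" and no: "(i, j) \<notin> E"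
  have sub: "{i} \<subseteq> V" "{j} \<subseteq> V" using ij by blast+
  have sep: "i \<notin> Cs ! l \<or> j \<notin> Cs ! l" if "l < length Cs" for l
    using clique_nth_complete[OF graph cliques that] ij no by blast
  have "splits_on V clique_marginals {i} {j}"
    unfolding clique_marginals_def[abs_def] prod_cliques
    by (intro splits_on_prod splits_on_marginal_density sep) simp
  moreover have "splits_on V separator_marginals {i} {j}"
    unfolding separator_marginals_def[abs_def] prod_mset_separators
  proof (intro splits_on_prod splits_on_marginal_density)
    fix l assume "l \<in> {1..<length Cs}"
    then show "i \<notin> separator Cs l \<or> j \<notin> separator Cs l"
      using sep[of l] separator_subset[of Cs l] by auto
  qed
  ultimately have quot: "splits_on V (\<lambda>y. clique_marginals y / separator_marginals y) {i} {j}"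
    by (rule splits_on_divide)
  have lam: "lam y = clique_marginals y / separator_marginals y" if y: "y \<in> pos_orthant V" "1 < y i" for y
  proof -
    have space: "y \<in> pareto_space d"
      using y ij(1) unfolding pareto_space_iff by (auto simp: PiE_iff less_imp_le simp del: atLeastAtMost_iff)
    have "separator_marginals y \<noteq> 0" using separator_marginals_pos[OF y(1)] by simp
    with space have "pareto_density d \<Lambda> lam y = 1 / mass * (clique_marginals y / separator_marginals y)"
      using assms unfolding density_factorizes_def clique_marginals_def separator_marginals_def by blast
    then show ?thesis using lam_eq_density[OF space] mass_pos by simp
  qed
  show "splits_on V lam {i} {j}"
  proof (rule splits_on_lam_if_far[OF sub ij(1)])
    fix y z assume yz: "y \<in> pos_orthant V" "z \<in> pos_orthant V" "1 < y i" "1 < z i"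
    have "lam (override_on y z J) = clique_marginals (override_on y z J) / separator_marginals (override_on y z J)"
      if "J \<subseteq> V" for J
      using yz by (intro lam override_on_pos_orthant that) (auto simp: override_on_def)
    from this[of "{}"] this[of "{i}"] this[of "{j}"] this[of "{i} \<union> {j}"] sub quot yz
    show "splits_at lam {i} {j} y z"
      unfolding splits_on_def splits_at_def by (metis override_on_emptyset empty_subsetI Un_least)
  qed
qed

section \<open>Removing the cliques one after the other\<close>

lemma coord_integral_marg:
  assumes "J \<subseteq> I" "I \<subseteq> V" "y \<in> V \<rightarrow>\<^sub>E UNIV"
  shows "coord_integral J (marg I) y = marg (I - J) y"
proof -
  have "V - (I - J) = J \<union> (V - I)" using assms by blast
  moreover have "coord_integral (J \<union> (V - I)) lam_int y = coord_integral J (coord_integral (V - I) lam_int) y"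
    by (rule coord_integral_union[OF _ _ _ _ assms(3) lam_int_measurable]) (use assms in auto)
  ultimately show ?thesis by (simp only: marg_def)
qed

lemma marg_restrict: "marg I (restrict y V) = marg I y"
  unfolding marg_def by (rule coord_integral_cong) (rule lam_int_restrict_override)

lemma marg_zero:
  assumes "i \<in> I" "I \<subseteq> V" "y i \<le> 0"
  shows "marg I y = 0"
proof -
  have "lam_int (override_on y z (V - I)) = 0" for z
  proof -
    have "override_on y z (V - I) i \<le> 0" "i \<in> V" using assms by (auto simp: override_on_def)
    then show ?thesis unfolding lam_int_def by (meson not_less)
  qed
  then show ?thesis unfolding marg_def coord_integral_def by simp
qed

lemma marg_finite: "I \<subseteq> V \<Longrightarrow> I \<noteq> {} \<Longrightarrow> y \<in> pos_orthant V \<Longrightarrow> marg I y < \<infinity>"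
  unfolding marg_def by (rule coord_integral_lam_int_finite)

lemma marg_pos:
  assumes "I \<subseteq> V" "I \<noteq> {}" "y \<in> pos_orthant V"
  shows "0 < enn2real (marg I y)"
proof -
  have "restrict y I \<in> pos_orthant I" using assms by (auto simp: PiE_iff)
  from marginal_density_pos[OF assms(1,2) this] show ?thesis
    by (simp only: marginal_density_marg[OF assms])
qed

lemma splits_on_marg_indep:
  assumes "i \<notin> I \<or> j \<notin> I" "I \<subseteq> V" "I \<noteq> {}" "{i} \<subseteq> V" "{j} \<subseteq> V"
  shows "splits_on V (\<lambda>y. enn2real (marg I y)) {i} {j}"
  by (rule splits_on_cong[OF marginal_density_marg[OF assms(2,3)] assms(4,5) splits_on_marginal_density[OF assms(1)]])

abbreviation "clique_union \<equiv> initial_union Cs"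

lemma clique_union_Suc: "clique_union (Suc l) = clique_union l \<union> Cs ! l"
  by (auto simp: lessThan_Suc)

lemma clique_union_subset: "l \<le> length Cs \<Longrightarrow> clique_union l \<subseteq> V"
  by (rule initial_union_subset[OF graph cliques])

lemma clique_union_nonempty:
  assumes "1 \<le> l" "l \<le> length Cs"
  shows "clique_union l \<noteq> {}"
proof -
  have "Cs ! 0 \<subseteq> clique_union l" using assms(1) by (intro UN_upper) simp
  then show ?thesis using clique_nonempty[OF cliques_nonempty] by blast
qed

text \<open>\<open>R\<close> consists of the vertices that are new in clique \<open>l\<close>, and
  \<open>A\<close> of the earlier ones outside that clique; no edge joins them. Integrating the
  splitting of the larger marginal over \<open>R\<close>, \<open>A\<close> and
  \<open>R \<union> A\<close> leaves exactly the marginals on the earlier union, the clique and the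
  separator.\<close>

lemma marg_peel:
  assumes split: "\<And>a c. a \<in> clique_union (Suc l) \<Longrightarrow> c \<in> clique_union (Suc l) \<Longrightarrow> a \<noteq> c \<Longrightarrow> (a, c) \<notin> E \<Longrightarrow>
      splits_on V (\<lambda>y. enn2real (marg (clique_union (Suc l)) y)) {a} {c}"
    and l: "1 \<le> l" "l < length Cs" and y: "y \<in> pos_orthant V"
  shows "separator Cs l \<noteq> {}"
    and "enn2real (marg (clique_union (Suc l)) y) * enn2real (marg (separator Cs l) y) =
      enn2real (marg (clique_union l) y) * enn2real (marg (Cs ! l) y)"
proof -
  let ?W = "clique_union (Suc l)" and ?D = "separator Cs l"
  define R where "R = Cs ! l - ?D"
  define A where "A = clique_union l - ?D"
  have W: "?W \<subseteq> V" "?W \<noteq> {}" using clique_union_subset[of "Suc l"] clique_union_nonempty[of "Suc l"] l by auto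
  have C: "Cs ! l \<subseteq> V" "Cs ! l \<noteq> {}" using clique_subset clique_nonempty l by auto
  have U: "clique_union l \<subseteq> V" "clique_union l \<noteq> {}"
    using clique_union_subset[of l] clique_union_nonempty[of l] l by auto
  have sub: "R \<subseteq> ?W" "A \<subseteq> ?W" "R \<inter> A = {}"
    unfolding R_def A_def clique_union_Suc separator_def by blast+
  have diffs: "?W - R = clique_union l" "?W - A = Cs ! l" "?W - (R \<union> A) = ?D"
    unfolding R_def A_def clique_union_Suc separator_def by blast+
  have pairs: "splits_on V (\<lambda>y. enn2real (marg ?W y)) {r} {a}" if "r \<in> R" "a \<in> A" for r a
  proof (rule split)
    show "(r, a) \<notin> E"
      using residual_nonadjacent[OF graph cliques l(2)] that unfolding R_def A_def by blast
  qed (use that sub in blast)+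
  have sets: "splits_on V (\<lambda>y. enn2real (marg ?W y)) R A"
  proof (rule splits_on_sets)
    show "0 < enn2real (marg ?W y)" if "y \<in> pos_orthant V" for y by (rule marg_pos[OF W that])
    show "R \<subseteq> V" "A \<subseteq> V" using sub W(1) by blast+
  qed (simp, rule pairs)
  have at: "splits_at (marg ?W) R A y z" for z
  proof (rule splits_at_extend[OF sets sub(1,2) W(1) sub(3)])
    show "marg ?W y \<noteq> \<infinity>" if "y \<in> pos_orthant V" for y using marg_finite[OF W that] by simp
    show "marg ?W (restrict y V) = marg ?W y" for y by (rule marg_restrict)
    show "marg ?W y = 0" if "i \<in> ?W" "y i \<le> 0" for y i by (rule marg_zero[of i _ y, OF that(1) W(1) that(2)])
    show "0 < y i" if "i \<in> V - ?W" for i using PiE_mem[OF y, of i] that by simp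
  qed
  have yU: "y \<in> V \<rightarrow>\<^sub>E UNIV" using y by (auto simp: PiE_iff)
  have meas: "marg ?W \<in> borel_measurable (lebesgue_on_coords V)"
    unfolding marg_def by (rule measurable_coord_integral[OF _ _ lam_int_measurable]) auto
  have "marg ?W y * coord_integral (R \<union> A) (marg ?W) y = coord_integral R (marg ?W) y * coord_integral A (marg ?W) y"
    using sub W(1) by (intro coord_integral_splits[OF _ _ _ sub(3) yU meas at]) auto
  then have eq: "marg ?W y * marg ?D y = marg (clique_union l) y * marg (Cs ! l) y"
    using coord_integral_marg[OF _ W(1) yU, of R] coord_integral_marg[OF _ W(1) yU, of A]
      coord_integral_marg[OF _ W(1) yU, of "R \<union> A"] sub unfolding diffs by simp
  show "?D \<noteq> {}"
  proof
    assume "?D = {}"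
    \<comment> \<open>The marginal on no coordinates is the infinite total mass, while the product
      on the other side of \<open>eq\<close> is finite.\<close>
    then have "marg ?D y = \<infinity>" using coord_integral_all_infinite by (simp add: marg_def)
    moreover have "marg ?W y \<noteq> 0" using marg_pos[OF W y] by auto
    moreover have "marg (clique_union l) y * marg (Cs ! l) y < \<infinity>"
      using marg_finite[OF U y] marg_finite[OF C y] by (simp add: ennreal_mult_less_top)
    ultimately show False using eq by (simp add: ennreal_mult_top)
  qed
  show "enn2real (marg ?W y) * enn2real (marg ?D y) = enn2real (marg (clique_union l) y) * enn2real (marg (Cs ! l) y)"
    using arg_cong[OF eq, of enn2real] by (simp only: enn2real_mult)
qed

text \<open>Downward induction from the whole vertex set. By \<open>marg_peel\<close> the smaller
  marginal is a quotient: the larger one splits by the induction hypothesis, and the clique and the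
  separator cannot contain both \<open>a\<close> and \<open>c\<close>.\<close>

lemma splits_on_marg_clique_union:
  assumes E: "lam_splits E" and l: "1 \<le> l" "l \<le> length Cs"
    and ac: "a \<in> clique_union l" "c \<in> clique_union l" "a \<noteq> c" "(a, c) \<notin> E"
  shows "splits_on V (\<lambda>y. enn2real (marg (clique_union l) y)) {a} {c}"
  using l(2,1) ac
proof (induction l arbitrary: a c rule: inc_induct)
  case base
  have V: "clique_union (length Cs) = V" by (rule initial_union_all[OF graph cliques])
  have "splits_on V lam {a} {c}"
    using E base V unfolding lam_splits_def by blast
  then show ?case
    unfolding V
    by (rule splits_on_cong[rotated 3]) (use base V lam_pos in \<open>auto simp: marg_def lam_int_eq less_imp_le\<close>)
next
  case (step l)
  let ?W = "clique_union (Suc l)" and ?D = "separator Cs l"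
  have l: "1 \<le> l" "l < length Cs" using step by auto
  have sub: "clique_union l \<subseteq> ?W" unfolding clique_union_Suc by blast
  have C: "Cs ! l \<subseteq> V" "Cs ! l \<noteq> {}" using clique_subset clique_nonempty l by auto
  have acV: "{a} \<subseteq> V" "{c} \<subseteq> V" using step.prems(2,3) clique_union_subset[of l] l by auto
  have split: "splits_on V (\<lambda>y. enn2real (marg ?W y)) {a} {c}"
    if "a \<in> ?W" "c \<in> ?W" "a \<noteq> c" "(a, c) \<notin> E" for a c
    using that by (intro step.IH) auto
  have y1: "(\<lambda>i\<in>V. 1) \<in> pos_orthant V" by auto
  \<comment> \<open>Non-emptiness is what identifies \<open>marg ?D\<close> with a marginal density;
    for the empty set the two differ.\<close>
  have D: "?D \<noteq> {}" "?D \<subseteq> V"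
    using marg_peel(1)[OF split l y1] separator_subset[of Cs l] C by auto
  have notC: "a \<notin> Cs ! l \<or> c \<notin> Cs ! l"
    using clique_nth_complete[OF graph cliques l(2)] step.prems by blast
  then have notD: "a \<notin> ?D \<or> c \<notin> ?D" using separator_subset[of Cs l] by blast
  have quot: "splits_on V (\<lambda>y. enn2real (marg ?W y) * enn2real (marg ?D y) / enn2real (marg (Cs ! l) y)) {a} {c}"
    using step.prems sub
    by (intro splits_on_divide splits_on_mult split splits_on_marg_indep notC notD C D acV) auto
  show ?case
  proof (rule splits_on_cong[OF _ acV quot])
    fix y assume y: "y \<in> pos_orthant V"
    show "enn2real (marg ?W y) * enn2real (marg ?D y) / enn2real (marg (Cs ! l) y) = enn2real (marg (clique_union l) y)"
      using marg_peel(2)[OF split l y] marg_pos[OF C y] by simp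
  qed
qed

lemma separator_nonempty:
  assumes "lam_splits E" "1 \<le> l" "l < length Cs"
  shows "separator Cs l \<noteq> {}"
proof (rule marg_peel(1)[OF _ assms(2,3), of "\<lambda>i\<in>V. 1"])
  show "splits_on V (\<lambda>y. enn2real (marg (clique_union (Suc l)) y)) {a} {c}"
    if "a \<in> clique_union (Suc l)" "c \<in> clique_union (Suc l)" "a \<noteq> c" "(a, c) \<notin> E" for a c
    using that assms by (intro splits_on_marg_clique_union) auto
qed auto

lemma marg_product:
  assumes "lam_splits E" "1 \<le> l" "l \<le> length Cs" and y: "y \<in> pos_orthant V"
  shows "enn2real (marg (clique_union l) y) * (\<Prod>m\<in>{1..<l}. enn2real (marg (separator Cs m) y)) =
    (\<Prod>m<l. enn2real (marg (Cs ! m) y))"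
  using assms(2,3)
proof (induction l rule: dec_induct)
  case base
  have "clique_union 1 = Cs ! 0" by auto
  then show ?case by simp
next
  case (step l)
  have split: "splits_on V (\<lambda>y. enn2real (marg (clique_union (Suc l)) y)) {a} {c}"
    if "a \<in> clique_union (Suc l)" "c \<in> clique_union (Suc l)" "a \<noteq> c" "(a, c) \<notin> E" for a c
    using that assms step by (intro splits_on_marg_clique_union) auto
  have peel: "enn2real (marg (clique_union (Suc l)) y) * enn2real (marg (separator Cs l) y) =
      enn2real (marg (clique_union l) y) * enn2real (marg (Cs ! l) y)"
    by (rule marg_peel(2)[OF split _ _ y]) (use step in auto)
  have "(\<Prod>m\<in>{1..<Suc l}. enn2real (marg (separator Cs m) y)) =
      enn2real (marg (separator Cs l) y) * (\<Prod>m\<in>{1..<l}. enn2real (marg (separator Cs m) y))"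
    using step(1) by (simp add: mult.commute)
  then have "enn2real (marg (clique_union (Suc l)) y) * (\<Prod>m\<in>{1..<Suc l}. enn2real (marg (separator Cs m) y)) =
      (enn2real (marg (clique_union (Suc l)) y) * enn2real (marg (separator Cs l) y)) *
      (\<Prod>m\<in>{1..<l}. enn2real (marg (separator Cs m) y))"
    by (simp only: mult.assoc)
  also have "\<dots> = (enn2real (marg (clique_union l) y) * (\<Prod>m\<in>{1..<l}. enn2real (marg (separator Cs m) y))) *
      enn2real (marg (Cs ! l) y)"
    unfolding peel by (simp only: mult_ac)
  also have "\<dots> = (\<Prod>m<Suc l. enn2real (marg (Cs ! m) y))"
    using step by simp
  finally show ?case .
qed

lemma lam_eq_quotient:
  assumes E: "lam_splits E" and y: "y \<in> pos_orthant V"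
  shows "lam y = clique_marginals y / separator_marginals y"
proof -
  have n: "1 \<le> length Cs" using cliques_nonempty by linarith
  have V: "clique_union (length Cs) = V" by (rule initial_union_all[OF graph cliques])
  have sep: "separator_marginals y = (\<Prod>m\<in>{1..<length Cs}. enn2real (marg (separator Cs m) y))"
    unfolding separator_marginals_def prod_mset_separators
  proof (rule prod.cong[OF refl])
    fix l assume "l \<in> {1..<length Cs}"
    then have l: "1 \<le> l" "l < length Cs" by auto
    show "marginal_density d lam (separator Cs l) (restrict y (separator Cs l)) = enn2real (marg (separator Cs l) y)"
      by (rule marginal_density_marg[OF _ separator_nonempty[OF E l] y])
        (use separator_subset[of Cs l] clique_subset[OF l(2)] in blast)
  qed
  have cl: "clique_marginals y = (\<Prod>m<length Cs. enn2real (marg (Cs ! m) y))"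
    unfolding clique_marginals_def prod_cliques
    by (intro prod.cong refl marginal_density_marg[OF clique_subset clique_nonempty y]) simp_all
  have "enn2real (marg V y) = lam y"
    using lam_pos[OF y] by (simp add: marg_def lam_int_eq[OF y])
  then have "lam y * separator_marginals y = clique_marginals y"
    using marg_product[OF E n order_refl y] unfolding V sep cl by simp
  then show ?thesis using separator_marginals_pos[OF y] by (simp add: field_simps)
qed


text \<open>A separator equal to \<open>V\<close> would make its clique all of \<open>V\<close>,
  which contains the first clique and so equals it by maximality, against distinctness. Properness
  allows \<open>marginal_density_origin\<close> to be applied to separators.\<close>

lemma separator_proper:
  assumes "1 \<le> l" "l < length Cs"
  shows "separator Cs l \<noteq> V"
proof
  assume "separator Cs l = V"
  then have "Cs ! 0 \<subseteq> Cs ! l" using separator_subset[of Cs l] clique_subset[OF cliques_nonempty] by blast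
  moreover have "complete_subset V E (Cs ! l)" "Cs ! 0 \<in> cliques V E"
    using clique_nth[OF graph cliques] assms(2) cliques_nonempty by (auto simp: cliques_def)
  ultimately have "Cs ! l = Cs ! 0" unfolding cliques_def by blast
  moreover have "distinct Cs" using cliques by (simp add: clique_sequence_def)
  ultimately show False using assms nth_eq_iff_index_eq[of Cs l 0] cliques_nonempty by simp
qed

text \<open>If no separator marginal vanishes, then \<open>y\<close> is non-zero on every separator and hence on every
  clique, so that all marginals are evaluated at points of continuity.\<close>

lemma separator_marginals_nonzero:
  assumes E: "lam_splits E" and y: "y \<in> pareto_space d" and nz: "separator_marginals y \<noteq> 0"
  shows "1 \<le> l \<Longrightarrow> l < length Cs \<Longrightarrow> restrict y (separator Cs l) \<in> orthant (separator Cs l)"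
    and "l < length Cs \<Longrightarrow> restrict y (Cs ! l) \<in> orthant (Cs ! l)"
proof -
  have yV: "y \<in> V \<rightarrow>\<^sub>E {0..}" using y by (simp add: pareto_space_iff)
  have enlarge: "restrict y J \<in> orthant J" if "restrict y I \<in> orthant I" "I \<subseteq> J" "J \<subseteq> V" for I J
  proof -
    from that(1) obtain i where "i \<in> I" "0 < y i" by (auto simp: orthant_iff)
    moreover have "restrict y J \<in> J \<rightarrow>\<^sub>E {0..}" using PiE_mem[OF yV] that(3) by auto
    ultimately show ?thesis using that(2) by (auto simp: orthant_iff)
  qed
  have sep: "restrict y (separator Cs l) \<in> orthant (separator Cs l)" if l: "1 \<le> l" "l < length Cs" for l
  proof (rule ccontr)
    let ?D = "separator Cs l"
    assume no: "\<not> ?thesis"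
    have D: "?D \<subseteq> V" using separator_subset[of Cs l] clique_subset[OF l(2)] by blast
    then have "restrict y ?D \<in> ?D \<rightarrow>\<^sub>E {0..}" using PiE_mem[OF yV] by auto
    with no have "restrict y ?D = (\<lambda>i\<in>?D. 0)" by (simp add: orthant_def)
    then have "marginal_density d lam ?D (restrict y ?D) = 0"
      using marginal_density_origin[OF D separator_nonempty[OF E l] separator_proper[OF l]] by simp
    moreover have "l \<in> {1..<length Cs}" using l by simp
    ultimately have "separator_marginals y = 0"
      unfolding separator_marginals_def prod_mset_separators
      by (intro prod_zero) (auto simp del: atLeastLessThan_iff)
    with nz show False ..
  qed
  then show "1 \<le> l \<Longrightarrow> l < length Cs \<Longrightarrow> restrict y (separator Cs l) \<in> orthant (separator Cs l)" .
  show "restrict y (Cs ! l) \<in> orthant (Cs ! l)" if l: "l < length Cs"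
  proof (cases "1 \<le> l")
    case True
    show ?thesis by (rule enlarge[OF sep[OF True l] separator_subset clique_subset[OF l]])
  next
    \<comment> \<open>The first clique has no separator of its own. It contains the separator of the
      next clique, unless it is the only clique and equals \<open>V\<close>.\<close>
    case False
    then have l0: "l = 0" by simp
    show ?thesis
    proof (cases "length Cs = 1")
      case True
      then have "clique_union 1 = V" using initial_union_all[OF graph cliques] by metis
      moreover have "clique_union 1 = Cs ! 0" by auto
      ultimately have "Cs ! 0 = V" by blast
      moreover have "restrict y V = y" using yV by (simp add: PiE_iff extensional_restrict)
      moreover have "y \<in> orthant V" using y pareto_space_subset by blast
      ultimately show ?thesis unfolding l0 by (simp only:)
    next
      case False
      then have 1: "1 < length Cs" using l by linarith
      have "separator Cs 1 \<subseteq> Cs ! 0" by (auto simp: separator_def)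
      then show ?thesis unfolding l0
        by (rule enlarge[OF sep[OF order_refl 1] _ clique_subset[OF cliques_nonempty]])
    qed
  qed
qed

lemma lam_splits_density_factorizes:
  assumes E: "lam_splits E"
  shows "density_factorizes d Cs \<Lambda> lam"
proof -
  have quotient: "pareto_density d \<Lambda> lam y = 1 / mass * (clique_marginals y / separator_marginals y)"
    if y: "y \<in> pareto_space d" and nz: "separator_marginals y \<noteq> 0" for y
  proof -
    \<comment> \<open>Raising every coordinate by \<open>1 / (n + 1)\<close> approaches a possible
      boundary point \<open>y\<close> from inside the open orthant without leaving
      \<open>pareto_space\<close>; the formula holds along this sequence.\<close>
    define x where "x n = (\<lambda>i\<in>V. y i + 1 / real (Suc n))" for n
    have yV: "y \<in> V \<rightarrow>\<^sub>E {0..}" using y by (simp add: pareto_space_iff)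
    obtain k where k: "k \<in> V" "1 < y k" using y by (auto simp: pareto_space_iff simp del: atLeastAtMost_iff)
    have x_pos: "x n \<in> pos_orthant V" for n
    proof -
      have "0 < y i + 1 / real (Suc n)" if "i \<in> V" for i
        using PiE_mem[OF yV that] by (simp add: add_nonneg_pos)
      then show ?thesis unfolding x_def by auto
    qed
    have x_space: "x n \<in> pareto_space d" for n
    proof -
      have "1 < x n k" using k by (simp add: x_def add_pos_nonneg less_le_trans del: of_nat_Suc)
      moreover have "x n \<in> V \<rightarrow>\<^sub>E {0..}" using x_pos[of n] by (auto simp: PiE_iff less_imp_le)
      ultimately show ?thesis using k(1) unfolding pareto_space_iff by blast
    qed
    have coord: "(\<lambda>n. x n i) \<longlonglongrightarrow> y i" for i
    proof (cases "i \<in> V")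
      case True
      have "(\<lambda>n. y i + inverse (real (Suc n))) \<longlonglongrightarrow> y i + 0"
        by (intro tendsto_add tendsto_const LIMSEQ_inverse_real_of_nat)
      then show ?thesis using True by (simp add: x_def inverse_eq_divide)
    next
      case False
      then have "x n i = y i" for n using PiE_arb[OF yV False] by (simp only: x_def restrict_apply if_False)
      then show ?thesis by simp
    qed
    have marginal_lim: "(\<lambda>n. marginal_density d lam I (restrict (x n) I)) \<longlonglongrightarrow> marginal_density d lam I (restrict y I)"
      if I: "I \<subseteq> V" "I \<noteq> {}" "restrict y I \<in> orthant I" for I
    proof (rule continuous_on_tendsto_compose[OF marginal_density_continuous[OF I(1,2)] _ I(3)])
      show "(\<lambda>n. restrict (x n) I) \<longlonglongrightarrow> restrict y I"
        by (rule tendsto_coordinatewise) (use coord in \<open>auto simp: restrict_def\<close>)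
      have "restrict (x n) I \<in> orthant I" for n
        using I(1,2) PiE_mem[OF x_pos[of n]] by (auto simp: orthant_iff less_imp_le subset_eq)
      then show "eventually (\<lambda>n. restrict (x n) I \<in> orthant I) sequentially" by simp
    qed
    have "(\<lambda>n. clique_marginals (x n)) \<longlonglongrightarrow> clique_marginals y"
      unfolding clique_marginals_def prod_cliques
      by (intro tendsto_prod marginal_lim clique_subset clique_nonempty separator_marginals_nonzero(2)[OF E y nz]) simp_all
    moreover have "(\<lambda>n. separator_marginals (x n)) \<longlonglongrightarrow> separator_marginals y"
      unfolding separator_marginals_def prod_mset_separators
    proof (intro tendsto_prod)
      fix l assume "l \<in> {1..<length Cs}"
      then have l: "1 \<le> l" "l < length Cs" by auto
      show "(\<lambda>n. marginal_density d lam (separator Cs l) (restrict (x n) (separator Cs l)))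
          \<longlonglongrightarrow> marginal_density d lam (separator Cs l) (restrict y (separator Cs l))"
        using separator_subset[of Cs l] clique_subset[OF l(2)]
        by (intro marginal_lim separator_nonempty[OF E l] separator_marginals_nonzero(1)[OF E y nz l]) blast
    qed
    ultimately have "(\<lambda>n. 1 / mass * (clique_marginals (x n) / separator_marginals (x n))) \<longlonglongrightarrow>
        1 / mass * (clique_marginals y / separator_marginals y)"
      using nz by (intro tendsto_mult tendsto_const tendsto_divide)
    then have "(\<lambda>n. pareto_density d \<Lambda> lam (x n)) \<longlonglongrightarrow> 1 / mass * (clique_marginals y / separator_marginals y)"
      unfolding lam_eq_quotient[OF E x_pos, symmetric] lam_eq_density[OF x_space] using mass_pos by simp
    moreover have "(\<lambda>n. pareto_density d \<Lambda> lam (x n)) \<longlonglongrightarrow> pareto_density d \<Lambda> lam y"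
      by (rule continuous_on_tendsto_compose[OF density_cont tendsto_coordinatewise[OF coord] y]) (simp add: x_space)
    ultimately show ?thesis by (rule LIMSEQ_unique[rotated])
  qed
  show ?thesis
    unfolding density_factorizes_def
  proof (intro conjI allI ballI impI; (elim conjE)?)
    fix I y assume "I \<subseteq> V" "I \<noteq> {}" "y \<in> pos_orthant I"
    then show "0 < marginal_density d lam I y" by (rule marginal_density_pos)
  next
    fix I assume I: "I \<subseteq> V" "I \<noteq> {}"
    show "continuous_on (orthant I) (marginal_density d lam I)"
      by (rule marginal_density_continuous[OF I])
    show "homogeneous I (- (real (card I) + 1)) (marginal_density d lam I)"
      by (rule marginal_density_homogeneous[OF I])
  next
    fix y assume "y \<in> pareto_space d" "(\<Prod>D\<in>#separators Cs. marginal_density d lam D (restrict y D)) \<noteq> 0"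
    then show "pareto_density d \<Lambda> lam y =
        1 / mass * ((\<Prod>C\<in>set Cs. marginal_density d lam C (restrict y C)) /
          (\<Prod>D\<in>#separators Cs. marginal_density d lam D (restrict y D)))"
      using quotient[of y] unfolding clique_marginals_def separator_marginals_def by blast
  qed
qed

end

theorem theorem1:
  fixes d :: nat and E :: "(nat \<times> nat) set" and Cs :: "nat set list"
    and \<Lambda> :: "(nat \<Rightarrow> real) measure" and lam :: "(nat \<Rightarrow> real) \<Rightarrow> real"
    and M :: "'a measure" and Y :: "'a \<Rightarrow> nat \<Rightarrow> real"
  assumes "2 \<le> d"
    and "undirected_graph {1..d} E"
    and "decomposable {1..d} E"
    and "clique_sequence {1..d} E Cs"
    and "exponent_measure d \<Lambda> lam"
    and "multivariate_pareto d \<Lambda> lam M Y"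
    and "\<forall>y \<in> pareto_space d. (\<forall>i\<in>{1..d}. 0 < y i) \<longrightarrow> 0 < pareto_density d \<Lambda> lam y"
    and "continuous_on (pareto_space d) (pareto_density d \<Lambda> lam)"
  shows "(pairwise_markov d E M Y \<longleftrightarrow> global_markov d E M Y) \<and>
         (global_markov d E M Y \<longleftrightarrow> density_factorizes d Cs \<Lambda> lam) \<and>
         (pairwise_markov d E M Y \<or> global_markov d E M Y \<or> density_factorizes d Cs \<Lambda> lam
            \<longrightarrow> connected_graph {1..d} E)"
proof -
  interpret pareto_vector d \<Lambda> lam M Y
    by unfold_locales (fact assms)+
  interpret pareto_graph d \<Lambda> lam E Cs
    by unfold_locales (fact assms)+
  have "pairwise_markov d E M Y \<longleftrightarrow> lam_splits E" "global_markov d E M Y \<longleftrightarrow> lam_splits E"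
    using pairwise_markov_lam_splits lam_splits_global_markov global_markov_pairwise_markov by blast+
  moreover have "density_factorizes d Cs \<Lambda> lam \<longleftrightarrow> lam_splits E"
    using density_factorizes_lam_splits lam_splits_density_factorizes by blast
  ultimately show ?thesis
    using lam_splits_connected by blast
qed

end
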